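(* Let $0<x<1$, $0<r<1$, $0<s<2$. Let $\mu\in\{0,1\}$, consider the $\mathcal E_2$ Fock module $\mathcal F_\mu(v)$, and choose any $k,l\in\mathbb Z$. The operators $\mathsf G_{\nu,N}$ preserve the bosonic Fock space $\mathcal F_{k,l}$, and the operators $G_{\nu,N}$ preserve the subspace $\mathcal F_{\mu,k}(v):=\mathcal H\otimes e^{(k+\mu/2)\bar\alpha_1}$ of $\mathcal F_\mu(v)$. Put $$q_1=x^{2-s},\quad q_2=x^{-2},\quad q_3=x^{s},\qquad p=x^{2r},\quad \bar p_1\,q^{-H_{1,0}}=x^{-2\hat\pi},$$ and identify $\mathcal F_{k,l}$ with $\mathcal F_{\mu,k}(v)$ as vector spaces by matching the oscillators, for $m>0$, $$\tfrac1{[m]}H^\perp_{1,-m}=\tfrac1m(-x^{-sm}\beta^1_{-m}+x^{sm}\beta^2_{-m}),\qquad \tfrac1{[m]}\tfrac{[(r-1)m]}{[rm]}H^\perp_{1,m}=\tfrac1m(-x^{sm}\beta^1_m+x^{-sm}\beta^2_m),$$ $$\tfrac1{[m]}H^\perp_{0,-m}=\tfrac1m(\beta^1_{-m}-\beta^2_{-m}),\qquad \tfrac1{[m]}\tfrac{[(r-1)m]}{[rm]}H^\perp_{0,m}=\tfrac1m(\beta^1_m-\beta^2_m).$$ Under this identification, the elliptic non-local integrals of motion $\mathsf G_{\nu,N}$ acting in $\mathcal F_{k,l}$ and the coefficients $G_{\nu,N}$ of the $\mathcal E_2$ transfer matrix acting in $\mathcal F_{\mu,k}(v)$ (with the same $\nu\in\{0,1\}$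 and $N$) coincide.
   Context: Here $[a]=(x^a-x^{-a})/(x-x^{-1})=(q^a-q^{-a})/(q-q^{-1})$ with $q=x^{-1}$. Notation: $(z;p)_\infty=\prod_{k\ge0}(1-p^kz)$, $(z_1,\dots,z_l;p)_\infty=\prod_j(z_j;p)_\infty$, $\Theta_p(z)=(z,p/z,p;p)_\infty$, $\Theta_p(z_1,\dots,z_k)=\prod_j\Theta_p(z_j)$, $\vartheta_\nu(z,p)=\sum_{n\in\mathbb Z+\nu/2}p^{n^2}z^{2n}$. Elliptic non-local integrals of motion $\mathsf G_{\nu,N}$. Oscillators $\beta^1_m,\beta^2_m$ ($m\ne0$): $[\beta^i_m,\beta^i_n]=\delta_{m+n,0}\,m\frac{[(r-1)m]}{[rm]}\frac{[(s-1)m]}{[sm]}$ and $[\beta^i_m,\beta^j_n]=-\delta_{m+n,0}\,m\frac{[(r-1)m]}{[rm]}\frac{[m]}{[sm]}x^{sm\,\mathrm{sgn}(i-j)}$ ($i\ne j$). Zero modes: $[P,\sqrt{-1}Q]=2$, $\hat\pi=\sqrt{r(r-1)}P$. For integers $a,b$, $\mathcal F_{a,b}$ is the Fock space generated by $\beta^i_{-m}$ ($i=1,2$, $m>0$) over the vacuum $|a,b\rangle=e^{(a\sqrt{r/(r-1)}-b\sqrt{(r-1)/r})\frac{\sqrt{-1}}2Q}|0,0\rangle$, on which $P$ acts by the scalar $a\sqrt{r/(r-1)}-b\sqrt{(r-1)/r}$; the scalar by which $\hat\pi$ acts is denoted by the same letter. Screening currents: $\mathsf F_0(z)=e^{-\sqrt{-1}\sqrt{(r-1)/r}\,Q}z^{-\hat\pi/r+(r-1)/r}:\exp\bigl(\sum_{m\ne0}\frac1m(-x^{sm}\beta^1_m+x^{-sm}\beta^2_m)z^{-m}\bigr):$,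 $\mathsf F_1(z)=e^{\sqrt{-1}\sqrt{(r-1)/r}\,Q}z^{\hat\pi/r+(r-1)/r}:\exp\bigl(\sum_{m\ne0}\frac1m(\beta^1_m-\beta^2_m)z^{-m}\bigr):$. With $[u]_r=x^{u^2/r-u}\Theta_{x^{2r}}(x^{2u})/(x^{2r};x^{2r})_\infty$, $\vartheta_\nu(u)=x^{\frac{2u^2}r-\frac{2\hat\pi u}r}\vartheta_\nu(x^{2u-\hat\pi},x^{2r})$, $z_j=x^{2u_j}$, $w_j=x^{2v_j}$: $$\mathsf G_{\nu,N}=\int\!\!\cdots\!\!\int\prod_{j=1}^N\frac{dz_j}{2\pi\sqrt{-1}z_j}\frac{dw_j}{2\pi\sqrt{-1}w_j}\,\mathsf F_1(z_1)\cdots\mathsf F_1(z_N)\mathsf F_0(w_1)\cdots\mathsf F_0(w_N)\,\frac{\prod_{i<j}[u_j-u_i]_r[u_j-u_i-1]_r[v_j-v_i]_r[v_j-v_i-1]_r}{\prod_{i,j=1}^N[v_j-u_i-\frac s2]_r[v_j-u_i+\frac s2-1]_r}\,\vartheta_\nu\Bigl(\sum_{j=1}^N(u_j-v_j)\Bigr),$$ with contours the unit circles. $\mathcal E_2$ side. $q_2=q^2$, $q_1=q^{-1}d$, $q_3=q^{-1}d^{-1}$. The Fock module $\mathcal F_\mu(v)$ ($v\in\mathbb C^\times$) of the quantum toroidal algebra $\mathcal E_2$ is realized on $\mathcal H\otimes\mathbb C[\mathbb Z\bar\alpha_1]e^{\mu\bar\alpha_1/2}$, $\mathcal H=\mathbb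 C[H^\perp_{i,-m}\mid m>0,\ i=0,1]$, $(\bar\alpha_1,\bar\alpha_1)=2$, $\bar\alpha_0=-\bar\alpha_1$, where $[H^\perp_{i,m},H^\perp_{j,n}]=\delta_{m+n,0}\,a_{i,j}(m)[m]$, $a_{i,i}(m)=[2m]/m$, $a_{0,1}(m)=a_{1,0}(m)=-\frac{[m]}m(d^m+d^{-m})$, and $z^{H_{i,0}}(w\otimes e^\beta)=z^{(\bar\alpha_i,\beta)}w\otimes e^\beta$. The dressed currents act by $\hat F_i^\perp(z)=F_i^\perp(z)\prod_{\ell\ge0}\bar K_i^{+,\perp}(p^{-\ell}z)^{-1}$ with $\bar K_i^{+,\perp}(z)=\exp((q-q^{-1})\sum_{m>0}H^\perp_{i,m}z^{-m})$ and $F_i^\perp(z)=c_i\exp\bigl(-\sum_{m>0}\frac1{[m]}H^\perp_{i,-m}z^m\bigr)\exp\bigl(\sum_{m>0}\frac{q^m}{[m]}H^\perp_{i,m}z^{-m}\bigr)\otimes e^{-\bar\alpha_i}z^{-H_{i,0}+1}$, $c_0c_1=q_1v$. With twisting parameters $\bar p,\bar p_1$ and $p=\bar pq^{-1}$, $$G_{\nu,N}=\int\!\!\cdots\!\!\int\hat F_0^\perp(x_{0,1})\cdots\hat F_0^\perp(x_{0,N})\hat F_1^\perp(x_{1,1})\cdots\hat F_1^\perp(x_{1,N})\,\frac{\prod_{t=0,1}\prod_{i<j}\Theta_p(x_{t,j}/x_{t,i},q_2x_{t,j}/x_{t,i})}{\prod_{i,j}\Theta_p(q_1^{-1}x_{1,j}/x_{0,i},q_3^{-1}x_{1,j}/x_{0,i})}$$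 $$\times\prod_{i=1}^N(x_{0,i}x_{1,i})^{N-2i+1}\Bigl(\prod_{i=1}^N\frac{x_{1,i}}{x_{0,i}}\Bigr)^Np^{-\nu/4}\vartheta_\nu\Bigl(\bar p_1^{1/2}q^{-H_{1,0}/2}\prod_{i=1}^N\frac{x_{1,i}}{x_{0,i}},p\Bigr)\prod_{t,j}\frac{dx_{t,j}}{2\pi\sqrt{-1}x_{t,j}}$$ (contours $|x_{t,j}|=1$ when $|q_1|,|q_3|<1$, analytic continuation otherwise). These are the operators in the expansion $T_\nu(u)=\sum_{N\ge0}(q_1u)^{-N}c_NG_{\nu,N}$, $c_N=\frac1{N!^2}(q-q^{-1})^{2N}(p;p)_\infty^{2N-2}(p,q_2^{-1}p;p)_\infty^{2N}$, of the $\mathcal E_2$ transfer matrix $T_\nu(u)=\mathrm{Tr}_{\mathcal F_\nu(u),1}((\bar p^{\,d^\perp}\bar p_1^{-\bar\Lambda_1})_1\mathcal R_{12})q^{d^\perp}$ ($\mathcal R$ the universal $R$-matrix, $d^\perp$ the degree operator, $\bar\Lambda_1=\frac12H_{1,0}$).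
   Formalization: As printed the coincidence fails (G scales as v^N). Here the relation for p̄_1 is p̄_1(p q^{-1})^{H_{1,0}}=x^{2π̂}, the elliptic operator has index ν+μ mod 2 in place of ν, and the operators coincide up to an explicit nonzero constant. *)

theory Defs
  imports
    "HOL-Complex_Analysis.Complex_Analysis"
    "HOL-Library.Multiset"
    "HOL-Library.Poly_Mapping"
begin

section \<open>Special functions\<close>

definition qnum :: "real \<Rightarrow> real \<Rightarrow> real" where
  "qnum x a = (x powr a - x powr (- a)) / (x - inverse x)"

definition qpoch :: "complex \<Rightarrow> complex \<Rightarrow> complex" where
  "qpoch z p = prodinf (\<lambda>k. 1 - p ^ k * z)"

definition Theta :: "complex \<Rightarrow> complex \<Rightarrow> complex" where
  "Theta p z = qpoch z p * qpoch (p / z) p * qpoch p p"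

text \<open>The summation index \<open>n\<close> running over \<open>\<int> + \<nu>/2\<close> is written \<open>n = m + \<nu>/2\<close>,
  so that \<open>z\<close> only carries the integer exponents \<open>2 n\<close>.\<close>

definition vtheta :: "int \<Rightarrow> complex \<Rightarrow> real \<Rightarrow> complex" where
  "vtheta \<nu> z p =
     (\<Sum>\<^sub>\<infinity>m::int. of_real (p powr ((of_int m + of_int \<nu> / 2)\<^sup>2)) * z powi (2 * m + \<nu>))"


section \<open>Fock spaces\<close>

text \<open>The monoid algebra of the free commutative monoid on the variables \<open>(i, n)\<close>, i.e.\ the
  polynomial ring in these variables. The variable \<open>(i, n)\<close> is the oscillator of species \<open>i\<close>
  and mode \<open>- (n + 1)\<close>; the shift excludes a mode 0. The vacuum is \<open>1\<close>.\<close>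

type_synonym 'i fock = "('i \<times> nat) multiset \<Rightarrow>\<^sub>0 complex"

definition scal :: "complex \<Rightarrow> 'i fock \<Rightarrow> 'i fock" where
  "scal c f = Poly_Mapping.map ((*) c) f"

definition create :: "'i \<times> nat \<Rightarrow> 'i fock \<Rightarrow> 'i fock" where
  "create a f = Poly_Mapping.single {#a#} 1 * f"

text \<open>The partial derivative with respect to the variable \<open>a\<close>.\<close>

definition annih :: "'i \<times> nat \<Rightarrow> 'i fock \<Rightarrow> 'i fock" where
  "annih a f = (\<Sum>b\<in>Poly_Mapping.keys f.
     Poly_Mapping.single (b - {#a#}) (of_nat (count b a) * Poly_Mapping.lookup f b))"

text \<open>The operator \<open>a\<^sub>i\<^sub>,\<^sub>m\<close> of the Heisenberg algebra
  \<open>[a\<^sub>i\<^sub>,\<^sub>m, a\<^sub>j\<^sub>,\<^sub>n] = \<delta>\<^sub>m\<^sub>+\<^sub>n\<^sub>,\<^sub>0 \<kappa> i j m\<close>; see \<open>osc_commutator\<close> below.\<close>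

definition osc :: "('i::finite \<Rightarrow> 'i \<Rightarrow> int \<Rightarrow> complex) \<Rightarrow> 'i \<Rightarrow> int \<Rightarrow> 'i fock \<Rightarrow> 'i fock" where
  "osc \<kappa> i m f =
     (if m < 0 then create (i, nat (- m) - 1) f
      else if m > 0 then \<Sum>j\<in>UNIV. scal (\<kappa> i j m) (annih (j, nat m - 1) f)
      else 0)"

lemma lookup_scal [simp]: "Poly_Mapping.lookup (scal c f) b = c * Poly_Mapping.lookup f b"
  by (simp add: scal_def Poly_Mapping.map.rep_eq when_def)

lemma lookup_create:
  "Poly_Mapping.lookup (create a f) b = (if a \<in># b then Poly_Mapping.lookup f (b - {#a#}) else 0)"
proof -
  have "Poly_Mapping.lookup (create a f) b =
      (\<Sum>l. (1 when {#a#} = l) * (\<Sum>q. Poly_Mapping.lookup f q when b = l + q))"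
    by (simp add: create_def times_poly_mapping.rep_eq prod_fun_def lookup_single)
  also have "\<dots> = (\<Sum>l. (\<Sum>q. Poly_Mapping.lookup f q when b = l + q) when l = {#a#})"
    by (intro Sum_any.cong) (auto simp: when_def)
  also have "\<dots> = (\<Sum>q. Poly_Mapping.lookup f q when b = {#a#} + q)"
    by simp
  also have "\<dots> = (if a \<in># b then Poly_Mapping.lookup f (b - {#a#}) else 0)"
  proof (cases "a \<in># b")
    case True
    then have "(b = {#a#} + q) = (q = b - {#a#})" for q by auto
    then show ?thesis using True by simp
  next
    case False
    then have "\<not> (b = {#a#} + q)" for q by auto
    then show ?thesis using False by simp
  qed
  finally show ?thesis .
qed

lemma lookup_annih:
  "Poly_Mapping.lookup (annih a f) b =
     of_nat (Suc (count b a)) * Poly_Mapping.lookup f (add_mset a b)"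
proof -
  have "Poly_Mapping.lookup (annih a f) b =
      (\<Sum>c\<in>Poly_Mapping.keys f. of_nat (count c a) * Poly_Mapping.lookup f c when c - {#a#} = b)"
    by (simp add: annih_def lookup_sum lookup_single)
  also have "\<dots> = (\<Sum>c\<in>Poly_Mapping.keys f.
      if c = add_mset a b then of_nat (count c a) * Poly_Mapping.lookup f c else 0)"
  proof (intro sum.cong refl)
    fix c assume "c \<in> Poly_Mapping.keys f"
    show "(of_nat (count c a) * Poly_Mapping.lookup f c when c - {#a#} = b) =
        (if c = add_mset a b then of_nat (count c a) * Poly_Mapping.lookup f c else 0)"
    proof (cases "a \<in># c")
      case True
      then have "(c - {#a#} = b) = (c = add_mset a b)" by auto
      then show ?thesis by (simp add: when_def)
    next
      case False
      then show ?thesis by (auto simp: when_def not_in_iff)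
    qed
  qed
  also have "\<dots> = of_nat (Suc (count b a)) * Poly_Mapping.lookup f (add_mset a b)"
    by (simp add: sum.delta in_keys_iff)
  finally show ?thesis .
qed

lemma annih_create:
  "annih a (create b f) - create b (annih a f) = (if a = b then f else 0)"
proof (rule poly_mapping_eqI)
  fix c
  show "Poly_Mapping.lookup (annih a (create b f) - create b (annih a f)) c =
      Poly_Mapping.lookup (if a = b then f else 0) c"
  proof (cases "b \<in># c")
    case True
    then obtain e where c: "c = add_mset b e" by (meson multi_member_split)
    have e: "add_mset a (add_mset b e) - {#b#} = add_mset a e"
      by (metis add_mset_commute add_mset_remove_trivial)
    show ?thesis
      by (simp add: c e lookup_minus lookup_annih lookup_create algebra_simps)
  next
    case False
    moreover have "count c b = 0" using False by (simp add: not_in_iff)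
    ultimately show ?thesis
      by (auto simp: lookup_minus lookup_annih lookup_create)
  qed
qed

lemma create_commute: "create a (create b f) = create b (create a f)"
  by (simp add: create_def mult.left_commute)

lemma annih_commute: "annih a (annih b f) = annih b (annih a f)"
  by (rule poly_mapping_eqI) (auto simp: lookup_annih add_mset_commute)

lemma scal_simps:
  "scal c (f + g) = scal c f + scal c g"
  "scal c (sum F A) = (\<Sum>a\<in>A. scal c (F a))"
  "create b (scal c f) = scal c (create b f)"
  "annih b (scal c f) = scal c (annih b f)"
  "create b (sum F A) = (\<Sum>a\<in>A. create b (F a))"
  "annih b (sum F A) = (\<Sum>a\<in>A. annih b (F a))"
  "scal c (scal c' f) = scal (c * c') f"
  "scal c f - scal c g = scal c (f - g)"
  by (rule poly_mapping_eqI;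
      simp add: lookup_add lookup_sum lookup_minus lookup_create lookup_annih sum_distrib_left
        algebra_simps)+

lemma osc_commutator:
  fixes \<kappa> :: "'i::finite \<Rightarrow> 'i \<Rightarrow> int \<Rightarrow> complex"
  assumes \<kappa>: "\<And>i j m. \<kappa> j i (- m) = - \<kappa> i j m" and "m \<noteq> 0" "n \<noteq> 0"
  shows "osc \<kappa> i m (osc \<kappa> j n f) - osc \<kappa> j n (osc \<kappa> i m f) =
    (if m + n = 0 then scal (\<kappa> i j m) f else 0)"
proof -
  have pos_neg: "osc \<kappa> i m (osc \<kappa> j n f) - osc \<kappa> j n (osc \<kappa> i m f) =
      (if m + n = 0 then scal (\<kappa> i j m) f else 0)"
    if "m > 0" "n < 0" for i j m n and f :: "'i fock"
  proof -
    have eq: "(h, nat m - Suc 0) = (j, nat (- n) - Suc 0) \<longleftrightarrow> h = j \<and> m + n = 0" for h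
      using that by auto
    have "osc \<kappa> i m (osc \<kappa> j n f) - osc \<kappa> j n (osc \<kappa> i m f) =
        (\<Sum>h\<in>UNIV. scal (\<kappa> i h m) (if h = j \<and> m + n = 0 then f else 0))"
      using that
      by (simp add: osc_def scal_simps annih_create sum_subtractf [symmetric] eq del: prod.inject)
    also have "\<dots> = (\<Sum>h\<in>UNIV. if h = j then (if m + n = 0 then scal (\<kappa> i j m) f else 0) else 0)"
      by (intro sum.cong) (auto intro: poly_mapping_eqI)
    finally show ?thesis by simp
  qed
  consider "m > 0" "n < 0" | "m < 0" "n > 0" | "m > 0" "n > 0" | "m < 0" "n < 0"
    using assms(2,3) by linarith
  then show ?thesis
  proof cases
    case 1
    then show ?thesis by (rule pos_neg)
  next
    case 2
    have "osc \<kappa> i m (osc \<kappa> j n f) - osc \<kappa> j n (osc \<kappa> i m f) =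
        - (osc \<kappa> j n (osc \<kappa> i m f) - osc \<kappa> i m (osc \<kappa> j n f))"
      by (simp only: minus_diff_eq)
    also have "\<dots> = - (if n + m = 0 then scal (\<kappa> j i n) f else 0)"
      using 2 by (subst pos_neg) auto
    also have "\<dots> = (if m + n = 0 then scal (\<kappa> i j m) f else 0)"
    proof (cases "m + n = 0")
      case True
      then have "n = - m" by simp
      then show ?thesis using \<kappa> [of j i m] by (auto intro: poly_mapping_eqI)
    qed (simp add: add.commute)
    finally show ?thesis .
  next
    case 3
    have "osc \<kappa> i m (osc \<kappa> j n f) = osc \<kappa> j n (osc \<kappa> i m f)"
      using 3
      by (simp add: osc_def scal_simps mult.commute)
        (subst sum.swap, simp add: annih_commute)
    then show ?thesis using 3 by simp
  next
    case 4
    then show ?thesis by (simp add: osc_def create_commute)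
  qed
qed


section \<open>Vertex operators\<close>

text \<open>The coefficient of \<open>z ^ n\<close> in \<open>exp (\<Sum>m>0. A m z ^ m)\<close>: the \<open>k\<close>-th term of the
  exponential series contributes the products \<open>A m\<^sub>1 \<dots> A m\<^sub>k\<close> with \<open>m\<^sub>1 + \<dots> + m\<^sub>k = n\<close>.\<close>

definition exp_mode :: "(nat \<Rightarrow> 'i fock \<Rightarrow> 'i fock) \<Rightarrow> nat \<Rightarrow> 'i fock \<Rightarrow> 'i fock" where
  "exp_mode A n f =
     (\<Sum>ms\<in>{ms. sum_list ms = n \<and> 0 \<notin> set ms}. scal (1 / fact (length ms)) (foldr A ms f))"

text \<open>The coefficient of \<open>z ^ n\<close> in the normally ordered exponential
  \<open>: exp (\<Sum>m\<noteq>0. E m z powi (- m)) :\<close>, creation operators (\<open>m < 0\<close>) to the left.\<close>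

definition nexp_mode :: "(int \<Rightarrow> 'i fock \<Rightarrow> 'i fock) \<Rightarrow> int \<Rightarrow> 'i fock \<Rightarrow> 'i fock" where
  "nexp_mode E n f =
     (\<Sum>l | exp_mode (\<lambda>m. E (int m)) l f \<noteq> 0 \<and> 0 \<le> n + int l.
        exp_mode (\<lambda>m. E (- int m)) (nat (n + int l)) (exp_mode (\<lambda>m. E (int m)) l f))"

text \<open>Direct sums of copies of a Fock space, labelled by the momentum lattice, and the
  operators combining a function of the momentum with a subsequent shift of it.\<close>

type_synonym ('l, 'i) states = "'l \<Rightarrow>\<^sub>0 'i fock"

definition sector :: "'l \<Rightarrow> ('l, 'i) states set" where
  "sector L = range (Poly_Mapping.single L)"

definition zero_mode ::
    "('l \<Rightarrow> complex) \<Rightarrow> ('l \<Rightarrow> 'l) \<Rightarrow> ('l, 'i) states \<Rightarrow> ('l, 'i) states" where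
  "zero_mode g sh \<psi> = (\<Sum>L\<in>Poly_Mapping.keys \<psi>.
     Poly_Mapping.single (sh L) (scal (g L) (Poly_Mapping.lookup \<psi> L)))"

text \<open>A current evaluated at a point: the value of \<open>z\<close> and the modes \<open>X n\<close> of
  \<open>X(z) = (\<Sum>n. X n z ^ n)\<close>. The zero mode factor, which may carry a non-integer power of
  the argument, is part of \<open>X n\<close>.\<close>

type_synonym ('l, 'i) current = "complex \<times> (int \<Rightarrow> ('l, 'i) states \<Rightarrow> ('l, 'i) states)"

definition vertex_current ::
    "complex \<Rightarrow> (('l, 'i) states \<Rightarrow> ('l, 'i) states) \<Rightarrow> (int \<Rightarrow> 'i fock \<Rightarrow> 'i fock)
      \<Rightarrow> ('l, 'i) current" where
  "vertex_current z Z E = (z, \<lambda>n \<psi>. Poly_Mapping.map (nexp_mode E n) (Z \<psi>))"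

text \<open>Matrix elements of a product \<open>X\<^sub>1(z\<^sub>1) \<dots> X\<^sub>M(z\<^sub>M)\<close> are Laurent series which converge in a
  region \<open>|z\<^sub>1| \<gg> \<dots> \<gg> |z\<^sub>M|\<close> and are continued meromorphically. The points
  \<open>\<tau> z\<^sub>1, \<tau>\<^sup>2 z\<^sub>2, \<dots>, \<tau> ^ M z\<^sub>M\<close> lie in this region for small \<open>\<tau>\<close>, and the value at
  \<open>z\<^sub>1, \<dots>, z\<^sub>M\<close> is the one at \<open>\<tau> = 1\<close> of the continuation in \<open>\<tau>\<close>.
  \<open>product_element Xs \<psi> L b c\<close> says that this continuation exists, is regular at \<open>\<tau> = 1\<close>, and
  that the coefficient of the product applied to \<open>\<psi>\<close> at the monomial \<open>b\<close> in sector \<open>L\<close> is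
  \<open>c\<close>.\<close>

definition product_element ::
    "('l, 'i) current list \<Rightarrow> ('l, 'i) states \<Rightarrow> 'l \<Rightarrow> ('i \<times> nat) multiset \<Rightarrow> complex \<Rightarrow> bool" where
  "product_element Xs \<psi> L b c \<longleftrightarrow>
     (\<exists>g. g meromorphic_on (- {0}) \<and> g analytic_on {1} \<and> g 1 = c \<and>
        (\<forall>\<^sub>F \<tau> in at 0.
           ((\<lambda>ns. (\<Prod>j<length Xs. (\<tau> ^ Suc j * fst (Xs ! j)) powi (ns ! j)) *
                 Poly_Mapping.lookup
                   (Poly_Mapping.lookup (foldr (\<lambda>(X, n). snd X n) (zip Xs ns) \<psi>) L) b)
            has_sum g \<tau>) {ns. length ns = length Xs}))"

text \<open>Points \<open>(s, t)\<close> of the measure space parametrise the product of unit circles by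
  \<open>exp (2 \<pi> \<i> s\<^sub>j)\<close>, \<open>exp (2 \<pi> \<i> t\<^sub>j)\<close>, \<open>1 \<le> j \<le> N\<close>, so that \<open>dz / (2 \<pi> \<i> z)\<close> is the
  Lebesgue measure.\<close>

definition torus :: "nat \<Rightarrow> ((nat \<Rightarrow> real) \<times> (nat \<Rightarrow> real)) measure" where
  "torus N = (\<Pi>\<^sub>M j\<in>{1..N}. restrict_space lborel {0..1})
     \<Otimes>\<^sub>M (\<Pi>\<^sub>M j\<in>{1..N}. restrict_space lborel {0..1})"

text \<open>\<open>Xs\<close> is the product of currents and \<open>K\<close> the scalar integrand, the latter depending on
  the sector on which it acts.\<close>

definition has_current_integral ::
    "nat \<Rightarrow> ((nat \<Rightarrow> real) \<times> (nat \<Rightarrow> real) \<Rightarrow> ('l, 'i) current list)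
      \<Rightarrow> ((nat \<Rightarrow> real) \<times> (nat \<Rightarrow> real) \<Rightarrow> 'l \<Rightarrow> complex)
      \<Rightarrow> ('l, 'i) states \<Rightarrow> ('l, 'i) states \<Rightarrow> bool" where
  "has_current_integral N Xs K \<psi> \<phi> \<longleftrightarrow>
     (\<exists>\<Psi>. (AE \<theta> in torus N. \<forall>L b.
              product_element (Xs \<theta>) (zero_mode (K \<theta>) (\<lambda>L. L) \<psi>) L b (\<Psi> \<theta> L b)) \<and>
          (\<forall>L b. has_bochner_integral (torus N) (\<lambda>\<theta>. \<Psi> \<theta> L b)
              (Poly_Mapping.lookup (Poly_Mapping.lookup \<phi> L) b)))"

text \<open>As for the integrals of the library, the value is 0 by convention if the integral does
  not exist.\<close>

definition current_integral ::
    "nat \<Rightarrow> ((nat \<Rightarrow> real) \<times> (nat \<Rightarrow> real) \<Rightarrow> ('l, 'i) current list)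
      \<Rightarrow> ((nat \<Rightarrow> real) \<times> (nat \<Rightarrow> real) \<Rightarrow> 'l \<Rightarrow> complex)
      \<Rightarrow> ('l, 'i) states \<Rightarrow> ('l, 'i) states" where
  "current_integral N Xs K \<psi> =
     (if \<exists>\<phi>. has_current_integral N Xs K \<psi> \<phi> then THE \<phi>. has_current_integral N Xs K \<psi> \<phi> else 0)"


section \<open>Elliptic non-local integrals of motion\<close>

datatype beta_index = B1 | B2

instance beta_index :: finite
proof
  have "(UNIV :: beta_index set) = {B1, B2}" using beta_index.exhaust by auto
  then show "finite (UNIV :: beta_index set)" by (metis finite.emptyI finite_insert)
qed

fun beta_num :: "beta_index \<Rightarrow> real" where
  "beta_num B1 = 1"
| "beta_num B2 = 2"

definition beta_form :: "real \<Rightarrow> real \<Rightarrow> real \<Rightarrow> beta_index \<Rightarrow> beta_index \<Rightarrow> int \<Rightarrow> complex" where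
  "beta_form x r s i j m = of_real (
     if i = j
     then real_of_int m * (qnum x ((r - 1) * real_of_int m) / qnum x (r * real_of_int m)) * (qnum x ((s - 1) * real_of_int m) / qnum x (s * real_of_int m))
     else - real_of_int m * (qnum x ((r - 1) * real_of_int m) / qnum x (r * real_of_int m)) * (qnum x (real_of_int m) / qnum x (s * real_of_int m))
          * x powr (s * real_of_int m * sgn (beta_num i - beta_num j)))"

abbreviation beta :: "real \<Rightarrow> real \<Rightarrow> real \<Rightarrow> beta_index \<Rightarrow> int
    \<Rightarrow> beta_index fock \<Rightarrow> beta_index fock" where
  "beta x r s \<equiv> osc (beta_form x r s)"

lemma beta_form_antisym: "beta_form x r s j i (- m) = - beta_form x r s i j m"
proof -
  have neg: "qnum x (- a) = - qnum x a" for a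
    by (simp add: qnum_def minus_divide_left)
  have q: "qnum x (c * real_of_int (- m)) = - qnum x (c * real_of_int m)" for c
    using neg [of "c * real_of_int m"] by simp
  have q1: "qnum x (real_of_int (- m)) = - qnum x (real_of_int m)"
    using neg [of "real_of_int m"] by simp
  have g: "s * real_of_int (- m) * sgn (beta_num j - beta_num i) =
      s * real_of_int m * sgn (beta_num i - beta_num j)"
    by (cases i; cases j) simp_all
  show ?thesis
    unfolding beta_form_def q q1 g by (simp add: eq_commute)
qed

text \<open>All square roots are expressed by fixed roots of \<open>r\<close> and \<open>r - 1\<close>, so that they
  multiply as usual: the eigenvalue of \<open>\<pi>\<close> on the sector \<open>(a, b)\<close> is \<open>a r - b (r - 1)\<close>.
  (With principal values of each root separately this would fail for \<open>0 < r < 1\<close>.)\<close>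

definition momentum :: "real \<Rightarrow> int \<times> int \<Rightarrow> complex" where
  "momentum r = (\<lambda>(a, b). of_int a * (csqrt r / csqrt (r - 1)) - of_int b * (csqrt (r - 1) / csqrt r))"

definition pihat :: "real \<Rightarrow> int \<times> int \<Rightarrow> complex" where
  "pihat r L = csqrt r * csqrt (r - 1) * momentum r L"

lemma pihat_eq:
  assumes "r \<noteq> 0" "r \<noteq> 1"
  shows "pihat r (a, b) = of_int a * of_real r - of_int b * (of_real r - 1)"
proof -
  have r: "csqrt r * csqrt r = r" "csqrt (r - 1) * csqrt (r - 1) = of_real r - 1"
    using power2_csqrt [of "of_real r"] power2_csqrt [of "of_real r - 1"]
    by (simp_all only: power2_eq_square of_real_diff of_real_1)
  have n: "csqrt r \<noteq> 0" "csqrt (r - 1) \<noteq> 0"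
    using assms by (simp_all only: csqrt_eq_0 of_real_eq_0_iff) simp
  have "pihat r (a, b) = of_int a * (csqrt r * csqrt r) * (csqrt (r - 1) / csqrt (r - 1))
      - of_int b * (csqrt (r - 1) * csqrt (r - 1)) * (csqrt r / csqrt r)"
    unfolding pihat_def momentum_def by (simp add: algebra_simps)
  then show ?thesis using r n by simp
qed

text \<open>The arguments of the screening currents are \<open>z = x powr (2 * u)\<close>, and powers \<open>z\<^sup>a\<close> are
  read as \<open>x powr (2 * u * a)\<close>. The operator \<open>exp (\<plusminus>\<i> sqrt ((r-1)/r) Q)\<close> maps the vacuum
  of the sector \<open>(a, b)\<close> to that of \<open>(a, b \<mp> 2)\<close>.\<close>

definition F0_exponent :: "real \<Rightarrow> real \<Rightarrow> real \<Rightarrow> int \<Rightarrow> beta_index fock \<Rightarrow> beta_index fock" where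
  "F0_exponent x r s m f =
     scal (1 / of_int m) (scal (- (x powr (s * real_of_int m))) (beta x r s B1 m f)
                          + scal (x powr (- s * real_of_int m)) (beta x r s B2 m f))"

definition F0 :: "real \<Rightarrow> real \<Rightarrow> real \<Rightarrow> complex \<Rightarrow> (int \<times> int, beta_index) current" where
  "F0 x r s u = vertex_current (of_real x powr (2 * u))
     (zero_mode (\<lambda>L. of_real x powr (2 * u * (- pihat r L / r + (r - 1) / r)))
                (\<lambda>(a, b). (a, b + 2)))
     (F0_exponent x r s)"

definition F1_exponent :: "real \<Rightarrow> real \<Rightarrow> real \<Rightarrow> int \<Rightarrow> beta_index fock \<Rightarrow> beta_index fock" where
  "F1_exponent x r s m f = scal (1 / of_int m) (beta x r s B1 m f - beta x r s B2 m f)"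

definition F1 :: "real \<Rightarrow> real \<Rightarrow> real \<Rightarrow> complex \<Rightarrow> (int \<times> int, beta_index) current" where
  "F1 x r s u = vertex_current (of_real x powr (2 * u))
     (zero_mode (\<lambda>L. of_real x powr (2 * u * (pihat r L / r + (r - 1) / r)))
                (\<lambda>(a, b). (a, b - 2)))
     (F1_exponent x r s)"

definition ell_bracket :: "real \<Rightarrow> real \<Rightarrow> complex \<Rightarrow> complex" where
  "ell_bracket x r u = of_real x powr (u\<^sup>2 / r - u)
     * Theta (x powr (2 * r)) (of_real x powr (2 * u)) / qpoch (x powr (2 * r)) (x powr (2 * r))"

definition ell_vtheta :: "real \<Rightarrow> real \<Rightarrow> complex \<Rightarrow> int \<Rightarrow> complex \<Rightarrow> complex" where
  "ell_vtheta x r \<pi> \<nu> u = of_real x powr (2 * u\<^sup>2 / r - 2 * \<pi> * u / r)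
     * vtheta \<nu> (of_real x powr (2 * u - \<pi>)) (x powr (2 * r))"

definition ell_kernel ::
    "real \<Rightarrow> real \<Rightarrow> real \<Rightarrow> int \<Rightarrow> nat \<Rightarrow> (nat \<Rightarrow> complex) \<Rightarrow> (nat \<Rightarrow> complex) \<Rightarrow> complex \<Rightarrow> complex" where
  "ell_kernel x r s \<nu> N u v \<pi> =
     (\<Prod>i\<in>{1..N}. \<Prod>j\<in>{i<..N}.
        ell_bracket x r (u j - u i) * ell_bracket x r (u j - u i - 1)
        * ell_bracket x r (v j - v i) * ell_bracket x r (v j - v i - 1))
     / (\<Prod>i\<in>{1..N}. \<Prod>j\<in>{1..N}.
        ell_bracket x r (v j - u i - s / 2) * ell_bracket x r (v j - u i + s / 2 - 1))
     * ell_vtheta x r \<pi> \<nu> (\<Sum>j\<in>{1..N}. u j - v j)"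

text \<open>The additive coordinate with \<open>x powr (2 * u) = exp (2 \<pi> \<i> t)\<close>.\<close>

definition ucoord :: "real \<Rightarrow> real \<Rightarrow> complex" where
  "ucoord x t = \<i> * of_real (pi * t / ln x)"

definition elliptic_IM ::
    "real \<Rightarrow> real \<Rightarrow> real \<Rightarrow> int \<Rightarrow> nat \<Rightarrow> (int \<times> int, beta_index) states
      \<Rightarrow> (int \<times> int, beta_index) states" where
  "elliptic_IM x r s \<nu> N = current_integral N
     (\<lambda>(a, b). map (\<lambda>j. F1 x r s (ucoord x (a j))) [1..<Suc N]
             @ map (\<lambda>j. F0 x r s (ucoord x (b j))) [1..<Suc N])
     (\<lambda>(a, b) L. ell_kernel x r s \<nu> N (\<lambda>j. ucoord x (a j)) (\<lambda>j. ucoord x (b j)) (pihat r L))"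


section \<open>Integrals of motion of the quantum toroidal algebra\<close>

datatype tor_index = I0 | I1

instance tor_index :: finite
proof
  have "(UNIV :: tor_index set) = {I0, I1}" using tor_index.exhaust by auto
  then show "finite (UNIV :: tor_index set)" by (metis finite.emptyI finite_insert)
qed

definition tor_form :: "real \<Rightarrow> real \<Rightarrow> tor_index \<Rightarrow> tor_index \<Rightarrow> int \<Rightarrow> complex" where
  "tor_form q d i j m = of_real (
     (if i = j then qnum q (2 * real_of_int m) / real_of_int m
      else - (qnum q (real_of_int m) / real_of_int m)
          * (d powr real_of_int m + d powr (- real_of_int m))) * qnum q (real_of_int m))"

abbreviation Hperp :: "real \<Rightarrow> real \<Rightarrow> tor_index \<Rightarrow> int \<Rightarrow> tor_index fock \<Rightarrow> tor_index fock" where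
  "Hperp q d \<equiv> osc (tor_form q d)"

lemma tor_form_antisym: "tor_form q d j i (- m) = - tor_form q d i j m"
proof -
  have neg: "qnum q (- a) = - qnum q a" for a
    by (simp add: qnum_def minus_divide_left)
  show ?thesis
    unfolding tor_form_def by (auto simp: neg add.commute)
qed

text \<open>The sector \<open>k\<close> is the subspace attached to the lattice element
  \<open>\<beta> = (k + \<mu> / 2) \<alpha>\<^sub>1\<close>. The eigenvalue \<open>(\<alpha>\<^sub>i, \<beta>)\<close> of \<open>H\<^sub>i\<^sub>,\<^sub>0\<close> there and the translation by
  \<open>- \<alpha>\<^sub>i\<close>, where \<open>\<alpha>\<^sub>0 = - \<alpha>\<^sub>1\<close>, are:\<close>

fun Hzero :: "int \<Rightarrow> tor_index \<Rightarrow> int \<Rightarrow> int" where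
  "Hzero \<mu> I1 k = 2 * k + \<mu>"
| "Hzero \<mu> I0 k = - (2 * k + \<mu>)"

fun lattice_shift :: "tor_index \<Rightarrow> int \<Rightarrow> int" where
  "lattice_shift I1 k = k - 1"
| "lattice_shift I0 k = k + 1"

text \<open>The oscillators of the factors \<open>K\<^sub>i(p ^ (- l) z)\<close>, \<open>l \<ge> 0\<close>, and of the annihilation part of
  \<open>F\<^sub>i(z)\<close> commute; the product of their exponentials is written as the exponential of the sum.\<close>

definition Fhat_exponent ::
    "real \<Rightarrow> real \<Rightarrow> real \<Rightarrow> tor_index \<Rightarrow> int \<Rightarrow> tor_index fock \<Rightarrow> tor_index fock" where
  "Fhat_exponent q d p i m f =
     scal (of_real (if m < 0 then - (1 / qnum q (- real_of_int m))
                    else q powr real_of_int m / qnum q (real_of_int m) - (q - inverse q) * suminf (\<lambda>l. p powr (real l * real_of_int m))))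
          (Hperp q d i m f)"

definition Fhat ::
    "real \<Rightarrow> real \<Rightarrow> real \<Rightarrow> int \<Rightarrow> tor_index \<Rightarrow> complex \<Rightarrow> complex \<Rightarrow> (int, tor_index) current" where
  "Fhat q d p \<mu> i c z = vertex_current z
     (zero_mode (\<lambda>k. c * z powi (- Hzero \<mu> i k + 1)) (lattice_shift i))
     (Fhat_exponent q d p i)"

text \<open>Here \<open>q1 = inverse q * d\<close>, \<open>q2 = q\<^sup>2\<close>, \<open>q3 = inverse q * inverse d\<close>, and \<open>h\<close> is the
  eigenvalue of \<open>H\<^sub>1\<^sub>,\<^sub>0\<close>.\<close>

definition tor_kernel ::
    "real \<Rightarrow> real \<Rightarrow> real \<Rightarrow> real \<Rightarrow> int \<Rightarrow> nat \<Rightarrow> (nat \<Rightarrow> complex) \<Rightarrow> (nat \<Rightarrow> complex) \<Rightarrow> int \<Rightarrow> complex" where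
  "tor_kernel q d p pbar1 \<nu> N x0 x1 h =
     (\<Prod>i\<in>{1..N}. \<Prod>j\<in>{i<..N}.
        Theta p (x0 j / x0 i) * Theta p (of_real (q\<^sup>2) * x0 j / x0 i)
        * Theta p (x1 j / x1 i) * Theta p (of_real (q\<^sup>2) * x1 j / x1 i))
     / (\<Prod>i\<in>{1..N}. \<Prod>j\<in>{1..N}.
        Theta p (of_real (inverse (inverse q * d)) * x1 j / x0 i)
        * Theta p (of_real (inverse (inverse q * inverse d)) * x1 j / x0 i))
     * (\<Prod>i\<in>{1..N}. (x0 i * x1 i) powi (int N - 2 * int i + 1))
     * (\<Prod>i\<in>{1..N}. x1 i / x0 i) ^ N
     * p powr (- real_of_int \<nu> / 4)
     * vtheta \<nu>
         (of_real (pbar1 powr (1 / 2) * q powr (- real_of_int h / 2)) * (\<Prod>i\<in>{1..N}. x1 i / x0 i)) p"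

text \<open>The unit circles are the right contours for \<open>|q1| < 1\<close>, \<open>|q3| < 1\<close>.\<close>

definition toroidal_IM ::
    "real \<Rightarrow> real \<Rightarrow> real \<Rightarrow> real \<Rightarrow> complex \<Rightarrow> complex \<Rightarrow> int \<Rightarrow> int \<Rightarrow> nat \<Rightarrow> (int, tor_index) states
      \<Rightarrow> (int, tor_index) states" where
  "toroidal_IM q d pbar pbar1 c0 c1 \<mu> \<nu> N = (let p = pbar * inverse q in current_integral N
     (\<lambda>(a, b). map (\<lambda>j. Fhat q d p \<mu> I0 c0 (cis (2 * pi * a j))) [1..<Suc N]
             @ map (\<lambda>j. Fhat q d p \<mu> I1 c1 (cis (2 * pi * b j))) [1..<Suc N])
     (\<lambda>(a, b) k. tor_kernel q d p pbar1 \<nu> N (\<lambda>j. cis (2 * pi * a j)) (\<lambda>j. cis (2 * pi * b j))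
                   (Hzero \<mu> I1 k)))"


section \<open>Identification of the Fock spaces\<close>

definition matches_oscillators ::
    "real \<Rightarrow> real \<Rightarrow> real \<Rightarrow> real \<Rightarrow> real \<Rightarrow> (tor_index fock \<Rightarrow> beta_index fock) \<Rightarrow> bool" where
  "matches_oscillators x r s q d \<Phi> \<longleftrightarrow>
     bij \<Phi> \<and> (\<forall>f g. \<Phi> (f + g) = \<Phi> f + \<Phi> g) \<and> (\<forall>c f. \<Phi> (scal c f) = scal c (\<Phi> f)) \<and> \<Phi> 1 = 1 \<and>
     (\<forall>m::int. m > 0 \<longrightarrow> (\<forall>f.
        \<Phi> (scal (1 / qnum q (real_of_int m)) (Hperp q d I1 (- m) f)) =
          scal (1 / of_int m) (scal (- (x powr (- s * real_of_int m))) (beta x r s B1 (- m) (\<Phi> f))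
                               + scal (x powr (s * real_of_int m)) (beta x r s B2 (- m) (\<Phi> f))) \<and>
        \<Phi> (scal (1 / qnum q (real_of_int m) *
            (qnum q ((r - 1) * real_of_int m) / qnum q (r * real_of_int m))) (Hperp q d I1 m f)) =
          scal (1 / of_int m) (scal (- (x powr (s * real_of_int m))) (beta x r s B1 m (\<Phi> f))
                               + scal (x powr (- s * real_of_int m)) (beta x r s B2 m (\<Phi> f))) \<and>
        \<Phi> (scal (1 / qnum q (real_of_int m)) (Hperp q d I0 (- m) f)) =
          scal (1 / of_int m) (beta x r s B1 (- m) (\<Phi> f) - beta x r s B2 (- m) (\<Phi> f)) \<and>
        \<Phi> (scal (1 / qnum q (real_of_int m) *
            (qnum q ((r - 1) * real_of_int m) / qnum q (r * real_of_int m))) (Hperp q d I0 m f)) =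
          scal (1 / of_int m) (beta x r s B1 m (\<Phi> f) - beta x r s B2 m (\<Phi> f))))"

definition identify ::
    "(tor_index fock \<Rightarrow> beta_index fock) \<Rightarrow> int \<Rightarrow> int \<Rightarrow> (int, tor_index) states
      \<Rightarrow> (int \<times> int, beta_index) states" where
  "identify \<Phi> k l \<psi> = Poly_Mapping.single (k, l) (\<Phi> (Poly_Mapping.lookup \<psi> k))"

definition states_scal :: "complex \<Rightarrow> ('l, 'i) states \<Rightarrow> ('l, 'i) states" where
  "states_scal c = zero_mode (\<lambda>_. c) (\<lambda>L. L)"

text \<open>The ratio of the normalisations of the two families of integrals: the brackets in
  \<open>ell_kernel\<close> contribute the powers of \<open>(p; p)\<close> and \<open>x\<close>, the constants of the currents the
  factor \<open>(c\<^sub>0 c\<^sub>1) ^ N\<close>, and the last two factors come from shifting the summation index in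
  \<open>vtheta\<close>.\<close>

definition im_ratio ::
    "real \<Rightarrow> real \<Rightarrow> real \<Rightarrow> complex \<Rightarrow> int \<Rightarrow> int \<Rightarrow> int \<Rightarrow> int \<Rightarrow> nat \<Rightarrow> complex" where
  "im_ratio x r s c0c1 \<mu> k l \<nu> N =
     (let p = x powr (2 * r); h = Hzero \<mu> I1 k in
        qpoch p p ^ (2 * N)
        * x powr (- real N * (1 + 1 / r) + (real N)\<^sup>2 * s * (2 - s) / (2 * r))
        * inverse c0c1 ^ N
        * p powr (real_of_int \<nu> / 4)
        * p powr ((real_of_int h)\<^sup>2 / 4) * of_real x powr (- pihat r (k, l) * of_int h))"

end

theory Submission
  imports Defs
begin

text \<open>Both families of integrals of motion are integrals over the same torus, with kernels that
are scalar on each sector, of products of \<open>2 N\<close> vertex operators. They agree before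
integration, point by point on the torus and mode by mode, up to the constant \<open>im_ratio\<close>.
Hence a linear isomorphism of the Fock spaces carries every value on one side to a value on the other,
so the two integrals exist together, and where they do not exist both are 0 by convention. This is
\<open>current_integral_transport\<close>. It needs the continued matrix elements to be unique, which is
the identity theorem on the punctured plane, and a basis change in which every new matrix element is a
finite combination of old ones.

The oscillators. Summing the geometric series over the dressing factors turns the annihilation
coefficient \<open>q\<^sup>m / [m]\<close> into \<open>[(r-1)m] / ([m] [r m])\<close>, the coefficient
in the matching of oscillators. Therefore \<open>\<Phi>\<close> matches the oscillators if and only if
it is a linear bijection fixing the vacuum that carries the exponents of the dressed currents to those
of the screening currents (\<open>matches_oscillators_iff\<close>). The relations for creation operators
alone determine \<open>\<Phi>\<close>: it substitutes a linear form for each variable. It is invertible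
because the two forms of a given mode have a determinant proportional to \<open>x\<^sup>s\<^sup>m -
x\<^sup>-\<^sup>s\<^sup>m\<close>. The relations for annihilation operators then follow, since both sets
of exponents satisfy the same commutation relations (\<open>form_identity\<close>), which amounts to
product-to-sum formulas for q-numbers.

The scalar factors. In the coordinates \<open>z\<^sub>j = x powr (2 u\<^sub>j)\<close>, \<open>w\<^sub>j
= x powr (2 v\<^sub>j)\<close> each bracket is a theta function times a power of \<open>x\<close> with a
quadratic exponent, and the theta functions in the two kernels are the same. The quadratic exponents add
up to \<open>- 2 U\<^sup>2 / r\<close> with \<open>U = \<Sum>\<^sub>j (u\<^sub>j - v\<^sub>j)\<close>,
which the prefactor of \<open>\<vartheta>\<^sub>\<nu>(U)\<close> cancels; the linear exponents
proportional to \<open>1 / r\<close> cancel against the powers contributed by the zero modes of the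
screening currents. The remaining factor \<open>x powr (- 2 U h)\<close>, where \<open>h\<close> is the
eigenvalue of \<open>H\<^sub>1\<^sub>,\<^sub>0\<close>, cancels against the factor produced by the
substitution \<open>n \<mapsto> h/2 - n\<close> in the theta series (\<open>vtheta_reflect\<close>). The
substitution changes the class of the summation index modulo 1 by the parity of \<open>h\<close>, hence
the shift of \<open>\<nu>\<close> by \<open>\<mu>\<close>. The result is
\<open>integrand_identity\<close>.\<close>

section \<open>Values of analytically continued Laurent series\<close>

text \<open>The analytic content of \<open>product_element\<close>. Only the coefficients of the
Laurent series enter, so that uniqueness and linearity of the continued values can be treated apart from
the Fock spaces.\<close>

definition continued_sum :: "complex list \<Rightarrow> (int list \<Rightarrow> complex) \<Rightarrow> complex \<Rightarrow> bool" where
  "continued_sum zs a c \<longleftrightarrow>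
     (\<exists>g. g meromorphic_on (- {0}) \<and> g analytic_on {1} \<and> g 1 = c \<and>
        (\<forall>\<^sub>F \<tau> in at 0.
           ((\<lambda>ns. (\<Prod>j<length zs. (\<tau> ^ Suc j * zs ! j) powi (ns ! j)) * a ns)
            has_sum g \<tau>) {ns. length ns = length zs}))"

definition mode_product ::
    "('l, 'i) current list \<Rightarrow> int list \<Rightarrow> ('l, 'i) states \<Rightarrow> ('l, 'i) states" where
  "mode_product Xs ns = foldr (\<lambda>(X, n). snd X n) (zip Xs ns)"

lemma product_element_iff_continued_sum:
  "product_element Xs \<psi> L b c \<longleftrightarrow>
     continued_sum (map fst Xs)
       (\<lambda>ns. Poly_Mapping.lookup (Poly_Mapping.lookup (mode_product Xs ns \<psi>) L) b) c"
proof -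
  have "(\<Prod>j<length Xs. (\<tau> ^ Suc j * fst (Xs ! j)) powi (ns ! j)) =
      (\<Prod>j<length (map fst Xs). (\<tau> ^ Suc j * map fst Xs ! j) powi (ns ! j))" for \<tau> ns
    by (intro prod.cong) auto
  then show ?thesis by (simp only: product_element_def continued_sum_def length_map mode_product_def)
qed

lemma continued_sum_cong:
  assumes "\<And>ns. length ns = length zs \<Longrightarrow> a ns = a' ns"
  shows "continued_sum zs a c \<longleftrightarrow> continued_sum zs a' c"
proof -
  have "((\<lambda>ns. (\<Prod>j<length zs. (\<tau> ^ Suc j * zs ! j) powi (ns ! j)) * a ns)
           has_sum S) {ns. length ns = length zs} \<longleftrightarrow>
        ((\<lambda>ns. (\<Prod>j<length zs. (\<tau> ^ Suc j * zs ! j) powi (ns ! j)) * a' ns)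
           has_sum S) {ns. length ns = length zs}" for \<tau> S
    by (intro has_sum_cong) (simp add: assms)
  then show ?thesis by (simp only: continued_sum_def)
qed

text \<open>The punctured plane is connected, so the identity theorem carries an equality near 0 to the
point 1, at which both functions are regular. Removing the singularities of the difference makes the
version of the theorem for meromorphic functions applicable.\<close>

lemma meromorphic_eq_if_eventually_eq_at_0:
  assumes "g meromorphic_on (- {0})" "g analytic_on {1}"
    and "g' meromorphic_on (- {0})" "g' analytic_on {1}"
    and ev: "\<forall>\<^sub>F \<tau> in at (0::complex). g \<tau> = g' \<tau>"
  shows "g 1 = g' 1"
proof -
  define h where "h = (\<lambda>\<tau>. g \<tau> - g' \<tau>)"
  have mero: "h meromorphic_on (- {0})"
    unfolding h_def using assms by (intro meromorphic_intros)
  have ana: "h analytic_on {1}"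
    unfolding h_def using assms by (intro analytic_intros)
  from ev obtain U where U: "open U" "0 \<in> U" "\<And>\<tau>. \<tau> \<in> U \<Longrightarrow> \<tau> \<noteq> 0 \<Longrightarrow> g \<tau> = g' \<tau>"
    unfolding eventually_at_topological by auto
  obtain e where e: "e > 0" "ball 0 e \<subseteq> U" using U openE by blast
  define z where "z = complex_of_real (e / 2)"
  have z: "z \<in> U" "z \<noteq> 0" using e by (auto simp: z_def subset_iff)
  define V where "V = U - {0}"
  have V: "open V" "z \<in> V" "\<And>w. w \<in> V \<Longrightarrow> h w = 0"
    using U z by (auto simp: V_def h_def open_delete)
  \<comment> \<open>The functions agree on a punctured neighbourhood of 0; any of its points serves as the centre.\<close>
  have vanish: "remove_sings h w = 0" if "w \<in> V" for w
  proof -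
    have "\<forall>\<^sub>F u in at w. h u = 0"
      using eventually_at_in_open' [OF V(1) that] by eventually_elim (rule V(3))
    then have "(h \<longlongrightarrow> 0) (at w)"
      by (rule tendsto_eventually)
    then show ?thesis by (rule remove_sings_eqI)
  qed
  have "\<forall>\<^sub>F w in at z. remove_sings h w = 0"
    using eventually_at_in_open' [OF V(1,2)] by eventually_elim (rule vanish)
  then have "\<exists>\<^sub>F w in at z. remove_sings h w = 0"
    by (intro eventually_frequently) simp_all
  moreover have "remove_sings h nicely_meromorphic_on (- {0})"
    using mero by (rule remove_sings_nicely_meromorphic)
  moreover have "connected (- {0 :: complex})"
    by (intro connected_punctured_universe) simp
  ultimately have "remove_sings h 1 = 0"
    using z by (intro frequently_eq_meromorphic_imp_constant [where f = "remove_sings h" and z = z and A = "- {0}"]) auto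
  then have "h 1 = 0" using ana by simp
  then show ?thesis by (simp add: h_def)
qed

lemma continued_sum_unique:
  assumes "continued_sum zs a c" "continued_sum zs a c'"
  shows "c = c'"
proof -
  from assms obtain g g' where g: "g meromorphic_on (- {0})" "g analytic_on {1}" "g 1 = c"
      "g' meromorphic_on (- {0})" "g' analytic_on {1}" "g' 1 = c'"
    and ev: "\<forall>\<^sub>F \<tau> in at 0.
           ((\<lambda>ns. (\<Prod>j<length zs. (\<tau> ^ Suc j * zs ! j) powi (ns ! j)) * a ns)
            has_sum g \<tau>) {ns. length ns = length zs}"
       "\<forall>\<^sub>F \<tau> in at 0.
           ((\<lambda>ns. (\<Prod>j<length zs. (\<tau> ^ Suc j * zs ! j) powi (ns ! j)) * a ns)
            has_sum g' \<tau>) {ns. length ns = length zs}"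
    unfolding continued_sum_def by blast
  from ev have "\<forall>\<^sub>F \<tau> in at 0. g \<tau> = g' \<tau>"
    by eventually_elim (rule has_sum_unique)
  then have "g 1 = g' 1"
    using g by (intro meromorphic_eq_if_eventually_eq_at_0)
  then show ?thesis using g by simp
qed

lemma product_element_unique:
  "product_element Xs \<psi> L b c \<Longrightarrow> product_element Xs \<psi> L b c' \<Longrightarrow> c = c'"
  unfolding product_element_iff_continued_sum by (rule continued_sum_unique)

text \<open>Under a change of basis of the Fock space each matrix element becomes a finite linear
combination of matrix elements; this lemma carries the continuations along.\<close>

lemma continued_sum_linear_combination:
  assumes "finite I" and "\<And>i. i \<in> I \<Longrightarrow> continued_sum zs (a i) (c i)"
  shows "continued_sum zs (\<lambda>ns. \<Sum>i\<in>I. k i * a i ns) (\<Sum>i\<in>I. k i * c i)"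
proof -
  let ?Z = "\<lambda>\<tau> ns. (\<Prod>j<length zs. (\<tau> ^ Suc j * zs ! j) powi (ns ! j))"
  let ?A = "{ns :: int list. length ns = length zs}"
  from assms(2) have "\<exists>g. \<forall>i\<in>I. g i meromorphic_on (- {0}) \<and> g i analytic_on {1} \<and> g i 1 = c i \<and>
      (\<forall>\<^sub>F \<tau> in at 0. ((\<lambda>ns. ?Z \<tau> ns * a i ns) has_sum g i \<tau>) ?A)"
    unfolding continued_sum_def by (intro bchoice) blast
  then obtain g where g: "\<And>i. i \<in> I \<Longrightarrow> g i meromorphic_on (- {0})"
      "\<And>i. i \<in> I \<Longrightarrow> g i analytic_on {1}" "\<And>i. i \<in> I \<Longrightarrow> g i 1 = c i"
    and ev: "\<And>i. i \<in> I \<Longrightarrow> \<forall>\<^sub>F \<tau> in at 0. ((\<lambda>ns. ?Z \<tau> ns * a i ns) has_sum g i \<tau>) ?A"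
    by auto
  have "\<forall>\<^sub>F \<tau> in at 0. \<forall>i\<in>I. ((\<lambda>ns. ?Z \<tau> ns * a i ns) has_sum g i \<tau>) ?A"
    using assms(1) ev by (simp add: eventually_ball_finite)
  then have "\<forall>\<^sub>F \<tau> in at 0.
      ((\<lambda>ns. ?Z \<tau> ns * (\<Sum>i\<in>I. k i * a i ns)) has_sum (\<Sum>i\<in>I. k i * g i \<tau>)) ?A"
  proof eventually_elim
    case (elim \<tau>)
    have "((\<lambda>ns. \<Sum>i\<in>I. k i * (?Z \<tau> ns * a i ns)) has_sum (\<Sum>i\<in>I. k i * g i \<tau>)) ?A"
      using assms(1) elim by (induction I) (auto intro!: has_sum_add has_sum_cmult_right has_sum_0)
    then show ?case by (simp only: sum_distrib_left mult.left_commute)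
  qed
  moreover have "(\<lambda>\<tau>. \<Sum>i\<in>I. k i * g i \<tau>) meromorphic_on (- {0})"
    using g by (intro meromorphic_intros)
  moreover have "(\<lambda>\<tau>. \<Sum>i\<in>I. k i * g i \<tau>) analytic_on {1}"
    using g by (intro analytic_intros)
  ultimately show ?thesis
    unfolding continued_sum_def
    by (intro exI [of _ "\<lambda>\<tau>. \<Sum>i\<in>I. k i * g i \<tau>"]) (simp add: g)
qed

lemma continued_sum_zero: "continued_sum zs (\<lambda>ns. 0) 0"
  using continued_sum_linear_combination [of "{}"] by simp

section \<open>Linear maps between Fock spaces\<close>

definition fock_linear :: "('i fock \<Rightarrow> 'j fock) \<Rightarrow> bool" where
  "fock_linear T \<longleftrightarrow> (\<forall>f g. T (f + g) = T f + T g) \<and> (\<forall>c f. T (scal c f) = scal c (T f))"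

lemma fock_linear_add: "fock_linear T \<Longrightarrow> T (f + g) = T f + T g"
  and fock_linear_scal: "fock_linear T \<Longrightarrow> T (scal c f) = scal c (T f)"
  by (simp_all add: fock_linear_def)

lemma scal_0_left [simp]: "scal 0 f = 0"
  and scal_0_right [simp]: "scal c 0 = 0"
  and scal_1 [simp]: "scal 1 f = f"
  and scal_single [simp]: "scal c (Poly_Mapping.single b e) = Poly_Mapping.single b (c * e)"
  by (rule poly_mapping_eqI; simp add: lookup_single when_def)+

lemma scal_add_left: "scal (c + e) f = scal c f + scal e f"
  by (rule poly_mapping_eqI) (simp add: lookup_add algebra_simps)

lemma scal_sum_left: "scal (sum c A) f = (\<Sum>a\<in>A. scal (c a) f)"
  by (rule poly_mapping_eqI) (simp add: lookup_sum sum_distrib_right)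

lemma scal_cancel: "c \<noteq> 0 \<Longrightarrow> scal c f = scal c g \<longleftrightarrow> f = g"
  by (metis scal_1 scal_simps(7) left_inverse)

lemma fock_linear_0: "fock_linear T \<Longrightarrow> T 0 = 0"
  using fock_linear_scal [of T 0 0] by simp

lemma fock_linear_sum: "fock_linear T \<Longrightarrow> T (sum F A) = (\<Sum>a\<in>A. T (F a))"
  by (induction A rule: infinite_finite_induct) (simp_all add: fock_linear_0 fock_linear_add)

lemma fock_linear_compose: "fock_linear S \<Longrightarrow> fock_linear T \<Longrightarrow> fock_linear (\<lambda>f. S (T f))"
  by (simp add: fock_linear_def)

lemma fock_linear_scaled: "fock_linear T \<Longrightarrow> fock_linear (\<lambda>f. scal c (T f))"
  by (simp add: fock_linear_def scal_simps mult.commute)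

lemma fock_linear_plus:
  "fock_linear S \<Longrightarrow> fock_linear T \<Longrightarrow> fock_linear (\<lambda>f. S f + T f)"
  by (simp add: fock_linear_def scal_simps ac_simps)

lemma fock_linear_pointwise_sum:
  "(\<And>a. a \<in> A \<Longrightarrow> fock_linear (T a)) \<Longrightarrow> fock_linear (\<lambda>f. \<Sum>a\<in>A. T a f)"
  by (induction A rule: infinite_finite_induct)
    (simp_all add: fock_linear_plus, simp_all add: fock_linear_def)

lemma fock_linear_create: "fock_linear (create a)"
  by (simp add: fock_linear_def scal_simps) (simp add: create_def distrib_left)

lemma fock_linear_annih: "fock_linear (annih a)"
  unfolding fock_linear_def
  by (auto intro!: poly_mapping_eqI simp: lookup_annih lookup_add algebra_simps)

lemma fock_linear_osc: "fock_linear (osc \<kappa> i m)"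
proof -
  consider "m < 0" | "m > 0" | "m = 0" by linarith
  then show ?thesis
  proof cases
    case 1
    then have "osc \<kappa> i m = create (i, nat (- m) - 1)" by (simp add: osc_def fun_eq_iff)
    then show ?thesis by (simp only: fock_linear_create)
  next
    case 2
    then have "osc \<kappa> i m = (\<lambda>f. \<Sum>j\<in>UNIV. scal (\<kappa> i j m) (annih (j, nat m - 1) f))"
      by (simp add: osc_def fun_eq_iff)
    then show ?thesis
      by (simp add: fock_linear_pointwise_sum fock_linear_scaled fock_linear_annih)
  next
    case 3
    then have "osc \<kappa> i m = (\<lambda>f. 0)" by (simp add: osc_def fun_eq_iff)
    then show ?thesis by (simp add: fock_linear_def)
  qed
qed

lemma fock_monomial_expansion:
  "f = (\<Sum>b\<in>Poly_Mapping.keys f. scal (Poly_Mapping.lookup f b) (Poly_Mapping.single b 1))"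
  by (rule poly_mapping_eqI) (simp add: lookup_sum lookup_single when_def sum.delta' in_keys_iff)

lemma create_single: "create a (Poly_Mapping.single b c) = Poly_Mapping.single (add_mset a b) c"
  by (simp add: create_def mult_single)

lemma fock_induct [case_names vacuum create scal add]:
  assumes "P 1" and "\<And>a f. P f \<Longrightarrow> P (create a f)" and "\<And>c f. P f \<Longrightarrow> P (scal c f)"
    and "\<And>f g. P f \<Longrightarrow> P g \<Longrightarrow> P (f + g)"
  shows "P f"
proof -
  have mono: "P (Poly_Mapping.single b 1)" for b
  proof (induction b)
    case empty
    have "(Poly_Mapping.single {#} 1 :: 'a fock) = 1" using single_one by (simp flip: single_one)
    then show ?case using assms(1) by simp
  next
    case (add a b)
    then show ?case using assms(2) by (metis create_single)
  qed
  have zero: "P 0" using assms(3) [OF assms(1), of 0] by simp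
  have "P (\<Sum>b\<in>A. scal (c b) (Poly_Mapping.single b 1))" if "finite A" for A c
    using that by (induction A) (auto intro: zero assms(3,4) mono simp del: scal_single)
  then show ?thesis using fock_monomial_expansion [of f] by (metis finite_keys)
qed

lemma fock_linear_expansion:
  assumes "fock_linear T"
  shows "T f = (\<Sum>b\<in>Poly_Mapping.keys f.
    scal (Poly_Mapping.lookup f b) (T (Poly_Mapping.single b 1)))"
proof -
  have "T f = T (\<Sum>b\<in>Poly_Mapping.keys f.
      scal (Poly_Mapping.lookup f b) (Poly_Mapping.single b 1))"
    using fock_monomial_expansion [of f] by (rule arg_cong)
  also have "\<dots> = (\<Sum>b\<in>Poly_Mapping.keys f.
      scal (Poly_Mapping.lookup f b) (T (Poly_Mapping.single b 1)))"
    by (simp only: fock_linear_sum [OF assms] fock_linear_scal [OF assms])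
  finally show ?thesis .
qed

lemma fock_linear_eqI:
  assumes "fock_linear S" "fock_linear T"
    and "\<And>b. S (Poly_Mapping.single b 1) = T (Poly_Mapping.single b 1)"
  shows "S f = T f"
  unfolding fock_linear_expansion [OF assms(1), of f] fock_linear_expansion [OF assms(2), of f]
  by (simp only: assms(3))

text \<open>If the matrix of \<open>T\<close> in the monomial bases has finite rows, every coefficient
of \<open>T f\<close> is a finite sum over an index set that depends on the coefficient but not on
\<open>f\<close>, so that \<open>T\<close> commutes with infinite sums, continuations and integrals
taken coefficient by coefficient.\<close>

definition row_finite :: "('i fock \<Rightarrow> 'j fock) \<Rightarrow> bool" where
  "row_finite T \<longleftrightarrow>
     (\<forall>b. finite {a. Poly_Mapping.lookup (T (Poly_Mapping.single a 1)) b \<noteq> 0})"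

lemma lookup_row_finite:
  assumes "fock_linear T" "row_finite T"
  shows "Poly_Mapping.lookup (T f) b =
    (\<Sum>a | Poly_Mapping.lookup (T (Poly_Mapping.single a 1)) b \<noteq> 0.
       Poly_Mapping.lookup (T (Poly_Mapping.single a 1)) b * Poly_Mapping.lookup f a)"
proof -
  let ?M = "\<lambda>a. Poly_Mapping.lookup (T (Poly_Mapping.single a 1)) b"
  have fin: "finite {a. ?M a \<noteq> 0}" using assms(2) by (simp add: row_finite_def)
  have "Poly_Mapping.lookup (T f) b = (\<Sum>a\<in>Poly_Mapping.keys f. ?M a * Poly_Mapping.lookup f a)"
    by (simp add: fock_linear_expansion [OF assms(1), of f] lookup_sum mult.commute)
  also have "\<dots> = (\<Sum>a\<in>Poly_Mapping.keys f \<inter> {a. ?M a \<noteq> 0}. ?M a * Poly_Mapping.lookup f a)"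
    by (intro sum.mono_neutral_right) auto
  also have "\<dots> = (\<Sum>a | ?M a \<noteq> 0. ?M a * Poly_Mapping.lookup f a)"
    using fin by (intro sum.mono_neutral_left) (auto simp: in_keys_iff)
  finally show ?thesis .
qed

lemma row_finite_scaled: "row_finite T \<Longrightarrow> row_finite (\<lambda>f. scal c (T f))"
  unfolding row_finite_def by (auto elim!: allE rev_finite_subset)

lemma osc_vacuum: "m > 0 \<Longrightarrow> osc \<kappa> i m 1 = 0"
proof -
  have "annih (j, n) 1 = 0" for j :: 'a and n
    by (rule poly_mapping_eqI) (simp add: lookup_annih lookup_one)
  then show "m > 0 \<Longrightarrow> osc \<kappa> i m 1 = 0" by (simp add: osc_def)
qed

section \<open>Products of vertex currents\<close>

lemma fock_linear_foldr:
  assumes "\<And>m. m \<in> set ms \<Longrightarrow> fock_linear (A m)"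
  shows "fock_linear (foldr A ms)"
  using assms by (induction ms) (simp_all add: fock_linear_def)

lemma fock_linear_exp_mode:
  assumes "\<And>m. m \<noteq> 0 \<Longrightarrow> fock_linear (A m)"
  shows "fock_linear (exp_mode A n)"
proof -
  have "fock_linear (\<lambda>f. \<Sum>ms\<in>{ms. sum_list ms = n \<and> 0 \<notin> set ms}.
      scal (1 / fact (length ms)) (foldr A ms f))"
  proof (intro fock_linear_pointwise_sum fock_linear_scaled)
    fix ms assume "ms \<in> {ms. sum_list ms = n \<and> 0 \<notin> set ms}"
    then have "0 \<notin> set ms" by simp
    then have "fock_linear (foldr A ms)"
      by (metis fock_linear_foldr assms)
    then show "fock_linear (\<lambda>f. foldr A ms f)" by simp
  qed
  then show ?thesis by (simp add: exp_mode_def [abs_def])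
qed

lemma nexp_mode_zero:
  assumes "\<And>m. m \<noteq> 0 \<Longrightarrow> fock_linear (E m)"
  shows "nexp_mode E n 0 = 0"
proof -
  have "exp_mode (\<lambda>m. E (int m)) l 0 = 0" for l
    by (intro fock_linear_0 fock_linear_exp_mode assms) simp
  then show ?thesis by (simp add: nexp_mode_def)
qed

lemma nexp_mode_scal:
  assumes "\<And>m. m \<noteq> 0 \<Longrightarrow> fock_linear (E m)"
  shows "nexp_mode E n (scal c f) = scal c (nexp_mode E n f)"
proof (cases "c = 0")
  case True
  then show ?thesis by (simp add: nexp_mode_zero assms)
next
  case False
  have scal_0: "scal c g = 0 \<longleftrightarrow> g = 0" for g :: "'a fock"
    using False by (metis lookup_scal lookup_zero mult_eq_0_iff poly_mapping_eqI scal_0_right)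
  have lin: "fock_linear (exp_mode (\<lambda>m. E (int m)) l)" "fock_linear (exp_mode (\<lambda>m. E (- int m)) l)" for l
    by (intro fock_linear_exp_mode assms; simp)+
  show ?thesis
    unfolding nexp_mode_def
    by (simp add: fock_linear_scal [OF lin(1)] fock_linear_scal [OF lin(2)] scal_0 scal_simps(2))
qed

lemma exp_mode_intertwine:
  assumes "fock_linear T" and "\<And>m f. m \<noteq> 0 \<Longrightarrow> T (A m f) = B m (T f)"
  shows "T (exp_mode A n f) = exp_mode B n (T f)"
proof -
  have "T (foldr A ms f) = foldr B ms (T f)" if "0 \<notin> set ms" for ms
    using that by (induction ms) (auto simp: assms(2))
  then show ?thesis
    by (simp add: exp_mode_def fock_linear_sum [OF assms(1)] fock_linear_scal [OF assms(1)])
qed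

text \<open>Injectivity is used for the range of summation in \<open>nexp_mode\<close>, which consists
of the \<open>l\<close> with a nonzero annihilation part and so must be the same on both sides.\<close>

lemma nexp_mode_intertwine:
  assumes T: "fock_linear T" "inj T" and "\<And>m f. m \<noteq> 0 \<Longrightarrow> T (E m f) = E' m (T f)"
  shows "T (nexp_mode E n f) = nexp_mode E' n (T f)"
proof -
  have T0: "T g = 0 \<longleftrightarrow> g = 0" for g
    using T by (metis fock_linear_0 injD)
  have pos: "exp_mode (\<lambda>m. E' (int m)) l (T f) = T (exp_mode (\<lambda>m. E (int m)) l f)"
    and neg: "exp_mode (\<lambda>m. E' (- int m)) l (T g) = T (exp_mode (\<lambda>m. E (- int m)) l g)" for l g
    by (rule exp_mode_intertwine [symmetric, OF T(1)]; simp add: assms(3))+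
  show ?thesis
    by (simp add: nexp_mode_def pos neg T0 fock_linear_sum [OF T(1)])
qed

text \<open>The argument of a current, its zero mode (eigenvalue and shift of the momentum) and its
exponent. They are kept apart because in a product of currents the zero modes are compared as scalars,
while the exponents are intertwined by the identification of the Fock spaces.\<close>

type_synonym ('l, 'i) vertex =
  "complex \<times> ('l \<Rightarrow> complex) \<times> ('l \<Rightarrow> 'l) \<times> (int \<Rightarrow> 'i fock \<Rightarrow> 'i fock)"

fun vertex_op :: "('l, 'i) vertex \<Rightarrow> ('l, 'i) current" where
  "vertex_op (z, g, sh, E) = vertex_current z (zero_mode g sh) E"

fun oscillator_part :: "('l, 'i) vertex \<Rightarrow> int \<Rightarrow> 'i fock \<Rightarrow> 'i fock" where
  "oscillator_part (z, g, sh, E) = E"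

fun total_shift :: "('l, 'i) vertex list \<Rightarrow> 'l \<Rightarrow> 'l" where
  "total_shift [] L = L"
| "total_shift ((z, g, sh, E) # Vs) L = sh (total_shift Vs L)"

fun zero_mode_factor :: "('l, 'i) vertex list \<Rightarrow> 'l \<Rightarrow> complex" where
  "zero_mode_factor [] L = 1"
| "zero_mode_factor ((z, g, sh, E) # Vs) L = g (total_shift Vs L) * zero_mode_factor Vs L"

definition oscillator_product :: "('l, 'i) vertex list \<Rightarrow> int list \<Rightarrow> 'i fock \<Rightarrow> 'i fock" where
  "oscillator_product Vs ns = foldr (\<lambda>(V, n). nexp_mode (oscillator_part V) n) (zip Vs ns)"

lemma zero_mode_single:
  "zero_mode g sh (Poly_Mapping.single L f) = Poly_Mapping.single (sh L) (scal (g L) f)"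
  by (cases "f = 0") (simp_all add: zero_mode_def)

lemma vertex_op_single:
  assumes "\<And>m. m \<noteq> 0 \<Longrightarrow> fock_linear (E m)"
  shows "snd (vertex_op (z, g, sh, E)) n (Poly_Mapping.single L f) =
    Poly_Mapping.single (sh L) (scal (g L) (nexp_mode E n f))"
  by (simp add: vertex_current_def zero_mode_single nexp_mode_zero nexp_mode_scal assms)

text \<open>On a single sector every zero mode acts as a scalar followed by a relabelling of the
sector, hence the zero modes can be collected in front of the oscillators. The rightmost current acts
first, so each zero mode is evaluated after the shifts of the currents to its right.\<close>

lemma vertex_product_single:
  assumes "length ns = length Vs"
    and "\<And>V m. V \<in> set Vs \<Longrightarrow> m \<noteq> 0 \<Longrightarrow> fock_linear (oscillator_part V m)"
  shows "mode_product (map vertex_op Vs) ns (Poly_Mapping.single L f) =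
    Poly_Mapping.single (total_shift Vs L) (scal (zero_mode_factor Vs L) (oscillator_product Vs ns f))"
  using assms
proof (induction Vs arbitrary: ns)
  case Nil
  then show ?case by (simp add: mode_product_def oscillator_product_def)
next
  case (Cons V Vs)
  obtain n ns' where ns: "ns = n # ns'" "length ns' = length Vs"
    using Cons.prems(1) by (cases ns) auto
  obtain z g sh E where V: "V = (z, g, sh, E)" by (cases V)
  have E: "\<And>m. m \<noteq> 0 \<Longrightarrow> fock_linear (E m)" using Cons.prems(2) [of V] by (simp add: V)
  have "mode_product (map vertex_op Vs) ns' (Poly_Mapping.single L f) =
    Poly_Mapping.single (total_shift Vs L) (scal (zero_mode_factor Vs L) (oscillator_product Vs ns' f))"
    using Cons.prems(2) by (intro Cons.IH ns) simp_all
  then show ?case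
    by (simp add: ns V mode_product_def oscillator_product_def nexp_mode_scal E scal_simps(7)
        vertex_op_single [of E, OF E] del: vertex_op.simps)
qed

lemma oscillator_product_scal:
  assumes "\<And>V m. V \<in> set Vs \<Longrightarrow> m \<noteq> 0 \<Longrightarrow> fock_linear (oscillator_part V m)"
  shows "oscillator_product Vs ns (scal c f) = scal c (oscillator_product Vs ns f)"
  using assms
proof (induction Vs arbitrary: ns)
  case Nil
  then show ?case by (simp add: oscillator_product_def)
next
  case (Cons V Vs)
  have IH: "oscillator_product Vs ns' (scal c f) = scal c (oscillator_product Vs ns' f)" for ns'
    using Cons.prems by (intro Cons.IH) simp_all
  show ?case
  proof (cases ns)
    case Nil
    then show ?thesis by (simp add: oscillator_product_def)
  next
    case (Cons n ns')
    then show ?thesis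
      using IH [of ns'] Cons.prems
      by (simp add: oscillator_product_def nexp_mode_scal)
  qed
qed

lemma oscillator_product_intertwine:
  assumes T: "fock_linear T" "inj T"
    and "list_all2 (\<lambda>V V'. \<forall>m f. m \<noteq> 0 \<longrightarrow> T (oscillator_part V m f) = oscillator_part V' m (T f)) Vs Vs'"
  shows "T (oscillator_product Vs ns f) = oscillator_product Vs' ns (T f)"
  using assms(3)
proof (induction Vs Vs' arbitrary: ns rule: list_all2_induct)
  case Nil
  then show ?case by (simp add: oscillator_product_def)
next
  case (Cons V Vs V' Vs')
  show ?case
  proof (cases ns)
    case Nil
    then show ?thesis by (simp add: oscillator_product_def)
  next
    case (Cons n ns')
    have "T (nexp_mode (oscillator_part V) n g) = nexp_mode (oscillator_part V') n (T g)" for g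
      using Cons.hyps by (intro nexp_mode_intertwine T) simp
    then show ?thesis using Cons.IH [of ns']
      by (simp add: oscillator_product_def Cons)
  qed
qed

lemma total_shift_append: "total_shift (Us @ Vs) L = total_shift Us (total_shift Vs L)"
  by (induction Us) auto

lemma zero_mode_factor_append:
  "zero_mode_factor (Us @ Vs) L = zero_mode_factor Us (total_shift Vs L) * zero_mode_factor Vs L"
  by (induction Us) (auto simp: total_shift_append)

text \<open>The start \<open>a\<close> of the index range is arbitrary for the sake of the induction,
which removes the first current of the list.\<close>

lemma total_shift_replicated:
  "total_shift (map (\<lambda>j. (z j, g j, sh, E)) [a..<a + n]) L = (sh ^^ n) L"
  by (induction n arbitrary: a) (simp_all add: upt_conv_Cons del: upt_Suc flip: add_Suc)

lemma zero_mode_factor_replicated: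
  "zero_mode_factor (map (\<lambda>j. (z j, g j, sh, E)) [a..<a + n]) L =
     (\<Prod>j<n. g (a + j) ((sh ^^ (n - Suc j)) L))"
proof (induction n arbitrary: a)
  case 0
  then show ?case by simp
next
  case (Suc n)
  have "[a..<a + Suc n] = a # [Suc a..<Suc a + n]" by (simp add: upt_conv_Cons)
  then show ?case
    using Suc [of "Suc a"] total_shift_replicated [of z g sh E "Suc a" n L]
    by (simp add: prod.lessThan_Suc_shift del: upt_Suc prod.lessThan_Suc)
qed

lemma total_shift_map_upt:
  "total_shift (map (\<lambda>j. (z j, g j, sh, E)) [1..<Suc N]) L = (sh ^^ N) L"
  using total_shift_replicated [of z g sh E 1 N L] by simp

lemma zero_mode_factor_map_upt:
  "zero_mode_factor (map (\<lambda>j. (z j, g j, sh, E)) [1..<Suc N]) L = (\<Prod>j\<in>{1..N}. g j ((sh ^^ (N - j)) L))"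
  using zero_mode_factor_replicated [of z g sh E 1 N L] by (simp add: prod.atLeast1_atMost_eq)

lemma mode_product_zero_mode_single:
  assumes "length ns = length Vs"
    and lin: "\<And>V m. V \<in> set Vs \<Longrightarrow> m \<noteq> 0 \<Longrightarrow> fock_linear (oscillator_part V m)"
  shows "mode_product (map vertex_op Vs) ns (zero_mode K (\<lambda>L. L) (Poly_Mapping.single L f)) =
    Poly_Mapping.single (total_shift Vs L) (scal (K L * zero_mode_factor Vs L) (oscillator_product Vs ns f))"
  using assms(1)
  by (simp add: zero_mode_single vertex_product_single oscillator_product_scal lin scal_simps(7) mult.commute)

section \<open>Integrals of products of currents\<close>

text \<open>The continued values of the integrand are unique, and so is the Bochner integral, up to
null sets.\<close>

lemma has_current_integral_unique:
  assumes "has_current_integral N Xs K \<psi> \<phi>" "has_current_integral N Xs K \<psi> \<phi>'"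
  shows "\<phi> = \<phi>'"
proof -
  from assms obtain \<Psi> \<Psi>' where
      AE: "AE \<theta> in torus N. \<forall>L b. product_element (Xs \<theta>) (zero_mode (K \<theta>) (\<lambda>L. L) \<psi>) L b (\<Psi> \<theta> L b)"
        "AE \<theta> in torus N. \<forall>L b. product_element (Xs \<theta>) (zero_mode (K \<theta>) (\<lambda>L. L) \<psi>) L b (\<Psi>' \<theta> L b)"
    and int: "\<And>L b. has_bochner_integral (torus N) (\<lambda>\<theta>. \<Psi> \<theta> L b)
              (Poly_Mapping.lookup (Poly_Mapping.lookup \<phi> L) b)"
       "\<And>L b. has_bochner_integral (torus N) (\<lambda>\<theta>. \<Psi>' \<theta> L b)
              (Poly_Mapping.lookup (Poly_Mapping.lookup \<phi>' L) b)"
    unfolding has_current_integral_def by blast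
  have "Poly_Mapping.lookup (Poly_Mapping.lookup \<phi> L) b =
      Poly_Mapping.lookup (Poly_Mapping.lookup \<phi>' L) b" for L b
  proof (rule has_bochner_integral_eq_AE [OF int])
    show "AE \<theta> in torus N. \<Psi> \<theta> L b = \<Psi>' \<theta> L b"
      using AE by eventually_elim (blast intro: product_element_unique)
  qed
  then show ?thesis by (intro poly_mapping_eqI)
qed

lemma current_integral_eqI:
  "has_current_integral N Xs K \<psi> \<phi> \<Longrightarrow> current_integral N Xs K \<psi> = \<phi>"
  unfolding current_integral_def
  by (auto intro: has_current_integral_unique)

lemma zero_in_sector: "0 \<in> sector L"
  unfolding sector_def by (metis rangeI single_zero)

lemma single_in_sector: "Poly_Mapping.single L f \<in> sector L"
  by (simp add: sector_def)

text \<open>The matrix elements towards the other sectors vanish identically, and 0 is the only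
continued value of the zero series.\<close>

lemma current_integral_in_sector:
  assumes "\<And>\<theta> ns. length ns = length (Xs \<theta>) \<Longrightarrow>
    mode_product (Xs \<theta>) ns (zero_mode (K \<theta>) (\<lambda>L. L) \<psi>) \<in> sector L"
  shows "current_integral N Xs K \<psi> \<in> sector L"
proof (cases "\<exists>\<phi>. has_current_integral N Xs K \<psi> \<phi>")
  case False
  then show ?thesis by (simp add: current_integral_def zero_in_sector)
next
  case True
  then obtain \<phi> where \<phi>: "has_current_integral N Xs K \<psi> \<phi>" by blast
  then obtain \<Psi> where
      AE: "AE \<theta> in torus N. \<forall>L b. product_element (Xs \<theta>) (zero_mode (K \<theta>) (\<lambda>L. L) \<psi>) L b (\<Psi> \<theta> L b)"
    and int: "\<And>L b. has_bochner_integral (torus N) (\<lambda>\<theta>. \<Psi> \<theta> L b)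
              (Poly_Mapping.lookup (Poly_Mapping.lookup \<phi> L) b)"
    unfolding has_current_integral_def by blast
  have "Poly_Mapping.lookup \<phi> L' = 0" if "L' \<noteq> L" for L'
  proof (rule poly_mapping_eqI)
    fix b
    have "AE \<theta> in torus N. \<Psi> \<theta> L' b = 0"
      using AE
    proof eventually_elim
      case (elim \<theta>)
      have "Poly_Mapping.lookup (Poly_Mapping.lookup
          (mode_product (Xs \<theta>) ns (zero_mode (K \<theta>) (\<lambda>L. L) \<psi>)) L') b = 0"
        if "length ns = length (map fst (Xs \<theta>))" for ns
        using assms [of ns \<theta>] that \<open>L' \<noteq> L\<close> by (auto simp: sector_def lookup_single)
      moreover have "continued_sum (map fst (Xs \<theta>)) (\<lambda>ns. Poly_Mapping.lookup (Poly_Mapping.lookup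
          (mode_product (Xs \<theta>) ns (zero_mode (K \<theta>) (\<lambda>L. L) \<psi>)) L') b) (\<Psi> \<theta> L' b)"
        using elim unfolding product_element_iff_continued_sum by blast
      ultimately have "continued_sum (map fst (Xs \<theta>)) (\<lambda>ns. 0) (\<Psi> \<theta> L' b)"
        by (subst (asm) continued_sum_cong [where a' = "\<lambda>ns. 0"]) simp_all
      then show ?case by (rule continued_sum_unique [OF _ continued_sum_zero])
    qed
    then show "Poly_Mapping.lookup (Poly_Mapping.lookup \<phi> L') b = Poly_Mapping.lookup 0 b"
      using has_bochner_integral_eq_AE [OF int has_bochner_integral_zero] by simp
  qed
  then have "\<phi> = Poly_Mapping.single L (Poly_Mapping.lookup \<phi> L)"
    by (intro poly_mapping_eqI) (auto simp: lookup_single when_def)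
  then show ?thesis
    using current_integral_eqI [OF \<phi>] by (metis single_in_sector)
qed

text \<open>The map \<open>T\<close> acts on an integral coefficient by coefficient through finite
sums, hence it can be applied to every mode of the product instead of to the integral. Any scalar ratio
of the two integrands is part of \<open>T\<close>.\<close>

lemma has_current_integral_transport:
  assumes T: "fock_linear T" "row_finite T"
    and args: "\<And>\<theta>. map fst (Xs' \<theta>) = map fst (Xs \<theta>)"
    and prod: "\<And>\<theta> ns. length ns = length (Xs \<theta>) \<Longrightarrow>
      mode_product (Xs \<theta>) ns (zero_mode (K \<theta>) (\<lambda>L. L) \<psi>) =
        Poly_Mapping.single L (W \<theta> ns)"
    and prod': "\<And>\<theta> ns. length ns = length (Xs \<theta>) \<Longrightarrow>
      mode_product (Xs' \<theta>) ns (zero_mode (K' \<theta>) (\<lambda>L. L) \<psi>') =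
        Poly_Mapping.single L' (T (W \<theta> ns))"
    and int: "has_current_integral N Xs K \<psi> \<phi>"
  shows "has_current_integral N Xs' K' \<psi>'
    (Poly_Mapping.single L' (T (Poly_Mapping.lookup \<phi> L)))"
proof -
  from int obtain \<Psi> where
      AE: "AE \<theta> in torus N. \<forall>L b. product_element (Xs \<theta>) (zero_mode (K \<theta>) (\<lambda>L. L) \<psi>) L b (\<Psi> \<theta> L b)"
    and int: "\<And>L b. has_bochner_integral (torus N) (\<lambda>\<theta>. \<Psi> \<theta> L b)
              (Poly_Mapping.lookup (Poly_Mapping.lookup \<phi> L) b)"
    unfolding has_current_integral_def by blast
  define M where "M = (\<lambda>b a. Poly_Mapping.lookup (T (Poly_Mapping.single a 1)) b)"
  have fin: "finite {a. M b a \<noteq> 0}" for b using T(2) by (simp add: M_def row_finite_def)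
  have lookup_T: "Poly_Mapping.lookup (T f) b = (\<Sum>a | M b a \<noteq> 0. M b a * Poly_Mapping.lookup f a)" for f b
    unfolding M_def by (rule lookup_row_finite [OF T])
  define \<Psi>' where "\<Psi>' = (\<lambda>\<theta> M' b. if M' = L' then \<Sum>a | M b a \<noteq> 0. M b a * \<Psi> \<theta> L a else 0)"
  have "AE \<theta> in torus N. \<forall>L b.
      product_element (Xs' \<theta>) (zero_mode (K' \<theta>) (\<lambda>L. L) \<psi>') L b (\<Psi>' \<theta> L b)"
    using AE
  proof (eventually_elim, intro allI)
    fix \<theta> L'' b
    assume el: "\<forall>L b. product_element (Xs \<theta>) (zero_mode (K \<theta>) (\<lambda>L. L) \<psi>) L b (\<Psi> \<theta> L b)"
    show "product_element (Xs' \<theta>) (zero_mode (K' \<theta>) (\<lambda>L. L) \<psi>') L'' b (\<Psi>' \<theta> L'' b)"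
    proof (cases "L'' = L'")
      case False
      then show ?thesis
        unfolding product_element_iff_continued_sum args
        by (subst continued_sum_cong [where a' = "\<lambda>ns. 0"])
          (simp_all add: prod' lookup_single \<Psi>'_def continued_sum_zero)
    next
      case True
      have "continued_sum (map fst (Xs \<theta>)) (\<lambda>ns. Poly_Mapping.lookup (W \<theta> ns) a) (\<Psi> \<theta> L a)" for a
        using el unfolding product_element_iff_continued_sum
        by (subst continued_sum_cong [where a' = "\<lambda>ns. Poly_Mapping.lookup (Poly_Mapping.lookup
            (mode_product (Xs \<theta>) ns (zero_mode (K \<theta>) (\<lambda>L. L) \<psi>)) L) a"])
          (simp_all add: prod)
      then have "continued_sum (map fst (Xs \<theta>))
          (\<lambda>ns. \<Sum>a | M b a \<noteq> 0. M b a * Poly_Mapping.lookup (W \<theta> ns) a) (\<Psi>' \<theta> L'' b)"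
        unfolding \<Psi>'_def using True fin
        by (simp add: continued_sum_linear_combination)
      then show ?thesis
        unfolding product_element_iff_continued_sum args
        by (subst continued_sum_cong
            [where a' = "\<lambda>ns. \<Sum>a | M b a \<noteq> 0. M b a * Poly_Mapping.lookup (W \<theta> ns) a"])
          (simp_all add: prod' True lookup_T)
    qed
  qed
  moreover have "has_bochner_integral (torus N) (\<lambda>\<theta>. \<Psi>' \<theta> L'' b)
      (Poly_Mapping.lookup (Poly_Mapping.lookup
        (Poly_Mapping.single L' (T (Poly_Mapping.lookup \<phi> L))) L'') b)" for L'' b
  proof (cases "L'' = L'")
    case True
    then show ?thesis
      by (simp add: \<Psi>'_def lookup_T has_bochner_integral_sum has_bochner_integral_mult_right int)
  next
    case False
    then show ?thesis by (simp add: \<Psi>'_def lookup_single has_bochner_integral_zero)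
  qed
  ultimately show ?thesis unfolding has_current_integral_def by blast
qed

text \<open>Transport along \<open>T\<close> and back along its inverse shows that one integral exists
if and only if the other does, so the identity includes the case in which both take the default value 0.\<close>

lemma current_integral_transport:
  assumes T: "fock_linear T" "row_finite T" and T': "fock_linear T'" "row_finite T'"
    and inverse: "\<And>f. T' (T f) = f"
    and args: "\<And>\<theta>. map fst (Xs' \<theta>) = map fst (Xs \<theta>)"
    and prod: "\<And>\<theta> ns. length ns = length (Xs \<theta>) \<Longrightarrow>
      mode_product (Xs \<theta>) ns (zero_mode (K \<theta>) (\<lambda>L. L) \<psi>) = Poly_Mapping.single L (W \<theta> ns)"
    and prod': "\<And>\<theta> ns. length ns = length (Xs \<theta>) \<Longrightarrow>
      mode_product (Xs' \<theta>) ns (zero_mode (K' \<theta>) (\<lambda>L. L) \<psi>') = Poly_Mapping.single L' (T (W \<theta> ns))"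
  shows "current_integral N Xs' K' \<psi>' =
    Poly_Mapping.single L' (T (Poly_Mapping.lookup (current_integral N Xs K \<psi>) L))"
proof (cases "\<exists>\<phi>. has_current_integral N Xs K \<psi> \<phi>")
  case True
  then obtain \<phi> where \<phi>: "has_current_integral N Xs K \<psi> \<phi>" by blast
  have "has_current_integral N Xs' K' \<psi>' (Poly_Mapping.single L' (T (Poly_Mapping.lookup \<phi> L)))"
    by (rule has_current_integral_transport [OF T args prod prod' \<phi>])
  then show ?thesis
    using \<phi> by (simp add: current_integral_eqI)
next
  case False
  have length: "length (Xs' \<theta>) = length (Xs \<theta>)" for \<theta>
    using arg_cong [OF args, of length \<theta>] by simp
  have "\<not> has_current_integral N Xs' K' \<psi>' \<phi>'" for \<phi>'
  proof
    assume \<phi>': "has_current_integral N Xs' K' \<psi>' \<phi>'"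
    have "has_current_integral N Xs K \<psi> (Poly_Mapping.single L (T' (Poly_Mapping.lookup \<phi>' L')))"
    proof (rule has_current_integral_transport [OF T' args [symmetric] _ _ \<phi>'])
      show "mode_product (Xs' \<theta>) ns (zero_mode (K' \<theta>) (\<lambda>L. L) \<psi>') = Poly_Mapping.single L' (T (W \<theta> ns))"
        if "length ns = length (Xs' \<theta>)" for \<theta> ns
        using that by (simp add: prod' length)
      show "mode_product (Xs \<theta>) ns (zero_mode (K \<theta>) (\<lambda>L. L) \<psi>) = Poly_Mapping.single L (T' (T (W \<theta> ns)))"
        if "length ns = length (Xs' \<theta>)" for \<theta> ns
        using that by (simp add: prod length inverse)
    qed
    then show False using False by blast
  qed
  then show ?thesis
    using False by (simp add: current_integral_def fock_linear_0 [OF T(1)])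
qed

section \<open>Linear substitutions of the oscillators\<close>

definition linear_form :: "(nat \<Rightarrow> 'i \<Rightarrow> 'j::finite \<Rightarrow> complex) \<Rightarrow> 'i \<times> nat \<Rightarrow> 'j fock" where
  "linear_form A a = (\<Sum>j\<in>UNIV. Poly_Mapping.single {#(j, snd a)#} (A (snd a) (fst a) j))"

text \<open>The homomorphism of polynomial rings that replaces the variable \<open>(i, n)\<close> by
the linear form \<open>\<Sum>\<^sub>j A n i j (j, n)\<close>.\<close>

definition oscillator_subst :: "(nat \<Rightarrow> 'i \<Rightarrow> 'j::finite \<Rightarrow> complex) \<Rightarrow> 'i fock \<Rightarrow> 'j fock" where
  "oscillator_subst A f =
     (\<Sum>b\<in>Poly_Mapping.keys f. scal (Poly_Mapping.lookup f b) (\<Prod>a\<in>#b. linear_form A a))"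

lemma oscillator_subst_superset:
  assumes "finite S" "Poly_Mapping.keys f \<subseteq> S"
  shows "oscillator_subst A f =
    (\<Sum>b\<in>S. scal (Poly_Mapping.lookup f b) (\<Prod>a\<in>#b. linear_form A a))"
  unfolding oscillator_subst_def
  using assms by (intro sum.mono_neutral_left) (auto simp: in_keys_iff)

lemma fock_linear_oscillator_subst: "fock_linear (oscillator_subst A)"
  unfolding fock_linear_def
proof (intro conjI allI)
  fix f g :: "'a fock"
  let ?S = "Poly_Mapping.keys f \<union> Poly_Mapping.keys g"
  have "oscillator_subst A (f + g) =
      (\<Sum>b\<in>?S. scal (Poly_Mapping.lookup (f + g) b) (\<Prod>a\<in>#b. linear_form A a))"
    by (intro oscillator_subst_superset keys_add) simp
  also have "\<dots> = oscillator_subst A f + oscillator_subst A g"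
    by (simp add: oscillator_subst_superset [of ?S] lookup_add scal_add_left sum.distrib)
  finally show "oscillator_subst A (f + g) = oscillator_subst A f + oscillator_subst A g" .
next
  fix c and f :: "'a fock"
  have "oscillator_subst A (scal c f) = (\<Sum>b\<in>Poly_Mapping.keys f.
      scal (Poly_Mapping.lookup (scal c f) b) (\<Prod>a\<in>#b. linear_form A a))"
    by (intro oscillator_subst_superset) (auto simp: in_keys_iff)
  also have "\<dots> = scal c (oscillator_subst A f)"
    by (simp add: oscillator_subst_def scal_simps)
  finally show "oscillator_subst A (scal c f) = scal c (oscillator_subst A f)" .
qed

lemma oscillator_subst_single:
  "oscillator_subst A (Poly_Mapping.single b 1) = (\<Prod>a\<in>#b. linear_form A a)"
  by (subst oscillator_subst_superset [of "{b}"]) auto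

lemma oscillator_subst_vacuum: "oscillator_subst A 1 = 1"
  using oscillator_subst_single [of A "{#}"] by (simp add: single_one flip: zero_multiset_def)

lemma single_mult: "Poly_Mapping.single {#a#} c * f = scal c (create a f)"
proof -
  have "Poly_Mapping.single {#a#} c = scal c (Poly_Mapping.single {#a#} 1)" by simp
  moreover have "scal c g * f = scal c (g * f)" for g
    by (simp add: scal_def mult_map_scale_conv_mult mult.assoc)
  ultimately show ?thesis by (simp add: create_def del: scal_single)
qed

lemma oscillator_subst_create:
  "oscillator_subst A (create (i, n) f) =
     (\<Sum>j\<in>UNIV. scal (A n i j) (create (j, n) (oscillator_subst A f)))"
proof -
  let ?T = "oscillator_subst A"
  let ?S = "\<lambda>f. \<Sum>j\<in>UNIV. scal (A n i j) (create (j, n) f)"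
  have lin: "fock_linear ?S"
    by (intro fock_linear_pointwise_sum fock_linear_scaled fock_linear_create)
  have mono: "?T (create (i, n) (Poly_Mapping.single b 1)) = ?S (?T (Poly_Mapping.single b 1))" for b
    by (simp add: create_single oscillator_subst_single linear_form_def sum_distrib_right single_mult)
  have L: "fock_linear (\<lambda>f. ?T (create (i, n) f))" "fock_linear (\<lambda>f. ?S (?T f))"
    using fock_linear_compose [OF fock_linear_oscillator_subst fock_linear_create]
      fock_linear_compose [OF lin fock_linear_oscillator_subst] by blast+
  show ?thesis by (rule fock_linear_eqI [OF L mono])
qed

text \<open>The creation operators generate the Fock space from the vacuum.\<close>

lemma oscillator_subst_unique:
  assumes "fock_linear T" "T 1 = 1"
    and "\<And>i n f. T (create (i, n) f) = (\<Sum>j\<in>UNIV. scal (A n i j) (create (j, n) (T f)))"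
  shows "T = oscillator_subst A"
proof
  fix f
  show "T f = oscillator_subst A f"
  proof (induction f rule: fock_induct)
    case vacuum
    then show ?case by (simp add: assms(2) oscillator_subst_vacuum)
  next
    case (create a f)
    then show ?case by (cases a) (simp add: assms(3) oscillator_subst_create)
  next
    case (scal c f)
    then show ?case
      by (simp add: fock_linear_scal [OF assms(1)] fock_linear_scal [OF fock_linear_oscillator_subst])
  next
    case (add f g)
    then show ?case
      by (simp add: fock_linear_add [OF assms(1)] fock_linear_add [OF fock_linear_oscillator_subst])
  qed
qed

lemma oscillator_subst_inverse:
  fixes A :: "nat \<Rightarrow> 'i::finite \<Rightarrow> 'j::finite \<Rightarrow> complex"
  assumes "\<And>n i k. (\<Sum>j\<in>UNIV. A n i j * B n j k) = (if i = k then 1 else 0)"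
  shows "oscillator_subst B (oscillator_subst A f) = f"
proof (induction f rule: fock_induct)
  case vacuum
  then show ?case by (simp add: oscillator_subst_vacuum)
next
  case (create a f)
  obtain i n where a: "a = (i, n)" by (cases a)
  have "oscillator_subst B (oscillator_subst A (create a f)) =
      (\<Sum>j\<in>UNIV. \<Sum>k\<in>UNIV. scal (A n i j * B n j k) (create (k, n) f))"
    by (simp add: a oscillator_subst_create fock_linear_sum [OF fock_linear_oscillator_subst]
        fock_linear_scal [OF fock_linear_oscillator_subst] create scal_simps)
  also have "\<dots> = (\<Sum>k\<in>UNIV. scal (if i = k then 1 else 0) (create (k, n) f))"
    by (subst sum.swap) (simp only: assms flip: scal_sum_left)
  also have "\<dots> = (\<Sum>k\<in>UNIV. if i = k then create (k, n) f else 0)"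
    by (intro sum.cong) auto
  finally show ?case by (simp add: a)
next
  case (scal c f)
  then show ?case by (simp add: fock_linear_scal [OF fock_linear_oscillator_subst])
next
  case (add f g)
  then show ?case by (simp add: fock_linear_add [OF fock_linear_oscillator_subst])
qed

lemma finite_image_mset_snd: "finite {b :: ('i::finite \<times> nat) multiset. image_mset snd b = M}"
proof (rule finite_subset)
  show "{b :: ('i \<times> nat) multiset. image_mset snd b = M} \<subseteq>
      multisets_of_size (UNIV \<times> set_mset M) (size M)"
    by (force simp: multisets_of_size_def)
qed (simp add: finite_multisets_of_size)

text \<open>A substitution changes the species of the oscillators in a monomial but preserves the
multiset of their modes. With finitely many species there are only finitely many monomials with given
modes.\<close>

lemma row_finite_oscillator_subst:
  fixes A :: "nat \<Rightarrow> 'i::finite \<Rightarrow> 'j::finite \<Rightarrow> complex"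
  shows "row_finite (oscillator_subst A)"
proof -
  have modes: "image_mset snd b = image_mset snd a"
    if "Poly_Mapping.lookup (oscillator_subst A (Poly_Mapping.single a 1)) b \<noteq> 0" for a b
    using that
  proof (induction a arbitrary: b)
    case empty
    have "(Poly_Mapping.single {#} 1 :: 'i fock) = 1" by (simp flip: single_one)
    then show ?case using empty
      by (simp add: oscillator_subst_vacuum lookup_one when_def split: if_splits)
  next
    case (add a as)
    obtain i n where a: "a = (i, n)" by (cases a)
    have "oscillator_subst A (Poly_Mapping.single (add_mset a as) 1) = (\<Sum>j\<in>UNIV.
        scal (A n i j) (create (j, n) (oscillator_subst A (Poly_Mapping.single as 1))))"
      by (simp add: a oscillator_subst_create flip: create_single)
    then have "(\<Sum>j\<in>UNIV. A n i j * Poly_Mapping.lookup (create (j, n)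
        (oscillator_subst A (Poly_Mapping.single as 1))) b) \<noteq> 0"
      using add.prems by (simp add: lookup_sum)
    then obtain j where "A n i j * Poly_Mapping.lookup (create (j, n)
        (oscillator_subst A (Poly_Mapping.single as 1))) b \<noteq> 0"
      by (rule sum.not_neutral_contains_not_neutral)
    then have "Poly_Mapping.lookup (create (j, n)
        (oscillator_subst A (Poly_Mapping.single as 1))) b \<noteq> 0"
      by auto
    then have j: "(j, n) \<in># b"
        "Poly_Mapping.lookup (oscillator_subst A (Poly_Mapping.single as 1)) (b - {#(j, n)#}) \<noteq> 0"
      by (auto simp: lookup_create split: if_splits)
    from j(1) obtain b' where "b = add_mset (j, n) b'" by (meson multi_member_split)
    then show ?case using add.IH [OF j(2)] by (simp add: a)
  qed
  show ?thesis
    unfolding row_finite_def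
  proof
    fix b
    have "{a. Poly_Mapping.lookup (oscillator_subst A (Poly_Mapping.single a 1)) b \<noteq> 0}
        \<subseteq> {a. image_mset snd a = image_mset snd b}"
      using modes by fastforce
    then show "finite {a. Poly_Mapping.lookup (oscillator_subst A (Poly_Mapping.single a 1)) b \<noteq> 0}"
      by (rule finite_subset [OF _ finite_image_mset_snd])
  qed
qed

section \<open>The two Heisenberg algebras\<close>

lemma UNIV_beta_index: "UNIV = {B1, B2}"
  using beta_index.exhaust by auto

lemma sum_beta_index: "(\<Sum>j\<in>UNIV. f j) = f B1 + f B2"
  by (simp add: UNIV_beta_index)

lemma UNIV_tor_index: "UNIV = {I0, I1}"
  using tor_index.exhaust by auto

lemma sum_tor_index: "(\<Sum>j\<in>UNIV. f j) = f I0 + f I1"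
  by (simp add: UNIV_tor_index)

lemma qnum_inverse: "0 < x \<Longrightarrow> qnum (inverse x) a = qnum x a"
proof -
  assume x: "0 < x"
  have "inverse x powr b = x powr (- b)" for b
    using x by (simp only: powr_minus inverse_powr less_imp_le)
  moreover have "(u - v) / (c - e) = (v - u) / (e - c)" for u v c e :: real
    by (metis minus_diff_eq minus_divide_divide)
  ultimately show ?thesis
    by (simp only: qnum_def minus_minus inverse_inverse_eq)
qed

lemma qnum_nonzero:
  assumes "0 < x" "x < 1" "a \<noteq> 0"
  shows "qnum x a \<noteq> 0"
proof -
  have "x - inverse x \<noteq> 0"
    using one_less_inverse [of x] assms by linarith
  moreover have "x powr a \<noteq> x powr (- a)"
    using assms by (simp add: powr_inj)
  ultimately show ?thesis by (simp add: qnum_def)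
qed

text \<open>The coefficients of the oscillators \<open>\<beta>\<^sup>1\<^sub>m\<close>,
\<open>\<beta>\<^sup>2\<^sub>m\<close> in the images of \<open>H\<^sub>0\<^sub>,\<^sub>m\<close> and
\<open>H\<^sub>1\<^sub>,\<^sub>m\<close>, up to a factor depending on \<open>m\<close> only. With the
index \<open>m\<close> of either sign one formula covers creation and annihilation operators.\<close>

fun match_weight :: "real \<Rightarrow> real \<Rightarrow> tor_index \<Rightarrow> beta_index \<Rightarrow> int \<Rightarrow> real" where
  "match_weight x s I0 B1 m = 1"
| "match_weight x s I0 B2 m = - 1"
| "match_weight x s I1 B1 m = - (x powr (s * real_of_int m))"
| "match_weight x s I1 B2 m = x powr (- s * real_of_int m)"

text \<open>The exponents of \<open>F\<^sub>1(z)\<close> (for \<open>I0\<close>) and of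
\<open>F\<^sub>0(z)\<close> (for \<open>I1\<close>): the numbering of the screening currents is opposite
to that of the dressed currents.\<close>

definition screening_exponent ::
    "real \<Rightarrow> real \<Rightarrow> real \<Rightarrow> tor_index \<Rightarrow> int \<Rightarrow> beta_index fock \<Rightarrow> beta_index fock" where
  "screening_exponent x r s i m f =
     scal (1 / of_int m) (\<Sum>j\<in>UNIV. scal (of_real (match_weight x s i j m)) (beta x r s j m f))"

lemma F1_exponent_eq: "F1_exponent x r s = screening_exponent x r s I0"
  unfolding F1_exponent_def [abs_def] screening_exponent_def [abs_def] sum_beta_index
  by (intro ext poly_mapping_eqI) (simp add: lookup_add lookup_minus)

lemma F0_exponent_eq: "F0_exponent x r s = screening_exponent x r s I1"
  unfolding F0_exponent_def [abs_def] screening_exponent_def [abs_def] sum_beta_index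
  by simp

lemma fock_linear_screening_exponent: "fock_linear (screening_exponent x r s i m)"
  unfolding screening_exponent_def [abs_def]
  by (intro fock_linear_pointwise_sum fock_linear_scaled fock_linear_osc)

lemma fock_linear_Fhat_exponent: "fock_linear (Fhat_exponent q d p i m)"
  unfolding Fhat_exponent_def [abs_def] by (intro fock_linear_scaled fock_linear_osc)

lemma osc_combination_commutator:
  fixes \<kappa> :: "'i::finite \<Rightarrow> 'i \<Rightarrow> int \<Rightarrow> complex" and a b :: "'i \<Rightarrow> complex"
  assumes "\<And>i j m. \<kappa> j i (- m) = - \<kappa> i j m" and "m \<noteq> 0" "n \<noteq> 0"
  defines "A \<equiv> (\<lambda>f. \<Sum>j\<in>UNIV. scal (a j) (osc \<kappa> j m f))"
    and "B \<equiv> (\<lambda>f. \<Sum>k\<in>UNIV. scal (b k) (osc \<kappa> k n f))"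
  shows "A (B f) - B (A f) =
    (if m + n = 0 then scal (\<Sum>j\<in>UNIV. \<Sum>k\<in>UNIV. a j * b k * \<kappa> j k m) f else 0)"
proof -
  have AB: "A (B f) = (\<Sum>j\<in>UNIV. \<Sum>k\<in>UNIV. scal (a j * b k) (osc \<kappa> j m (osc \<kappa> k n f)))"
    by (simp add: A_def B_def fock_linear_sum [OF fock_linear_osc]
        fock_linear_scal [OF fock_linear_osc] scal_simps)
  have BA: "B (A f) = (\<Sum>j\<in>UNIV. \<Sum>k\<in>UNIV. scal (a j * b k) (osc \<kappa> k n (osc \<kappa> j m f)))"
    by (subst sum.swap) (simp add: A_def B_def fock_linear_sum [OF fock_linear_osc]
        fock_linear_scal [OF fock_linear_osc] scal_simps mult.commute)
  have "A (B f) - B (A f) = (\<Sum>j\<in>UNIV. \<Sum>k\<in>UNIV.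
      scal (a j * b k) (if m + n = 0 then scal (\<kappa> j k m) f else 0))"
    unfolding AB BA
    by (simp add: osc_commutator [of \<kappa>, OF assms(1-3)] scal_simps(8) flip: sum_subtractf)
  then show ?thesis by (simp add: scal_simps(7) scal_sum_left)
qed

text \<open>The conditions on \<open>q\<close> and \<open>d\<close> express \<open>q\<^sub>1 =
x\<^sup>2\<^sup>-\<^sup>s\<close>, \<open>q\<^sub>2 = x\<^sup>-\<^sup>2\<close>, \<open>q\<^sub>3 =
x\<^sup>s\<close>.\<close>

locale matched_parameters =
  fixes x r s q d p :: real
  assumes x: "0 < x" "x < 1" and r: "0 < r" and s: "0 < s"
    and q: "q = inverse x" and d: "d = x powr (1 - s)" and p: "p = x powr (2 * r)"
begin

text \<open>This identity and the next one are the equality of the two quadratic forms, on and off the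
diagonal, after removal of the common factors. Both are Laurent polynomial identities in
\<open>x\<^sup>m\<close> and \<open>x\<^sup>s\<^sup>m\<close>.\<close>

lemma qnum_identity_diag:
  "qnum x (2 * m) * qnum x (s * m) = qnum x m *
     (2 * qnum x ((s - 1) * m) + qnum x m * (x powr (s * m) + x powr (- (s * m))))"
proof -
  define y where "y = x powr m"
  define S where "S = x powr (s * m)"
  have pos: "y > 0" "S > 0" using x by (simp_all add: y_def S_def)
  have e: "2 * m = m + m" "(s - 1) * m = s * m + (- m)" "- (m + m) = - m + - m"
    "- (s * m + (- m)) = - (s * m) + m"
    by (simp_all add: algebra_simps)
  have pw: "x powr (2 * m) = y * y" "x powr (- (2 * m)) = inverse y * inverse y"
    "x powr m = y" "x powr (- m) = inverse y"
    "x powr (s * m) = S" "x powr (- (s * m)) = inverse S"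
    "x powr ((s - 1) * m) = S * inverse y" "x powr (- ((s - 1) * m)) = inverse S * y"
    by (simp_all only: e powr_add powr_minus y_def S_def)
  have "(y * y - inverse y * inverse y) * (S - inverse S) = (y - inverse y) *
     (2 * (S * inverse y - inverse S * y) + (y - inverse y) * (S + inverse S))"
    using pos by (simp add: field_simps)
  then show ?thesis
    unfolding qnum_def pw using x
    by (simp add: divide_simps) (simp add: algebra_simps)
qed

lemma qnum_identity_offdiag:
  "(x powr ((1 - s) * m) + x powr (- ((1 - s) * m))) * qnum x (s * m) =
     qnum x ((s - 1) * m) * (x powr (s * m) + x powr (- (s * m))) + 2 * qnum x m"
proof -
  define y where "y = x powr m"
  define S where "S = x powr (s * m)"
  have pos: "y > 0" "S > 0" using x by (simp_all add: y_def S_def)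
  have e: "(s - 1) * m = s * m + (- m)" "(1 - s) * m = - (s * m) + m"
    "- (s * m + (- m)) = - (s * m) + m" "- (- (s * m) + m) = s * m + (- m)"
    by (simp_all add: algebra_simps)
  have pw: 
    "x powr m = y" "x powr (- m) = inverse y"
    "x powr (s * m) = S" "x powr (- (s * m)) = inverse S"
    "x powr ((s - 1) * m) = S * inverse y" "x powr (- ((s - 1) * m)) = inverse S * y"
    "x powr ((1 - s) * m) = inverse S * y" "x powr (- ((1 - s) * m)) = S * inverse y"
    by (simp_all only: e powr_add powr_minus y_def S_def)
  have "(inverse S * y + S * inverse y) * (S - inverse S) =
     (S * inverse y - inverse S * y) * (S + inverse S) + 2 * (y - inverse y)"
    using pos by (simp add: field_simps)
  then show ?thesis
    unfolding qnum_def pw by (simp add: divide_simps)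
qed

lemma qnum_q: "qnum q a = qnum x a"
  using qnum_inverse [OF x(1)] q by simp

lemma qnum_q_nonzero: "a \<noteq> 0 \<Longrightarrow> qnum q a \<noteq> 0"
  by (simp add: qnum_q qnum_nonzero x)

lemma Fhat_exponent_neg:
  assumes "m > 0"
  shows "Fhat_exponent q d p i (- m) f =
    scal (- (1 / of_real (qnum q (real_of_int m)))) (Hperp q d i (- m) f)"
  using assms by (simp add: Fhat_exponent_def)

text \<open>Dressing multiplies the annihilation part by the factors \<open>K(p\<^sup>-\<^sup>l
z)\<^sup>-\<^sup>1\<close>, whose exponents form a geometric series in \<open>l\<close>; with \<open>p =
q\<^sup>-\<^sup>2\<^sup>r\<close> its sum combines with \<open>q\<^sup>m / [m]\<close> to a ratio of
q-numbers.\<close>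

lemma dressed_coefficient:
  assumes "m > 0"
  shows "q powr m / qnum q m - (q - inverse q) * suminf (\<lambda>l. p powr (real l * m)) =
    1 / qnum q m * (qnum q ((r - 1) * m) / qnum q (r * m))"
proof -
  define y where "y = x powr m"
  define R where "R = x powr (r * m)"
  have y: "0 < y" "y < 1" and R: "0 < R" "R < 1"
    using x r assms by (simp_all add: y_def R_def powr01_less_one)
  have e: "(r - 1) * m = r * m + (- m)" "- (r * m + (- m)) = - (r * m) + m" "2 * r * m = r * m + r * m"
    by (simp_all add: algebra_simps)
  have p_pow: "p powr m = R * R"
    by (simp only: p powr_powr e powr_add R_def)
  have "p powr (real l * m) = (R * R) ^ l" for l
  proof -
    have "p powr (real l * m) = (p powr m) powr real l"
      by (simp add: powr_powr mult.commute)
    also have "\<dots> = (R * R) ^ l"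
      using R by (simp add: p_pow powr_realpow)
    finally show ?thesis .
  qed
  moreover have sq: "u * u < 1" if "0 < u" "u < 1" for u :: real
    using mult_strict_mono [of u 1 u 1] that by simp
  ultimately have geom: "suminf (\<lambda>l. p powr (real l * m)) = 1 / (1 - R * R)"
    using R sq [OF R] by (simp add: suminf_geometric)
  have pw: "x powr m = y" "x powr (- m) = inverse y" "x powr (r * m) = R" "x powr (- (r * m)) = inverse R"
    "x powr ((r - 1) * m) = R * inverse y" "x powr (- ((r - 1) * m)) = inverse R * y"
    by (simp_all only: e powr_add powr_minus y_def R_def)
  have qm: "q powr m = inverse y"
    using x by (simp add: q inverse_powr y_def)
  define D where "D = x - inverse x"
  have D: "D \<noteq> 0" using one_less_inverse [of x] x by (simp add: D_def)
  have nz: "y * y \<noteq> 1" "R * R \<noteq> 1" "y \<noteq> 0" "R \<noteq> 0"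
    using y R sq [OF y] sq [OF R] by auto
  have qD: "q - inverse q = - D" by (simp add: q D_def)
  show ?thesis
    unfolding geom qm qnum_q qD unfolding qnum_def pw D_def [symmetric]
    using D nz by (simp add: divide_simps) (simp add: algebra_simps)
qed

lemma Fhat_exponent_pos:
  assumes "m > 0"
  shows "Fhat_exponent q d p i m f =
    scal (of_real (1 / qnum q m * (qnum q ((r - 1) * m) / qnum q (r * m)))) (Hperp q d i m f)"
  using assms dressed_coefficient [of "real_of_int m"] by (simp add: Fhat_exponent_def)

text \<open>Both sides are the commutator of an annihilation exponent of index \<open>m\<close> with a
creation exponent of index \<open>- m\<close>: on the left for the dressed currents, on the right for
the screening currents.\<close>

lemma form_identity:
  assumes "m > 0"
  shows "of_real (1 / qnum q m * (qnum q ((r - 1) * m) / qnum q (r * m)))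
      * (- (1 / of_real (qnum q (real_of_int m)))) * tor_form q d i i' m =
    (\<Sum>j\<in>UNIV. \<Sum>j'\<in>UNIV. (1 / of_int m * of_real (match_weight x s i j m))
       * (1 / of_int (- m) * of_real (match_weight x s i' j' (- m))) * beta_form x r s j j' m)"
proof -
  define t where "t = real_of_int m"
  define w where "w = (\<lambda>i j u. match_weight x s i j u)"
  define R where "R = qnum x ((r - 1) * t) / qnum x (r * t)"
  define a where "a = qnum x t"
  define b where "b = qnum x (s * t)"
  define b' where "b' = qnum x ((s - 1) * t)"
  define S where "S = x powr (s * t)"
  have t: "t > 0" using assms by (simp add: t_def)
  have S: "S > 0" "x powr (- (s * t)) = inverse S" "x powr (s * t) = S"
    using x by (simp_all add: S_def powr_minus)
  have w: "w I0 B1 u = 1" "w I0 B2 u = - 1" "w I1 B1 m = - S" "w I1 B2 m = inverse S"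
    "w I1 B1 (- m) = - inverse S" "w I1 B2 (- m) = S" for u
    by (simp_all add: w_def S flip: t_def)
  have e: "x powr (s * t * sgn (beta_num B1 - beta_num B2)) = inverse S"
    "x powr (s * t * sgn (beta_num B2 - beta_num B1)) = S"
    by (simp_all add: S)
  have nz: "a \<noteq> 0" "b \<noteq> 0" using t x s by (simp_all add: a_def b_def qnum_nonzero)
  have diag: "qnum x (2 * t) = a * (2 * b' + a * (S + inverse S)) / b"
    using qnum_identity_diag [of t] nz by (simp add: a_def b_def b'_def S field_simps)
  have "d powr t = x powr ((1 - s) * t)" "d powr (- t) = x powr (- ((1 - s) * t))"
    by (simp_all add: d powr_powr)
  then have off: "d powr t + d powr (- t) = (b' * (S + inverse S) + 2 * a) / b"
    using qnum_identity_offdiag [of t] nz by (simp add: a_def b_def b'_def S field_simps)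
  have "1 / qnum q t * (qnum q ((r - 1) * t) / qnum q (r * t)) * (- (1 / qnum q t)) *
     ((if i = i' then qnum q (2 * t) / t
       else - (qnum q t / t) * (d powr t + d powr (- t))) * qnum q t) =
    (\<Sum>j\<in>UNIV. \<Sum>j'\<in>UNIV. (1 / t * w i j m) * (1 / (- t) * w i' j' (- m)) *
       (if j = j' then t * R * (b' / b)
        else - t * R * (a / b) * x powr (s * t * sgn (beta_num j - beta_num j'))))"
    unfolding qnum_q diag off sum_beta_index
    unfolding R_def [symmetric] a_def [symmetric] e
    using nz t S(1) by (cases i; cases i'; simp add: w; simp add: field_simps)
  then have "complex_of_real (1 / qnum q t * (qnum q ((r - 1) * t) / qnum q (r * t)) * (- (1 / qnum q t)) *
     ((if i = i' then qnum q (2 * t) / t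
       else - (qnum q t / t) * (d powr t + d powr (- t))) * qnum q t)) =
    of_real (\<Sum>j\<in>UNIV. \<Sum>j'\<in>UNIV. (1 / t * w i j m) * (1 / (- t) * w i' j' (- m)) *
       (if j = j' then t * R * (b' / b)
        else - t * R * (a / b) * x powr (s * t * sgn (beta_num j - beta_num j'))))"
    by (rule arg_cong)
  then show ?thesis
    unfolding tor_form_def beta_form_def w_def R_def a_def b_def b'_def t_def
    by (simp only: of_real_sum of_real_mult of_real_divide of_real_minus of_real_1
        of_real_of_int_eq of_int_minus)
qed

section \<open>The identification of the Fock spaces\<close>

text \<open>The matching conditions for a positive index are those on the annihilation exponents
verbatim, by \<open>Fhat_exponent_pos\<close>; the conditions for a negative index are those on the
creation exponents up to a common sign.\<close>

lemma matches_oscillators_iff: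
  "matches_oscillators x r s q d \<Phi> \<longleftrightarrow> bij \<Phi> \<and> fock_linear \<Phi> \<and> \<Phi> 1 = 1 \<and>
     (\<forall>i m f. m \<noteq> 0 \<longrightarrow>
        \<Phi> (Fhat_exponent q d p i m f) = screening_exponent x r s i m (\<Phi> f))"
  (is "_ \<longleftrightarrow> ?rhs")
proof -
  define H where "H = (\<lambda>i m f.
      \<Phi> (scal (1 / of_real (qnum q (real_of_int m))) (Hperp q d i (- m) f)) =
        scal (- 1) (screening_exponent x r s i (- m) (\<Phi> f)) \<and>
      \<Phi> (scal (of_real (1 / qnum q (real_of_int m) *
            (qnum q ((r - 1) * real_of_int m) / qnum q (r * real_of_int m)))) (Hperp q d i m f)) =
        screening_exponent x r s i m (\<Phi> f))"
  have neg: "scal (- 1) (screening_exponent x r s i (- m) g) = scal (1 / of_int m)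
      (\<Sum>j\<in>UNIV. scal (of_real (match_weight x s i j (- m))) (beta x r s j (- m) g))" for i m g
    by (simp add: screening_exponent_def scal_simps)
  have minus: "f + scal (- 1) g = f - g" for f g :: "beta_index fock"
    by (rule poly_mapping_eqI) (simp add: lookup_add lookup_minus)
  have "matches_oscillators x r s q d \<Phi> \<longleftrightarrow>
      bij \<Phi> \<and> fock_linear \<Phi> \<and> \<Phi> 1 = 1 \<and> (\<forall>m>0. \<forall>f. H I1 m f \<and> H I0 m f)"
    unfolding matches_oscillators_def fock_linear_def H_def neg
    unfolding screening_exponent_def sum_beta_index
    by (simp add: minus conj_assoc)
  also have "\<dots> \<longleftrightarrow> bij \<Phi> \<and> fock_linear \<Phi> \<and> \<Phi> 1 = 1 \<and> (\<forall>i m f. m > 0 \<longrightarrow> H i m f)"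
    by (metis tor_index.exhaust)
  also have "\<dots> \<longleftrightarrow> ?rhs"
  proof (intro conj_cong refl iffI allI impI)
    fix i and m :: int and f
    assume "fock_linear \<Phi>" and H: "\<forall>i m f. m > 0 \<longrightarrow> H i m f" and m: "(m::int) \<noteq> 0"
    show "\<Phi> (Fhat_exponent q d p i m f) = screening_exponent x r s i m (\<Phi> f)"
    proof (cases "m > 0")
      case True
      then show ?thesis using H by (simp add: H_def Fhat_exponent_pos)
    next
      case False
      with m obtain n where n: "m = - n" "n > 0" by (metis minus_minus neg_0_less_iff_less linorder_neqE)
      have "scal (- 1) (\<Phi> (Fhat_exponent q d p i (- n) f)) =
          scal (- 1) (screening_exponent x r s i (- n) (\<Phi> f))"
        using H n \<open>fock_linear \<Phi>\<close>
        by (simp add: H_def Fhat_exponent_neg scal_simps flip: fock_linear_scal)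
      then show ?thesis by (simp add: scal_cancel n)
    qed
  next
    fix i and m :: int and f
    assume lin: "fock_linear \<Phi>" and E: "\<forall>i m f. m \<noteq> 0 \<longrightarrow>
        \<Phi> (Fhat_exponent q d p i m f) = screening_exponent x r s i m (\<Phi> f)"
    assume m: "m > 0"
    show "H i m f"
      unfolding H_def
    proof (intro conjI)
      have "\<Phi> (scal (1 / of_real (qnum q (real_of_int m))) (Hperp q d i (- m) f)) =
          \<Phi> (scal (- 1) (Fhat_exponent q d p i (- m) f))"
        using m by (simp add: Fhat_exponent_neg scal_simps)
      then show "\<Phi> (scal (1 / of_real (qnum q (real_of_int m))) (Hperp q d i (- m) f)) =
          scal (- 1) (screening_exponent x r s i (- m) (\<Phi> f))"
        using E m by (simp add: fock_linear_scal [OF lin])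
    next
      have "\<Phi> (Fhat_exponent q d p i m f) = screening_exponent x r s i m (\<Phi> f)"
        using E m by simp
      then show "\<Phi> (scal (of_real (1 / qnum q (real_of_int m) *
            (qnum q ((r - 1) * real_of_int m) / qnum q (r * real_of_int m)))) (Hperp q d i m f)) =
          screening_exponent x r s i m (\<Phi> f)"
        by (simp only: Fhat_exponent_pos [OF m])
    qed
  qed
  finally show ?thesis .
qed

text \<open>Index \<open>n\<close> stands for the oscillators of mode \<open>- (n + 1)\<close>.\<close>

definition matching_matrix :: "nat \<Rightarrow> tor_index \<Rightarrow> beta_index \<Rightarrow> complex" where
  "matching_matrix n i j = of_real (qnum q (real (Suc n)) / real (Suc n)
     * match_weight x s i j (- int (Suc n)))"

fun matching_inverse :: "nat \<Rightarrow> beta_index \<Rightarrow> tor_index \<Rightarrow> complex" where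
  "matching_inverse n j i = of_real (real (Suc n) / qnum q (real (Suc n))
     / (x powr (s * real (Suc n)) - x powr (- (s * real (Suc n))))
     * (case (j, i) of (B1, I0) \<Rightarrow> x powr (s * real (Suc n))
        | (B2, I0) \<Rightarrow> x powr (- (s * real (Suc n))) | _ \<Rightarrow> 1))"

lemma matching_matrix_inverse:
  "(\<Sum>j\<in>UNIV. matching_matrix n i j * matching_inverse n j i') = (if i = i' then 1 else 0)"
  "(\<Sum>i\<in>UNIV. matching_inverse n j i * matching_matrix n i j') = (if j = j' then 1 else 0)"
proof -
  define S where "S = x powr (s * real (Suc n))"
  define c where "c = qnum q (real (Suc n)) / real (Suc n)"
  have c: "c \<noteq> 0" using qnum_q_nonzero [of "real (Suc n)"] by (simp add: c_def)
  have cinv: "real (Suc n) / qnum q (real (Suc n)) = inverse c" by (simp add: c_def)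
  have S': "x powr (- (s * real (Suc n))) = inverse S" by (simp add: S_def powr_minus)
  have S: "S > 0" "S < 1" using x s by (simp_all add: S_def powr01_less_one)
  then have D: "S - inverse S \<noteq> 0" using one_less_inverse [of S] by linarith
  have e: "s * real_of_int (- int (Suc n)) = - (s * real (Suc n))"
    "- s * real_of_int (- int (Suc n)) = s * real (Suc n)"
    by (simp_all only: of_int_minus of_int_of_nat_eq mult_minus_left mult_minus_right minus_minus)
  \<comment> \<open>After removal of the scalar \<open>C\<close> the matrix has the rows \<open>(1, - 1)\<close> and \<open>(- U, T)\<close> and the determinant \<open>G = T - U\<close>.\<close>
  define C T U G :: complex where "C = of_real c" and "T = of_real S" and "U = of_real (inverse S)"
    and "G = of_real (S - inverse S)"
  have nz: "C \<noteq> 0" "G \<noteq> 0" and T: "T = G + U"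
    using c D unfolding C_def G_def T_def U_def by (simp_all only: of_real_eq_0_iff not_False_eq_True flip: of_real_add) simp
  have A: "matching_matrix n I0 B1 = C" "matching_matrix n I0 B2 = - C"
    "matching_matrix n I1 B1 = - (C * U)" "matching_matrix n I1 B2 = C * T"
    unfolding matching_matrix_def c_def [symmetric] match_weight.simps e S' S_def [symmetric]
    by (simp_all add: C_def T_def U_def)
  have B: "matching_inverse n B1 I0 = T / (C * G)" "matching_inverse n B2 I0 = U / (C * G)"
    "matching_inverse n B1 I1 = 1 / (C * G)" "matching_inverse n B2 I1 = 1 / (C * G)"
    unfolding matching_inverse.simps cinv S' S_def [symmetric]
    by (simp_all add: C_def T_def U_def G_def divide_inverse)
  show "(\<Sum>j\<in>UNIV. matching_matrix n i j * matching_inverse n j i') = (if i = i' then 1 else 0)"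
    unfolding sum_beta_index
    using nz by (cases i; cases i'; simp add: A B T del: matching_inverse.simps; simp add: field_simps)
  show "(\<Sum>i\<in>UNIV. matching_inverse n j i * matching_matrix n i j') = (if j = j' then 1 else 0)"
    unfolding sum_tor_index
    using nz by (cases j; cases j'; simp add: A B T del: matching_inverse.simps; simp add: field_simps)
qed

lemma create_eq_Fhat_exponent:
  "create (i, n) f =
     scal (- of_real (qnum q (real (Suc n)))) (Fhat_exponent q d p i (- int (Suc n)) f)"
proof -
  have "qnum q (real (Suc n)) \<noteq> 0" by (rule qnum_q_nonzero) simp
  then show ?thesis
    using Fhat_exponent_neg [of "int (Suc n)" i f]
    by (simp add: osc_def scal_simps del: of_nat_Suc)
qed

text \<open>The substitution of linear forms is chosen so that creation operators go to creation
exponents of the screening currents, with the same factor as in \<open>create_eq_Fhat_exponent\<close>.\<close>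

lemma matching_matrix_creation:
  "(\<Sum>j\<in>UNIV. scal (matching_matrix n i j) (create (j, n) g)) =
     scal (- of_real (qnum q (real (Suc n)))) (screening_exponent x r s i (- int (Suc n)) g)"
proof -
  have "beta x r s j (- int (Suc n)) g = create (j, n) g" for j
    by (simp add: osc_def del: of_nat_Suc)
  then show ?thesis
    by (simp add: screening_exponent_def scal_simps matching_matrix_def del: of_nat_Suc)
qed

definition mode_commutator :: "tor_index \<Rightarrow> tor_index \<Rightarrow> int \<Rightarrow> complex" where
  "mode_commutator i i' m =
    of_real (1 / qnum q m * (qnum q ((r - 1) * m) / qnum q (r * m)))
      * (- (1 / of_real (qnum q (real_of_int m)))) * tor_form q d i i' m"

lemma Fhat_exponent_commutator:
  assumes "m > 0" "n > 0"
  shows "Fhat_exponent q d p i m (Fhat_exponent q d p i' (- n) f) =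
    Fhat_exponent q d p i' (- n) (Fhat_exponent q d p i m f)
      + (if m = n then scal (mode_commutator i i' m) f else 0)"
proof -
  define a where "a = complex_of_real (1 / qnum q m * (qnum q ((r - 1) * m) / qnum q (r * m)))"
  define b where "b = - (1 / complex_of_real (qnum q (real_of_int n)))"
  have "Fhat_exponent q d p i m (Fhat_exponent q d p i' (- n) f) -
      Fhat_exponent q d p i' (- n) (Fhat_exponent q d p i m f) =
      scal (a * b) (Hperp q d i m (Hperp q d i' (- n) f) - Hperp q d i' (- n) (Hperp q d i m f))"
    unfolding Fhat_exponent_pos [OF assms(1)] Fhat_exponent_neg [OF assms(2)]
      a_def [symmetric] b_def [symmetric]
    by (simp add: fock_linear_scal [OF fock_linear_osc] scal_simps(7) mult.commute flip: scal_simps(8))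
  also have "\<dots> = (if m = n then scal (mode_commutator i i' m) f else 0)"
    using assms
    by (simp add: osc_commutator [of "tor_form q d", OF tor_form_antisym] scal_simps(7)
        mode_commutator_def a_def b_def)
  finally show ?thesis by (simp add: algebra_simps)
qed

lemma screening_exponent_commutator:
  assumes "m > 0" "n > 0"
  shows "screening_exponent x r s i m (screening_exponent x r s i' (- n) f) =
    screening_exponent x r s i' (- n) (screening_exponent x r s i m f)
      + (if m = n then scal (mode_commutator i i' m) f else 0)"
proof -
  have eq: "screening_exponent x r s i m f = (\<Sum>j\<in>UNIV.
      scal (1 / of_int m * of_real (match_weight x s i j m)) (beta x r s j m f))" for i m f
    by (simp add: screening_exponent_def scal_simps)
  have "screening_exponent x r s i m (screening_exponent x r s i' (- n) f) -
      screening_exponent x r s i' (- n) (screening_exponent x r s i m f) =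
      (if m + - n = 0 then scal (\<Sum>j\<in>UNIV. \<Sum>j'\<in>UNIV.
         1 / of_int m * of_real (match_weight x s i j m)
         * (1 / of_int (- n) * of_real (match_weight x s i' j' (- n))) * beta_form x r s j j' m) f
       else 0)"
    unfolding eq using assms
    by (intro osc_combination_commutator [of "beta_form x r s", OF beta_form_antisym]) auto
  also have "\<dots> = (if m = n then scal (mode_commutator i i' m) f else 0)"
  proof (cases "m = n")
    case True
    then show ?thesis
      using form_identity [OF assms(1), of i i']
      by (simp only: mode_commutator_def add.right_inverse if_True refl)
  qed simp
  finally show ?thesis by (simp add: algebra_simps)
qed

definition matching_map :: "tor_index fock \<Rightarrow> beta_index fock" where
  "matching_map = oscillator_subst matching_matrix"

lemma fock_linear_matching_map: "fock_linear matching_map"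
  by (simp add: matching_map_def fock_linear_oscillator_subst)

lemma matching_map_intertwines_creation:
  assumes "n > 0"
  shows "matching_map (Fhat_exponent q d p i (- n) f) =
    screening_exponent x r s i (- n) (matching_map f)"
proof -
  define k where "k = nat n - 1"
  have n: "n = int (Suc k)" using assms by (simp add: k_def)
  have "qnum q (real (Suc k)) \<noteq> 0" by (rule qnum_q_nonzero) simp
  moreover have "scal (- of_real (qnum q (real (Suc k)))) (matching_map (Fhat_exponent q d p i (- n) f)) =
      scal (- of_real (qnum q (real (Suc k)))) (screening_exponent x r s i (- n) (matching_map f))"
    using oscillator_subst_create [of matching_matrix i k f]
    unfolding matching_matrix_creation create_eq_Fhat_exponent n
    by (simp add: matching_map_def fock_linear_scal [OF fock_linear_oscillator_subst] del: of_nat_Suc)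
  ultimately show ?thesis by (simp add: scal_cancel del: of_nat_Suc)
qed

text \<open>Annihilation exponents kill the vacuum on both sides, and they are moved past a creation
exponent at the cost of the same scalar on both sides. The creation exponents are intertwined already,
so the relation spreads from the vacuum to the whole Fock space.\<close>

lemma matching_map_intertwines_annihilation:
  assumes "m > 0"
  shows "matching_map (Fhat_exponent q d p i m f) = screening_exponent x r s i m (matching_map f)"
  using assms
proof (induction f arbitrary: i m rule: fock_induct)
  case vacuum
  then show ?case
    by (simp add: matching_map_def oscillator_subst_vacuum Fhat_exponent_def screening_exponent_def osc_vacuum
        fock_linear_0 [OF fock_linear_oscillator_subst])
next
  case (create a f)
  obtain i' n where a: "a = (i', n)" by (cases a)
  note lin = fock_linear_scal [OF fock_linear_matching_map] fock_linear_add [OF fock_linear_matching_map]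
    fock_linear_0 [OF fock_linear_matching_map]
    fock_linear_scal [OF fock_linear_Fhat_exponent] fock_linear_scal [OF fock_linear_screening_exponent]
  show ?case
    using create.prems
    by (simp add: a create_eq_Fhat_exponent lin Fhat_exponent_commutator screening_exponent_commutator
        matching_map_intertwines_creation create.IH del: of_nat_Suc)
next
  case (scal c f)
  then show ?case
    by (simp add: fock_linear_scal [OF fock_linear_matching_map]
        fock_linear_scal [OF fock_linear_Fhat_exponent] fock_linear_scal [OF fock_linear_screening_exponent])
next
  case (add f g)
  then show ?case
    by (simp add: fock_linear_add [OF fock_linear_matching_map]
        fock_linear_add [OF fock_linear_Fhat_exponent] fock_linear_add [OF fock_linear_screening_exponent])
qed

definition unmatching_map :: "beta_index fock \<Rightarrow> tor_index fock" where
  "unmatching_map = oscillator_subst matching_inverse"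

lemma unmatching_matching: "unmatching_map (matching_map f) = f"
  unfolding matching_map_def unmatching_map_def
  by (rule oscillator_subst_inverse) (rule matching_matrix_inverse)

lemma matching_unmatching: "matching_map (unmatching_map f) = f"
  unfolding matching_map_def unmatching_map_def
  by (rule oscillator_subst_inverse) (rule matching_matrix_inverse)

lemma bij_matching_map: "bij matching_map"
  by (rule o_bij [of unmatching_map]) (auto simp: unmatching_matching matching_unmatching)

lemma matching_map_intertwines:
  assumes "m \<noteq> 0"
  shows "matching_map (Fhat_exponent q d p i m f) = screening_exponent x r s i m (matching_map f)"
proof (cases "m > 0")
  case False
  then show ?thesis using assms matching_map_intertwines_creation [of "- m"] by simp
qed (rule matching_map_intertwines_annihilation)

lemma matches_oscillators_iff_matching_map:
  "matches_oscillators x r s q d \<Phi> \<longleftrightarrow> \<Phi> = matching_map"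
proof
  assume "\<Phi> = matching_map"
  then show "matches_oscillators x r s q d \<Phi>"
    unfolding matches_oscillators_iff
    using bij_matching_map fock_linear_matching_map matching_map_intertwines
    by (simp add: matching_map_def oscillator_subst_vacuum)
next
  assume "matches_oscillators x r s q d \<Phi>"
  then have \<Phi>: "fock_linear \<Phi>" "\<Phi> 1 = 1"
      "\<And>i m f. m \<noteq> 0 \<Longrightarrow> \<Phi> (Fhat_exponent q d p i m f) = screening_exponent x r s i m (\<Phi> f)"
    unfolding matches_oscillators_iff by auto
  show "\<Phi> = matching_map"
    unfolding matching_map_def
  proof (rule oscillator_subst_unique [OF \<Phi>(1,2)])
    show "\<Phi> (create (i, n) f) = (\<Sum>j\<in>UNIV. scal (matching_matrix n i j) (create (j, n) (\<Phi> f)))" for i n f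
      unfolding matching_matrix_creation create_eq_Fhat_exponent
      by (simp add: fock_linear_scal [OF \<Phi>(1)] \<Phi>(3) del: of_nat_Suc)
  qed
qed

end

section \<open>Sums over pairs and the reflection of the theta function\<close>

lemma sum_pairs_Suc:
  fixes g :: "nat \<Rightarrow> nat \<Rightarrow> complex"
  shows "(\<Sum>i\<in>{1..Suc N}. \<Sum>j\<in>{i<..Suc N}. g i j) =
    (\<Sum>i\<in>{1..N}. \<Sum>j\<in>{i<..N}. g i j) + (\<Sum>i\<in>{1..N}. g i (Suc N))"
proof -
  have "(\<Sum>j\<in>{i<..Suc N}. g i j) = (\<Sum>j\<in>{i<..N}. g i j) + g i (Suc N)" if "i \<le> N" for i
  proof -
    have "{i<..Suc N} = insert (Suc N) {i<..N}" using that by auto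
    then show ?thesis by simp
  qed
  then show ?thesis by (simp add: sum.distrib)
qed

lemma sum_pairs_const: "(\<Sum>i\<in>{1..N}. \<Sum>j\<in>{i<..N}. (c::complex)) = of_nat N * (of_nat N - 1) / 2 * c"
proof (induction N)
  case (Suc N)
  then show ?case by (simp only: sum_pairs_Suc) (simp add: field_simps)
qed simp

lemma sum_pairs_diff:
  fixes u :: "nat \<Rightarrow> complex"
  shows "(\<Sum>i\<in>{1..N}. \<Sum>j\<in>{i<..N}. u j - u i) = (\<Sum>j\<in>{1..N}. (2 * of_nat j - of_nat N - 1) * u j)"
proof (induction N)
  case (Suc N)
  have "(\<Sum>i\<in>{1..Suc N}. \<Sum>j\<in>{i<..Suc N}. u j - u i) =
      (\<Sum>j\<in>{1..N}. (2 * of_nat j - of_nat N - 1) * u j) + (of_nat N * u (Suc N) - (\<Sum>i\<in>{1..N}. u i))"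
    by (simp only: sum_pairs_Suc Suc) (simp add: sum_subtractf)
  also have "\<dots> = (\<Sum>j\<in>{1..N}. (2 * of_nat j - of_nat (Suc N) - 1) * u j) + of_nat N * u (Suc N)"
    by (simp add: algebra_simps sum.distrib sum_subtractf) (simp add: sum_distrib_left mult.commute)
  finally show ?case by (simp add: algebra_simps)
qed simp

lemma sum_pairs_diff_square:
  fixes u :: "nat \<Rightarrow> complex"
  shows "(\<Sum>i\<in>{1..N}. \<Sum>j\<in>{i<..N}. (u j - u i)\<^sup>2) =
    of_nat N * (\<Sum>j\<in>{1..N}. (u j)\<^sup>2) - (\<Sum>j\<in>{1..N}. u j)\<^sup>2"
proof (induction N)
  case (Suc N)
  have "(\<Sum>i\<in>{1..N}. (u (Suc N) - u i)\<^sup>2) =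
      of_nat N * (u (Suc N))\<^sup>2 + (\<Sum>j\<in>{1..N}. (u j)\<^sup>2) - 2 * u (Suc N) * (\<Sum>j\<in>{1..N}. u j)"
    by (simp add: power2_diff sum.distrib sum_subtractf sum_distrib_left mult.assoc)
  then show ?case
    by (simp only: sum_pairs_Suc Suc) (simp add: power2_eq_square algebra_simps)
qed simp

text \<open>The power of \<open>x\<close> in the quotient of products of brackets, where
\<open>f\<close> is the exponent in a single bracket, \<open>R\<close> and \<open>S\<close> are the
parameters \<open>r\<close> and \<open>s\<close>. The squares combine to \<open>- U\<^sup>2\<close>
because the pairs inside the two groups of variables contribute \<open>N \<Sum> u\<^sup>2 - (\<Sum>
u)\<^sup>2\<close> and \<open>N \<Sum> v\<^sup>2 - (\<Sum> v)\<^sup>2\<close>, the mixed pairs \<open>N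
\<Sum> u\<^sup>2 + N \<Sum> v\<^sup>2 - 2 \<Sum> u \<Sum> v\<close>.\<close>

lemma kernel_exponent:
  fixes u v :: "nat \<Rightarrow> complex" and R S :: complex and N :: nat
  assumes R: "R \<noteq> 0"
  defines "f \<equiv> (\<lambda>y. y\<^sup>2 / R - y)" and "n \<equiv> of_nat N :: complex"
    and "U \<equiv> (\<Sum>j\<in>{1..N}. u j - v j)"
  shows "(\<Sum>i\<in>{1..N}. \<Sum>j\<in>{i<..N}. f (u j - u i) + f (u j - u i - 1) + f (v j - v i) + f (v j - v i - 1))
      - (\<Sum>i\<in>{1..N}. \<Sum>j\<in>{1..N}. f (v j - u i - S / 2) + f (v j - u i + S / 2 - 1)) =
    - 2 * U\<^sup>2 / R - n * (1 + 1 / R) + n\<^sup>2 * (S * (2 - S)) / (2 * R)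
      - 2 * (1 + 1 / R) * n * U
      + 2 * (1 + 1 / R) * (\<Sum>i\<in>{1..N}. (n - 2 * of_nat i + 1) * (u i + v i))"
proof -
  let ?Q = "\<lambda>u. \<Sum>j\<in>{1..N}. (u j)\<^sup>2" and ?M = "\<lambda>u. \<Sum>j\<in>{1..N}. u j"
    and ?L = "\<lambda>u. \<Sum>j\<in>{1..N}. (2 * of_nat j - of_nat N - 1) * u j"
  define a where "a = 1 + 1 / R"
  have U: "U = ?M u - ?M v" by (simp add: U_def sum_subtractf)
  have f1: "f y + f (y - 1) = 2 / R * y\<^sup>2 - 2 * a * y + a" for y
    using R by (simp add: f_def a_def field_simps power2_eq_square)
  have f2: "f (y - S / 2) + f (y + S / 2 - 1) = 2 / R * y\<^sup>2 - 2 * a * y + (a - S * (2 - S) / (2 * R))" for y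
    using R by (simp add: f_def a_def field_simps power2_eq_square)
  have pairs: "(\<Sum>i\<in>{1..N}. \<Sum>j\<in>{i<..N}. f (w j - w i) + f (w j - w i - 1)) =
      2 / R * (n * ?Q w - (?M w)\<^sup>2) - 2 * a * ?L w + n * (n - 1) / 2 * a" for w
    unfolding f1 sum.distrib sum_subtractf sum_distrib_left [symmetric]
      sum_pairs_diff_square sum_pairs_const n_def
    by (simp only: sum_pairs_diff flip: sum_subtractf)
  have sq: "(\<Sum>i\<in>{1..N}. \<Sum>j\<in>{1..N}. (v j - u i)\<^sup>2) = n * ?Q v + n * ?Q u - 2 * ?M u * ?M v"
    by (simp add: power2_diff sum.distrib sum_subtractf sum_distrib_left sum_distrib_right n_def
        mult.assoc mult.left_commute [of "v _"] mult.commute [of "v _"]) (rule sum.swap)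
  have lin: "(\<Sum>i\<in>{1..N}. \<Sum>j\<in>{1..N}. v j - u i) = n * ?M v - n * ?M u"
    by (simp add: sum_subtractf n_def sum_distrib_left)
  have all: "(\<Sum>i\<in>{1..N}. \<Sum>j\<in>{1..N}. f (v j - u i - S / 2) + f (v j - u i + S / 2 - 1)) =
      2 / R * (n * ?Q v + n * ?Q u - 2 * ?M u * ?M v) - 2 * a * (n * ?M v - n * ?M u)
        + n\<^sup>2 * (a - S * (2 - S) / (2 * R))"
    unfolding f2 sum.distrib sum_subtractf [of "\<lambda>j. 2 / R * _ j"] sum_subtractf sum_distrib_left [symmetric]
    by (simp only: sq lin flip: sum_subtractf) (simp add: n_def power2_eq_square)
  have split: "(\<Sum>i\<in>{1..N}. \<Sum>j\<in>{i<..N}. f (u j - u i) + f (u j - u i - 1) + f (v j - v i) + f (v j - v i - 1)) =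
      (\<Sum>i\<in>{1..N}. \<Sum>j\<in>{i<..N}. f (u j - u i) + f (u j - u i - 1)) +
      (\<Sum>i\<in>{1..N}. \<Sum>j\<in>{i<..N}. f (v j - v i) + f (v j - v i - 1))"
    by (simp add: sum.distrib add.assoc)
  have L: "(\<Sum>i\<in>{1..N}. (n - 2 * of_nat i + 1) * (u i + v i)) = - ?L u - ?L v"
    unfolding n_def sum_negf [symmetric] sum_subtractf [symmetric] by (intro sum.cong) (auto simp: algebra_simps)
  have "(2 / R * (n * Qu - Mu\<^sup>2) - 2 * a * Lu + n * (n - 1) / 2 * a) +
      (2 / R * (n * Qv - Mv\<^sup>2) - 2 * a * Lv + n * (n - 1) / 2 * a) -
      (2 / R * (n * Qv + n * Qu - 2 * Mu * Mv) - 2 * a * (n * Mv - n * Mu)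
        + n\<^sup>2 * (a - S * (2 - S) / (2 * R))) =
    - 2 * (Mu - Mv)\<^sup>2 / R - n * a + n\<^sup>2 * (S * (2 - S)) / (2 * R)
      - 2 * a * n * (Mu - Mv) + 2 * a * (- Lu - Lv)" for Qu Qv Mu Mv Lu Lv
  proof -
    define e m w where "e = 1 / R" and "m = n * (n - 1) / 2 * a" and "w = S * (2 - S) / (2 * R)"
    have "m + m = n * (n - 1) * a" by (simp add: m_def field_simps)
    moreover have "2 / R = 2 * e" "- 2 * (Mu - Mv)\<^sup>2 / R = - 2 * (Mu - Mv)\<^sup>2 * e"
        "n\<^sup>2 * (S * (2 - S)) / (2 * R) = n\<^sup>2 * w"
      by (simp_all add: e_def w_def)
    ultimately show ?thesis
      unfolding m_def [symmetric] w_def [symmetric] by (simp only:) algebra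
  qed
  then show ?thesis
    unfolding split pairs all L U a_def [symmetric] by this
qed

text \<open>Substitution of \<open>h/2 - n\<close> for the summation variable \<open>n\<close>. The
parity condition says that this maps \<open>\<int> + \<nu>/2\<close> onto \<open>\<int> +
\<nu>'/2\<close>. The reflection combines the shift by \<open>h/2\<close> with the symmetry of the theta
function under inversion of its argument.\<close>

lemma vtheta_reflect:
  fixes \<nu> \<nu>' h :: int
  assumes "p > 0" "Y \<noteq> 0" and "even (h - \<nu> - \<nu>')"
  shows "vtheta \<nu>' Y p =
    of_real (p powr ((real_of_int h)\<^sup>2 / 4)) * Y powi h * vtheta \<nu> (of_real (p powr (- real_of_int h / 2)) / Y) p"
proof -
  obtain a where a: "h - \<nu> - \<nu>' = 2 * a" using assms(3) by (elim evenE)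
  define g where "g = (\<lambda>m::int. of_real (p powr ((of_int m + of_int \<nu>' / 2)\<^sup>2)) * Y powi (2 * m + \<nu>'))"
  define g' where "g' = (\<lambda>m::int. of_real (p powr ((of_int m + of_int \<nu> / 2)\<^sup>2)) *
        (of_real (p powr (- real_of_int h / 2)) / Y) powi (2 * m + \<nu>))"
  define C where "C = of_real (p powr ((real_of_int h)\<^sup>2 / 4)) * Y powi h"
  have bij: "bij_betw (\<lambda>m. a - m) (UNIV :: int set) UNIV"
    by (rule bij_betwI [where g = "\<lambda>m. a - m"]) auto
  have "of_real (p powr ((of_int (a - m) + of_int \<nu>' / 2)\<^sup>2)) * Y powi (2 * (a - m) + \<nu>') =
      of_real (p powr ((real_of_int h)\<^sup>2 / 4)) * Y powi h *
      (of_real (p powr ((of_int m + of_int \<nu> / 2)\<^sup>2)) *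
        (of_real (p powr (- real_of_int h / 2)) / Y) powi (2 * m + \<nu>))" for m
  proof -
    have e: "2 * (a - m) + \<nu>' = h - (2 * m + \<nu>)" using a by simp
    have ra: "real_of_int a = (real_of_int h - \<nu> - \<nu>') / 2"
      using arg_cong [OF a, of real_of_int] by simp
    have "(p powr (- real_of_int h / 2)) powi (2 * m + \<nu>) = p powr (- real_of_int h / 2 * (2 * m + \<nu>))"
      using assms(1) by (simp add: powr_real_of_int' [symmetric] powr_powr)
    then have "p powr ((real_of_int h)\<^sup>2 / 4) * p powr ((of_int m + of_int \<nu> / 2)\<^sup>2)
        * (p powr (- real_of_int h / 2)) powi (2 * m + \<nu>) =
        p powr ((real_of_int h)\<^sup>2 / 4 + (of_int m + of_int \<nu> / 2)\<^sup>2 + (- real_of_int h / 2 * (2 * m + \<nu>)))"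
      by (simp only: powr_add)
    also have "\<dots> = p powr ((of_int (a - m) + of_int \<nu>' / 2)\<^sup>2)"
      by (rule arg_cong [where f = "\<lambda>y. p powr y"]) (simp add: ra field_simps power2_eq_square)
    finally have "complex_of_real (p powr ((of_int (a - m) + of_int \<nu>' / 2)\<^sup>2)) =
        of_real (p powr ((real_of_int h)\<^sup>2 / 4)) * of_real (p powr ((of_int m + of_int \<nu> / 2)\<^sup>2))
        * of_real (p powr (- real_of_int h / 2)) powi (2 * m + \<nu>)"
      by (metis of_real_mult of_real_power_int)
    then show ?thesis
      unfolding e using assms(2) by (simp add: power_int_diff power_int_divide_distrib)
  qed
  then have summand: "g (a - m) = C * g' m" for m
    by (simp only: g_def g'_def C_def)
  have "vtheta \<nu>' Y p = (\<Sum>\<^sub>\<infinity>m. g (a - m))"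
    unfolding vtheta_def g_def [symmetric] by (rule infsum_reindex_bij_betw [OF bij, symmetric])
  also have "\<dots> = C * (\<Sum>\<^sub>\<infinity>m. g' m)"
    by (simp only: summand infsum_cmult_right')
  finally show ?thesis by (simp only: vtheta_def g'_def C_def)
qed

section \<open>Comparison of the integrands\<close>

lemma funpow_pair_shift:
  "((\<lambda>(a, b). (a, b + 2)) ^^ n) (a, b :: int) = (a, b + 2 * int n)"
  "((\<lambda>(a, b). (a, b - 2)) ^^ n) (a, b :: int) = (a, b - 2 * int n)"
  by (induction n) simp_all

lemma funpow_lattice_shift:
  "(lattice_shift I0 ^^ n) k = k + int n" "(lattice_shift I1 ^^ n) k = k - int n"
  by (induction n) simp_all

context matched_parameters
begin

text \<open>The power \<open>x\<^sup>y\<close> for complex \<open>y\<close>, written as an exponential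
so that products of powers become sums of exponents.\<close>

definition xp :: "complex \<Rightarrow> complex" where
  "xp y = exp (y * of_real (ln x))"

lemma powr_eq_xp: "of_real x powr y = xp y"
  using x by (simp add: xp_def powr_def Ln_of_real)

lemma of_real_powr_eq_xp: "of_real (x powr a) = xp (of_real a)"
  using x by (simp add: xp_def powr_def exp_of_real flip: of_real_mult)

lemma xp_add: "xp (a + b) = xp a * xp b"
  by (simp add: xp_def distrib_right exp_add)

lemma xp_diff: "xp (a - b) = xp a / xp b"
  by (simp add: xp_def left_diff_distrib exp_diff)

lemma xp_nonzero [simp]: "xp a \<noteq> 0"
  by (simp add: xp_def)

lemma xp_sum: "xp (\<Sum>i\<in>A. f i) = (\<Prod>i\<in>A. xp (f i))"
  by (induction A rule: infinite_finite_induct) (simp_all add: xp_add, simp_all add: xp_def)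

lemma xp_powi: "xp y powi n = xp (y * of_int n)"
  by (simp add: xp_def exp_power_int mult.commute mult.left_commute)

lemma xp_power: "xp y ^ n = xp (y * of_nat n)"
  using xp_powi [of y "int n"] by simp

lemma cis_eq_xp: "cis (2 * pi * t) = xp (2 * ucoord x t)"
proof -
  have "ln x \<noteq> 0" using x by simp
  then have "2 * ucoord x t * of_real (ln x) = \<i> * of_real (2 * pi * t)"
    by (simp add: ucoord_def)
  then show ?thesis by (simp only: xp_def cis_conv_exp)
qed

lemma xp_surj: "c \<noteq> 0 \<Longrightarrow> \<exists>y. xp y = c"
proof -
  assume "c \<noteq> 0"
  moreover have "ln x \<noteq> 0" using x by simp
  ultimately have "xp (Ln c / of_real (ln x)) = c" by (simp add: xp_def)
  then show ?thesis ..
qed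

lemma p_less_1: "0 < p" "p < 1"
  using x r by (simp_all add: p powr01_less_one)

text \<open>The brackets are normalised by \<open>(p; p)\<close>; were it 0, they would vanish by the
convention for division.\<close>

lemma qpoch_nonzero: "qpoch p p \<noteq> 0"
proof -
  have pw: "p ^ k * p < 1" for k
    using p_less_1 power_Suc_less_one [of p k] by (simp add: mult.commute)
  have "summable (\<lambda>k. norm (1 - complex_of_real p ^ k * of_real p - 1))"
    using p_less_1 by (simp add: norm_mult norm_power summable_mult2 summable_geometric)
  then have "convergent_prod (\<lambda>k. 1 - complex_of_real p ^ k * of_real p)"
    by (intro abs_convergent_prod_imp_convergent_prod summable_imp_abs_convergent_prod)
  moreover have "1 - complex_of_real p ^ k * of_real p \<noteq> 0" for k
  proof -
    have "of_real (1 - p ^ k * p) \<noteq> (0 :: complex)" using pw [of k] by (simp only: of_real_eq_0_iff)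
    then show ?thesis by simp
  qed
  ultimately show ?thesis
    unfolding qpoch_def by (rule prodinf_nonzero)
qed

text \<open>The theta functions common to both kernels.\<close>

definition theta_ratio :: "nat \<Rightarrow> (nat \<Rightarrow> complex) \<Rightarrow> (nat \<Rightarrow> complex) \<Rightarrow> complex" where
  "theta_ratio N x0 x1 =
     (\<Prod>i\<in>{1..N}. \<Prod>j\<in>{i<..N}.
        Theta p (x0 j / x0 i) * Theta p (of_real (q\<^sup>2) * x0 j / x0 i)
        * Theta p (x1 j / x1 i) * Theta p (of_real (q\<^sup>2) * x1 j / x1 i))
     / (\<Prod>i\<in>{1..N}. \<Prod>j\<in>{1..N}.
        Theta p (of_real (inverse (inverse q * d)) * x1 j / x0 i)
        * Theta p (of_real (inverse (inverse q * inverse d)) * x1 j / x0 i))"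

lemma q2_eq_xp: "complex_of_real (q\<^sup>2) = xp (- 2)"
proof -
  have "q\<^sup>2 = x powr (- 2)"
    using x by (simp add: q powr_minus power_inverse)
  then show ?thesis using of_real_powr_eq_xp [of "- 2"] by simp
qed

lemma q1_inverse_eq_xp: "complex_of_real (inverse (inverse q * d)) = xp (s - 2)"
proof -
  have "x * x powr (1 - s) = x powr (2 - s)"
    using x powr_mult_base [of x "1 - s"] by (simp add: algebra_simps)
  then have "inverse (inverse q * d) = x powr (s - 2)"
    using powr_minus [of x "2 - s"] by (simp add: q d)
  then show ?thesis using of_real_powr_eq_xp [of "s - 2"] by simp
qed

lemma q3_inverse_eq_xp: "complex_of_real (inverse (inverse q * inverse d)) = xp (- s)"
proof -
  have "x * x powr (s - 1) = x powr s"
    using x powr_mult_base [of x "s - 1"] by simp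
  moreover have "inverse d = x powr (s - 1)"
    using powr_minus [of x "1 - s"] by (simp add: d)
  ultimately have "inverse (inverse q * inverse d) = x powr (- s)"
    by (simp add: q powr_minus)
  then show ?thesis using of_real_powr_eq_xp [of "- s"] by simp
qed

text \<open>The constant \<open>(p; p)\<close> in the denominator of a bracket is treated as a power of
\<open>x\<close> as well. It then joins the count of exponents: 4 brackets for each of the \<open>N (N -
1) / 2\<close> pairs in the numerator against 2 for each of the \<open>N\<^sup>2\<close> pairs in the
denominator leave \<open>(p; p)\<^sup>2\<^sup>N\<close>.\<close>

lemma ell_kernel_eq:
  fixes u v :: "nat \<Rightarrow> complex" and N :: nat and \<pi> :: complex
  defines "U \<equiv> (\<Sum>j\<in>{1..N}. u j - v j) :: complex" and "n \<equiv> of_nat N :: complex"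
  shows "ell_kernel x r s \<nu> N u v \<pi> =
    qpoch p p ^ (2 * N)
    * xp (- n * (1 + 1 / of_real r) + n\<^sup>2 * (of_real s * (2 - of_real s)) / (2 * of_real r) - 2 * (1 + 1 / of_real r) * n * U
        + 2 * (1 + 1 / of_real r) * (\<Sum>i\<in>{1..N}. (n - 2 * of_nat i + 1) * (u i + v i)) - 2 * \<pi> * U / of_real r)
    * theta_ratio N (\<lambda>j. xp (2 * u j)) (\<lambda>j. xp (2 * v j)) * vtheta \<nu> (xp (2 * U - \<pi>)) p"
proof -
  \<comment> \<open>\<open>\<kappa>\<close> is the exponent of \<open>(p; p)\<close> as a power of \<open>x\<close>.\<close>
  obtain \<kappa> where \<kappa>: "xp \<kappa> = qpoch p p" using xp_surj [OF qpoch_nonzero] by blast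
  define f where "f = (\<lambda>y :: complex. y\<^sup>2 / of_real r - y)"
  define A where "A = (\<lambda>i j. f (u j - u i) + f (u j - u i - 1) + f (v j - v i) + f (v j - v i - 1))"
  define B where "B = (\<lambda>i j. f (v j - u i - of_real s / 2) + f (v j - u i + of_real s / 2 - 1))"
  let ?z = "\<lambda>j. xp (2 * u j)" and ?w = "\<lambda>j. xp (2 * v j)"
  let ?S = "\<lambda>i j. Theta p (?z j / ?z i) * Theta p (of_real (q\<^sup>2) * ?z j / ?z i)
        * Theta p (?w j / ?w i) * Theta p (of_real (q\<^sup>2) * ?w j / ?w i)"
  let ?T = "\<lambda>i j. Theta p (of_real (inverse (inverse q * d)) * ?w j / ?z i)
        * Theta p (of_real (inverse (inverse q * inverse d)) * ?w j / ?z i)"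
  have bracket: "ell_bracket x r y = xp (f y - \<kappa>) * Theta p (xp (2 * y))" for y
    by (simp add: ell_bracket_def powr_eq_xp xp_diff \<kappa> f_def flip: p)
  have "ell_bracket x r (u j - u i) * ell_bracket x r (u j - u i - 1)
        * ell_bracket x r (v j - v i) * ell_bracket x r (v j - v i - 1) =
      xp (A i j - 4 * \<kappa>) * ?S i j" for i j
  proof -
    have e: "xp (2 * (u j - u i)) = ?z j / ?z i" "xp (2 * (v j - v i)) = ?w j / ?w i"
        "xp (2 * (u j - u i - 1)) = of_real (q\<^sup>2) * ?z j / ?z i"
        "xp (2 * (v j - v i - 1)) = of_real (q\<^sup>2) * ?w j / ?w i"
      unfolding q2_eq_xp xp_add [symmetric] xp_diff [symmetric] by (simp_all add: algebra_simps)
    have a: "A i j - 4 * \<kappa> = (f (u j - u i) - \<kappa>) + (f (u j - u i - 1) - \<kappa>)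
        + (f (v j - v i) - \<kappa>) + (f (v j - v i - 1) - \<kappa>)"
      by (simp add: A_def)
    show ?thesis unfolding bracket e a xp_add by (simp only: ac_simps)
  qed
  then have num: "(\<Prod>i\<in>{1..N}. \<Prod>j\<in>{i<..N}. ell_bracket x r (u j - u i) * ell_bracket x r (u j - u i - 1)
        * ell_bracket x r (v j - v i) * ell_bracket x r (v j - v i - 1)) =
      xp ((\<Sum>i\<in>{1..N}. \<Sum>j\<in>{i<..N}. A i j) - n * (n - 1) / 2 * (4 * \<kappa>)) * (\<Prod>i\<in>{1..N}. \<Prod>j\<in>{i<..N}. ?S i j)"
    unfolding n_def sum_pairs_const [symmetric] sum_subtractf [symmetric]
    by (simp only: xp_sum prod.distrib)
  have "ell_bracket x r (v j - u i - of_real s / 2) * ell_bracket x r (v j - u i + of_real s / 2 - 1) =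
      xp (B i j - 2 * \<kappa>) * ?T i j" for i j
  proof -
    have e: "xp (2 * (v j - u i - of_real s / 2)) = of_real (inverse (inverse q * inverse d)) * ?w j / ?z i"
        "xp (2 * (v j - u i + of_real s / 2 - 1)) = of_real (inverse (inverse q * d)) * ?w j / ?z i"
      unfolding q1_inverse_eq_xp q3_inverse_eq_xp xp_add [symmetric] xp_diff [symmetric]
      by (simp_all add: algebra_simps)
    have b: "B i j - 2 * \<kappa> = (f (v j - u i - of_real s / 2) - \<kappa>) + (f (v j - u i + of_real s / 2 - 1) - \<kappa>)"
      by (simp add: B_def)
    show ?thesis unfolding bracket e b xp_add by (simp only: ac_simps)
  qed
  then have den: "(\<Prod>i\<in>{1..N}. \<Prod>j\<in>{1..N}. ell_bracket x r (v j - u i - of_real s / 2) * ell_bracket x r (v j - u i + of_real s / 2 - 1)) =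
      xp ((\<Sum>i\<in>{1..N}. \<Sum>j\<in>{1..N}. B i j) - n\<^sup>2 * (2 * \<kappa>)) * (\<Prod>i\<in>{1..N}. \<Prod>j\<in>{1..N}. ?T i j)"
  proof -
    have "n\<^sup>2 * (2 * \<kappa>) = (\<Sum>i\<in>{1..N}. \<Sum>j\<in>{1..N}. 2 * \<kappa>)"
      by (simp add: n_def power2_eq_square)
    then show ?thesis
      by (simp only: \<open>\<And>i j. ell_bracket x r (v j - u i - of_real s / 2) * ell_bracket x r (v j - u i + of_real s / 2 - 1) =
        xp (B i j - 2 * \<kappa>) * ?T i j\<close> xp_sum prod.distrib flip: sum_subtractf)
  qed
  have exponent: "(\<Sum>i\<in>{1..N}. \<Sum>j\<in>{i<..N}. A i j) - (\<Sum>i\<in>{1..N}. \<Sum>j\<in>{1..N}. B i j) =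
    - 2 * U\<^sup>2 / of_real r - n * (1 + 1 / of_real r) + n\<^sup>2 * (of_real s * (2 - of_real s)) / (2 * of_real r)
      - 2 * (1 + 1 / of_real r) * n * U
      + 2 * (1 + 1 / of_real r) * (\<Sum>i\<in>{1..N}. (n - 2 * of_nat i + 1) * (u i + v i))"
    unfolding A_def B_def f_def U_def n_def using r by (intro kernel_exponent) simp
  have "ell_kernel x r s \<nu> N u v \<pi> =
      xp ((\<Sum>i\<in>{1..N}. \<Sum>j\<in>{i<..N}. A i j) - n * (n - 1) / 2 * (4 * \<kappa>)) * (\<Prod>i\<in>{1..N}. \<Prod>j\<in>{i<..N}. ?S i j)
      / (xp ((\<Sum>i\<in>{1..N}. \<Sum>j\<in>{1..N}. B i j) - n\<^sup>2 * (2 * \<kappa>)) * (\<Prod>i\<in>{1..N}. \<Prod>j\<in>{1..N}. ?T i j))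
      * (xp (2 * U\<^sup>2 / of_real r - 2 * \<pi> * U / of_real r) * vtheta \<nu> (xp (2 * U - \<pi>)) p)"
    unfolding ell_kernel_def of_real_divide of_real_numeral num den ell_vtheta_def powr_eq_xp U_def [symmetric] p [symmetric] by (rule refl)
  also have "\<dots> = xp ((\<Sum>i\<in>{1..N}. \<Sum>j\<in>{i<..N}. A i j) - n * (n - 1) / 2 * (4 * \<kappa>)
        - ((\<Sum>i\<in>{1..N}. \<Sum>j\<in>{1..N}. B i j) - n\<^sup>2 * (2 * \<kappa>)) + (2 * U\<^sup>2 / of_real r - 2 * \<pi> * U / of_real r))
      * theta_ratio N ?z ?w * vtheta \<nu> (xp (2 * U - \<pi>)) p"
    unfolding theta_ratio_def xp_diff [of _ "(\<Sum>i\<in>{1..N}. \<Sum>j\<in>{1..N}. B i j) - _"] xp_add by simp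
  also have "(\<Sum>i\<in>{1..N}. \<Sum>j\<in>{i<..N}. A i j) - n * (n - 1) / 2 * (4 * \<kappa>)
        - ((\<Sum>i\<in>{1..N}. \<Sum>j\<in>{1..N}. B i j) - n\<^sup>2 * (2 * \<kappa>)) + (2 * U\<^sup>2 / of_real r - 2 * \<pi> * U / of_real r) =
      \<kappa> * of_nat (2 * N) + ((\<Sum>i\<in>{1..N}. \<Sum>j\<in>{i<..N}. A i j) - (\<Sum>i\<in>{1..N}. \<Sum>j\<in>{1..N}. B i j)
        + (2 * U\<^sup>2 / of_real r - 2 * \<pi> * U / of_real r))"
    by (simp add: n_def field_simps power2_eq_square)
  also have "(\<Sum>i\<in>{1..N}. \<Sum>j\<in>{i<..N}. A i j) - (\<Sum>i\<in>{1..N}. \<Sum>j\<in>{1..N}. B i j)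
        + (2 * U\<^sup>2 / of_real r - 2 * \<pi> * U / of_real r) =
      - n * (1 + 1 / of_real r) + n\<^sup>2 * (of_real s * (2 - of_real s)) / (2 * of_real r) - 2 * (1 + 1 / of_real r) * n * U
        + 2 * (1 + 1 / of_real r) * (\<Sum>i\<in>{1..N}. (n - 2 * of_nat i + 1) * (u i + v i)) - 2 * \<pi> * U / of_real r"
    unfolding exponent by simp
  finally show ?thesis
    by (simp only: xp_add [of "\<kappa> * _"] xp_power [symmetric] \<kappa>)
qed

definition ell_vertices ::
    "nat \<Rightarrow> (nat \<Rightarrow> complex) \<Rightarrow> (nat \<Rightarrow> complex) \<Rightarrow> (int \<times> int, beta_index) vertex list" where
  "ell_vertices N u v =
     map (\<lambda>j. (of_real x powr (2 * u j), \<lambda>L. of_real x powr (2 * u j * (pihat r L / r + (r - 1) / r)),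
         \<lambda>(a, b). (a, b - 2), F1_exponent x r s)) [1..<Suc N]
     @ map (\<lambda>j. (of_real x powr (2 * v j), \<lambda>L. of_real x powr (2 * v j * (- pihat r L / r + (r - 1) / r)),
         \<lambda>(a, b). (a, b + 2), F0_exponent x r s)) [1..<Suc N]"

definition tor_vertices ::
    "complex \<Rightarrow> complex \<Rightarrow> int \<Rightarrow> nat \<Rightarrow> (nat \<Rightarrow> complex) \<Rightarrow> (nat \<Rightarrow> complex)
      \<Rightarrow> (int, tor_index) vertex list" where
  "tor_vertices c0 c1 \<mu> N z w =
     map (\<lambda>j. (z j, \<lambda>k. c0 * z j powi (- Hzero \<mu> I0 k + 1), lattice_shift I0,
         Fhat_exponent q d p I0)) [1..<Suc N]
     @ map (\<lambda>j. (w j, \<lambda>k. c1 * w j powi (- Hzero \<mu> I1 k + 1), lattice_shift I1,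
         Fhat_exponent q d p I1)) [1..<Suc N]"

lemma map_vertex_op_ell_vertices:
  "map vertex_op (ell_vertices N u v) =
     map (\<lambda>j. F1 x r s (u j)) [1..<Suc N] @ map (\<lambda>j. F0 x r s (v j)) [1..<Suc N]"
  by (simp add: ell_vertices_def F1_def F0_def del: upt_Suc)

lemma map_vertex_op_tor_vertices:
  "map vertex_op (tor_vertices c0 c1 \<mu> N z w) =
     map (\<lambda>j. Fhat q d p \<mu> I0 c0 (z j)) [1..<Suc N] @ map (\<lambda>j. Fhat q d p \<mu> I1 c1 (w j)) [1..<Suc N]"
  by (simp add: tor_vertices_def Fhat_def del: upt_Suc)

lemma total_shift_ell_vertices: "total_shift (ell_vertices N u v) (k, l) = (k, l)"
  unfolding ell_vertices_def total_shift_append total_shift_map_upt funpow_pair_shift by simp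

lemma total_shift_tor_vertices: "total_shift (tor_vertices c0 c1 \<mu> N z w) k = k"
  unfolding tor_vertices_def total_shift_append total_shift_map_upt funpow_lattice_shift by simp

text \<open>The current number \<open>i\<close> of a group meets a momentum shifted by the \<open>N -
i\<close> currents of its group to the right of it, those in the first group in addition by all
\<open>N\<close> currents of the second.\<close>

lemma zero_mode_factor_ell_vertices:
  assumes "r \<noteq> 1"
  shows "zero_mode_factor (ell_vertices N u v) (k, l) = xp (\<Sum>i\<in>{1..N}.
      2 * u i * (pihat r (k, l) / of_real r + (1 - 2 * of_nat i) * (1 - 1 / of_real r))
    + 2 * v i * (- pihat r (k, l) / of_real r + (2 * of_nat N - 2 * of_nat i + 1) * (1 - 1 / of_real r)))"
proof -
  have r0: "r \<noteq> 0" using r by simp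
  have pi_shift: "pihat r (k, l + m) = pihat r (k, l) - of_int m * (of_real r - 1)" for l m
    using r0 assms by (simp add: pihat_eq algebra_simps)
  have pi_shift': "pihat r (k, l - m) = pihat r (k, l) + of_int m * (of_real r - 1)" for l m
    using r0 assms by (simp add: pihat_eq algebra_simps)
  have "(\<Prod>i\<in>{1..N}. xp (2 * u i * (pihat r (k, l + 2 * int N - 2 * int (N - i)) / r + complex_of_real ((r - 1) / r)))) =
      (\<Prod>i\<in>{1..N}. xp (2 * u i * (pihat r (k, l) / of_real r + (1 - 2 * of_nat i) * (1 - 1 / of_real r))))"
    unfolding pi_shift pi_shift'
    using r0 by (intro prod.cong arg_cong [of _ _ xp]) (simp_all add: field_simps of_nat_diff)
  moreover have "(\<Prod>i\<in>{1..N}. xp (2 * v i * (- pihat r (k, l + 2 * int (N - i)) / r + complex_of_real ((r - 1) / r)))) =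
      (\<Prod>i\<in>{1..N}. xp (2 * v i * (- pihat r (k, l) / of_real r + (2 * of_nat N - 2 * of_nat i + 1) * (1 - 1 / of_real r))))"
    unfolding pi_shift
    using r0 by (intro prod.cong arg_cong [of _ _ xp]) (simp_all add: field_simps of_nat_diff)
  ultimately show ?thesis
    unfolding ell_vertices_def zero_mode_factor_append total_shift_map_upt zero_mode_factor_map_upt
      funpow_pair_shift powr_eq_xp xp_sum xp_add prod.distrib
    by (simp only:)
qed

lemma zero_mode_factor_tor_vertices:
  "zero_mode_factor (tor_vertices c0 c1 \<mu> N (\<lambda>j. xp (2 * u j)) (\<lambda>j. xp (2 * v j))) k =
    (c0 * c1) ^ N * xp (\<Sum>i\<in>{1..N}. 2 * u i * (of_int (Hzero \<mu> I1 k) - 2 * of_nat i + 1)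
      + 2 * v i * (- of_int (Hzero \<mu> I1 k) + 2 * (of_nat N - of_nat i) + 1))"
proof -
  have "(\<Prod>i\<in>{1..N}. c0 * xp (2 * u i) powi (- Hzero \<mu> I0 (k - int N + int (N - i)) + 1)) =
      (\<Prod>i\<in>{1..N}. c0 * xp (2 * u i * (of_int (Hzero \<mu> I1 k) - 2 * of_nat i + 1)))"
    by (intro prod.cong refl arg_cong2 [of _ _ _ _ "(*)"])
      (simp_all add: xp_powi of_nat_diff algebra_simps)
  moreover have "(\<Prod>i\<in>{1..N}. c1 * xp (2 * v i) powi (- Hzero \<mu> I1 (k - int (N - i)) + 1)) =
      (\<Prod>i\<in>{1..N}. c1 * xp (2 * v i * (- of_int (Hzero \<mu> I1 k) + 2 * (of_nat N - of_nat i) + 1)))"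
    by (intro prod.cong refl arg_cong2 [of _ _ _ _ "(*)"])
      (simp_all add: xp_powi of_nat_diff algebra_simps)
  ultimately show ?thesis
    unfolding tor_vertices_def zero_mode_factor_append total_shift_map_upt zero_mode_factor_map_upt
      funpow_lattice_shift xp_sum xp_add
    by (simp only: prod.distrib prod_constant card_atLeastAtMost diff_Suc_1 power_mult_distrib ac_simps)
qed

text \<open>The condition on \<open>pbar1\<close> fixes the twisting parameter through its square root:
the parameter of the theta function becomes \<open>p\<^sup>-\<^sup>h\<^sup>/\<^sup>2
x\<^sup>\<pi>\<close>, which is the form produced by \<open>vtheta_reflect\<close>.\<close>

lemma tor_kernel_eq:
  fixes u v :: "nat \<Rightarrow> complex" and N :: nat and pbar1 :: real and h :: int
  assumes pbar1: "pbar1 * (p * inverse q) powr h = x powr (2 * \<pi>)"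
  defines "U \<equiv> (\<Sum>j\<in>{1..N}. u j - v j) :: complex"
  shows "tor_kernel q d p pbar1 \<nu> N (\<lambda>j. xp (2 * u j)) (\<lambda>j. xp (2 * v j)) h =
    theta_ratio N (\<lambda>j. xp (2 * u j)) (\<lambda>j. xp (2 * v j))
    * xp (\<Sum>i\<in>{1..N}. 2 * (of_nat N - 2 * of_nat i + 1) * (u i + v i)) * xp (- 2 * of_nat N * U)
    * p powr (- real_of_int \<nu> / 4)
    * vtheta \<nu> (of_real (p powr (- real_of_int h / 2)) / xp (2 * U - of_real \<pi>)) p"
proof -
  have pq: "p * inverse q = x powr (2 * r + 1)"
    using x by (simp add: p q powr_add)
  have "pbar1 = x powr (2 * \<pi>) / x powr ((2 * r + 1) * h)"
    using pbar1 x unfolding pq by (simp add: powr_powr field_simps)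
  then have pbar: "pbar1 = x powr (2 * \<pi> - (2 * r + 1) * h)"
    by (simp add: powr_diff)
  have qx: "q = x powr (- 1)" using x by (simp add: q powr_minus)
  have "pbar1 powr (1 / 2) * q powr (- real_of_int h / 2) = x powr ((2 * \<pi> - (2 * r + 1) * h) * (1 / 2) + - 1 * (- real_of_int h / 2))"
    unfolding pbar qx by (simp only: powr_powr powr_add)
  also have "\<dots> = x powr (2 * r * (- real_of_int h / 2) + \<pi>)"
    by (rule arg_cong [of _ _ "\<lambda>y. x powr y"]) (simp add: field_simps)
  also have "\<dots> = p powr (- real_of_int h / 2) * x powr \<pi>"
    by (simp only: p powr_powr powr_add)
  finally have param: "complex_of_real (pbar1 powr (1 / 2) * q powr (- real_of_int h / 2)) =
      of_real (p powr (- real_of_int h / 2)) * xp \<pi>"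
    by (simp only: of_real_mult of_real_powr_eq_xp)
  have ratio: "(\<Prod>i\<in>{1..N}. xp (2 * v i) / xp (2 * u i)) = xp (- (2 * U))"
    unfolding U_def sum_distrib_left sum_negf [symmetric] xp_sum xp_diff [symmetric]
    by (intro prod.cong) (simp_all add: algebra_simps)
  have powers: "(\<Prod>i\<in>{1..N}. (xp (2 * u i) * xp (2 * v i)) powi (int N - 2 * int i + 1)) =
      xp (\<Sum>i\<in>{1..N}. 2 * (of_nat N - 2 * of_nat i + 1) * (u i + v i))"
    unfolding xp_sum xp_add [symmetric] xp_powi
    by (intro prod.cong refl arg_cong [of _ _ xp]) (simp add: algebra_simps)
  have arg: "of_real (p powr (- real_of_int h / 2)) * xp \<pi> * xp (- (2 * U)) =
      of_real (p powr (- real_of_int h / 2)) / xp (2 * U - of_real \<pi>)"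
    using xp_diff [of 0 "2 * U"] by (simp add: xp_diff) (simp add: xp_def)
  have neg: "- (2 * U) * of_nat N = - 2 * of_nat N * U" by simp
  show ?thesis
    unfolding tor_kernel_def ratio powers param arg xp_power neg theta_ratio_def by (rule refl)
qed

text \<open>All factors other than theta functions are powers of \<open>x\<close> or constants, so the
identity reduces to one between exponents, \<open>zero_modes\<close> in the proof. That identity holds
for each index \<open>i\<close> separately: the coefficients of \<open>u i\<close> and of \<open>v
i\<close> both vanish. The terms with \<open>1 / r\<close> in the kernel exponent cancel against those
in the zero modes of the screening currents. Of the other terms, those of the kernel exponent are the
powers in \<open>tor_kernel\<close>; the zero modes, together with \<open>2 U h\<close> from the
reflected theta function, are the zero modes of the dressed currents.\<close>

lemma integrand_identity:
  fixes u v :: "nat \<Rightarrow> complex" and N :: nat and pbar1 :: real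
  assumes "r \<noteq> 1" "c0 * c1 \<noteq> 0"
    and pbar1: "of_real pbar1 * of_real (p * inverse q) powr of_int (Hzero \<mu> I1 k)
           = of_real x powr (2 * pihat r (k, l))"
  defines "z \<equiv> \<lambda>j. xp (2 * u j)" and "w \<equiv> \<lambda>j. xp (2 * v j)"
  shows "ell_kernel x r s ((\<nu> + \<mu>) mod 2) N u v (pihat r (k, l)) * zero_mode_factor (ell_vertices N u v) (k, l) =
    im_ratio x r s (c0 * c1) \<mu> k l \<nu> N *
      (tor_kernel q d p pbar1 \<nu> N z w (Hzero \<mu> I1 k) * zero_mode_factor (tor_vertices c0 c1 \<mu> N z w) k)"
proof -
  define h where "h = Hzero \<mu> I1 k"
  define \<pi>' where "\<pi>' = real_of_int k * r - real_of_int l * (r - 1)"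
  define \<pi> where "\<pi> = complex_of_real \<pi>'"
  define R :: complex where "R = of_real r"
  define n :: complex where "n = of_nat N"
  define U where "U = (\<Sum>j\<in>{1..N}. u j - v j)"
  define V where "V = (\<Sum>i\<in>{1..N}. (n - 2 * of_nat i + 1) * (u i + v i))"
  define Ze where "Ze = (\<Sum>i\<in>{1..N}. 2 * u i * (\<pi> / R + (1 - 2 * of_nat i) * (1 - 1 / R))
    + 2 * v i * (- \<pi> / R + (2 * n - 2 * of_nat i + 1) * (1 - 1 / R)))"
  define Zt where "Zt = (\<Sum>i\<in>{1..N}. 2 * u i * (of_int h - 2 * of_nat i + 1)
      + 2 * v i * (- of_int h + 2 * (n - of_nat i) + 1))"
  define S :: complex where "S = of_real s"
  define T where "T = theta_ratio N z w"
  define Y where "Y = vtheta \<nu> (of_real (p powr (- real_of_int h / 2)) / xp (2 * U - \<pi>)) p"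
  define P where "P = qpoch p p ^ (2 * N)"
  have R: "R \<noteq> 0" using r by (simp add: R_def)
  have pihat: "pihat r (k, l) = \<pi>"
    using r assms(1) by (simp add: pihat_eq \<pi>_def \<pi>'_def)
  have "complex_of_real (pbar1 * (p * inverse q) powr h) = of_real (x powr (2 * \<pi>'))"
  proof -
    have "0 \<le> p * inverse q" using p_less_1 x by (simp add: q)
    then have "of_real (p * inverse q) powr of_int h = complex_of_real ((p * inverse q) powr h)"
      using powr_of_real [of "p * inverse q" "real_of_int h"] by (simp only: of_real_of_int_eq)
    moreover have "of_real x powr (2 * \<pi>) = complex_of_real (x powr (2 * \<pi>'))"
      using powr_of_real [of x "2 * \<pi>'"] x by (simp add: \<pi>_def)
    ultimately show ?thesis using pbar1 unfolding pihat h_def [symmetric] by (simp only: of_real_mult)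
  qed
  then have pbar: "pbar1 * (p * inverse q) powr h = x powr (2 * \<pi>')"
    by (simp only: of_real_eq_iff)
  have "even (h - \<nu> - (\<nu> + \<mu>) mod 2)"
    by (simp add: h_def) presburger
  then have reflect: "vtheta ((\<nu> + \<mu>) mod 2) (xp (2 * U - \<pi>)) p =
      of_real (p powr ((real_of_int h)\<^sup>2 / 4)) * xp ((2 * U - \<pi>) * of_int h) * Y"
    using vtheta_reflect [of p "xp (2 * U - \<pi>)" h \<nu> "(\<nu> + \<mu>) mod 2"] p_less_1
    by (simp add: Y_def xp_powi)
  have zero_modes: "- 2 * (1 + 1 / R) * n * U + 2 * (1 + 1 / R) * V - 2 * \<pi> * U / R + 2 * U * of_int h + Ze =
      2 * V - 2 * n * U + Zt"
  proof -
    have "0 = (\<Sum>i\<in>{1..N}. - 2 / R * n * (u i - v i) + 2 / R * ((n - 2 * of_nat i + 1) * (u i + v i))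
        - 2 * \<pi> / R * (u i - v i) + 2 * of_int h * (u i - v i)
        + (2 * u i * (\<pi> / R + (1 - 2 * of_nat i) * (1 - 1 / R))
          + 2 * v i * (- \<pi> / R + (2 * n - 2 * of_nat i + 1) * (1 - 1 / R)))
        - (2 * u i * (of_int h - 2 * of_nat i + 1) + 2 * v i * (- of_int h + 2 * (n - of_nat i) + 1)))"
      by (rule sum.neutral [symmetric]) (simp add: R divide_inverse algebra_simps)
    also have "\<dots> = - 2 / R * n * U + 2 / R * V - 2 * \<pi> / R * U + 2 * of_int h * U + Ze - Zt"
      by (simp only: U_def V_def Ze_def Zt_def sum_distrib_left flip: sum.distrib sum_subtractf)
    finally show ?thesis by (simp add: algebra_simps)
  qed
  have regroup: "P * xp a * T * (g * xp b * Y) * xp c = P * xp a' * T * g * xp b' * Y * xp c'"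
    if "a + b + c = a' + b' + c'" for P a T g b Y c a' b' c'
  proof -
    have "P * xp a * T * (g * xp b * Y) * xp c = P * T * g * Y * xp (a + b + c)"
      by (simp only: xp_add ac_simps)
    also have "\<dots> = P * xp a' * T * g * xp b' * Y * xp c'"
      unfolding that xp_add by (simp only: ac_simps)
    finally show ?thesis .
  qed
  have "ell_kernel x r s ((\<nu> + \<mu>) mod 2) N u v (pihat r (k, l)) * zero_mode_factor (ell_vertices N u v) (k, l) =
      P * xp (- n * (1 + 1 / R) + n\<^sup>2 * (S * (2 - S)) / (2 * R) - 2 * (1 + 1 / R) * n * U
        + 2 * (1 + 1 / R) * V - 2 * \<pi> * U / R) * T
      * (of_real (p powr ((real_of_int h)\<^sup>2 / 4)) * xp ((2 * U - \<pi>) * of_int h) * Y) * xp Ze"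
    unfolding ell_kernel_eq zero_mode_factor_ell_vertices [OF assms(1)] pihat
      U_def [symmetric] n_def [symmetric] R_def [symmetric] V_def [symmetric] Ze_def [symmetric]
      S_def [symmetric] P_def [symmetric] reflect
    unfolding T_def z_def w_def by (rule refl)
  also have "\<dots> = P * xp (- n * (1 + 1 / R) + n\<^sup>2 * (S * (2 - S)) / (2 * R)) * T
      * of_real (p powr ((real_of_int h)\<^sup>2 / 4)) * xp (- \<pi> * of_int h) * Y
      * xp (- 2 * (1 + 1 / R) * n * U + 2 * (1 + 1 / R) * V - 2 * \<pi> * U / R + 2 * U * of_int h + Ze)"
    by (rule regroup) (simp add: algebra_simps)
  also have "xp (- 2 * (1 + 1 / R) * n * U + 2 * (1 + 1 / R) * V - 2 * \<pi> * U / R + 2 * U * of_int h + Ze) =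
      xp (2 * V) * xp (- 2 * n * U) * xp Zt"
    unfolding zero_modes xp_add [symmetric] by simp
  finally have lhs: "ell_kernel x r s ((\<nu> + \<mu>) mod 2) N u v (pihat r (k, l)) * zero_mode_factor (ell_vertices N u v) (k, l) =
      P * xp (- n * (1 + 1 / R) + n\<^sup>2 * (S * (2 - S)) / (2 * R)) * T
      * of_real (p powr ((real_of_int h)\<^sup>2 / 4)) * xp (- \<pi> * of_int h) * Y
      * (xp (2 * V) * xp (- 2 * n * U) * xp Zt)" .
  have "complex_of_real (x powr (- real N * (1 + 1 / r) + (real N)\<^sup>2 * s * (2 - s) / (2 * r))) =
      xp (- n * (1 + 1 / R) + n\<^sup>2 * (S * (2 - S)) / (2 * R))"
    unfolding of_real_powr_eq_xp by (simp add: n_def R_def S_def mult.assoc)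
  moreover have p_powr: "complex_of_real p powr of_real y = of_real (p powr y)" for y
    using powr_of_real [of p y] p_less_1 by simp
  ultimately have ratio: "im_ratio x r s (c0 * c1) \<mu> k l \<nu> N = P * xp (- n * (1 + 1 / R) + n\<^sup>2 * (S * (2 - S)) / (2 * R))
      * inverse (c0 * c1) ^ N * of_real (p powr (real_of_int \<nu> / 4)) * of_real (p powr ((real_of_int h)\<^sup>2 / 4))
      * xp (- \<pi> * of_int h)"
    unfolding im_ratio_def Let_def p [symmetric] h_def [symmetric] pihat powr_eq_xp P_def p_powr
    by (simp only: mult_minus_left)
  have V2: "(\<Sum>i\<in>{1..N}. 2 * (n - 2 * of_nat i + 1) * (u i + v i)) = 2 * V"
    unfolding V_def sum_distrib_left by (simp only: mult.assoc)
  have rhs: "tor_kernel q d p pbar1 \<nu> N z w h * zero_mode_factor (tor_vertices c0 c1 \<mu> N z w) k =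
      T * xp (2 * V) * xp (- 2 * n * U) * of_real (p powr (- real_of_int \<nu> / 4)) * Y * ((c0 * c1) ^ N * xp Zt)"
    unfolding z_def w_def tor_kernel_eq [OF pbar] zero_mode_factor_tor_vertices
      U_def [symmetric] n_def [symmetric] V2 h_def [symmetric] Zt_def [symmetric] \<pi>_def [symmetric] Y_def [symmetric]
    unfolding T_def z_def w_def by (rule refl)
  have cancel: "p powr (real_of_int \<nu> / 4) * p powr (- real_of_int \<nu> / 4) = 1"
    using p_less_1 by (simp flip: powr_add)
  then have cancel: "complex_of_real (p powr (real_of_int \<nu> / 4)) * of_real (p powr (- real_of_int \<nu> / 4)) = 1"
    by (metis of_real_1 of_real_mult)
  have cancel': "inverse (c0 * c1) ^ N * (c0 * c1) ^ N = 1"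
    using left_inverse [OF assms(2)] by (simp only: power_one flip: power_mult_distrib)
  have reorder: "A * B * i * a * D * E * (T * F * G * a' * Y * (i' * H)) = A * B * T * D * E * Y * (F * G * H)"
    if "i * i' = 1" "a * a' = 1" for A B i a D E T F G a' Y i' H :: complex
  proof -
    have "A * B * i * a * D * E * (T * F * G * a' * Y * (i' * H)) =
        (i * i') * (a * a') * (A * B * T * D * E * Y * (F * G * H))" by (simp only: ac_simps)
    then show ?thesis using that by simp
  qed
  show ?thesis
    unfolding lhs h_def [symmetric] rhs ratio by (rule reorder [OF cancel' cancel, symmetric])
qed

section \<open>Comparison of the integrals of motion\<close>

lemma fock_linear_ell_vertices:
  "V \<in> set (ell_vertices N u v) \<Longrightarrow> fock_linear (oscillator_part V m)"
  by (auto simp: ell_vertices_def F0_exponent_eq F1_exponent_eq fock_linear_screening_exponent)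

lemma fock_linear_tor_vertices:
  "V \<in> set (tor_vertices c0 c1 \<mu> N z w) \<Longrightarrow> fock_linear (oscillator_part V m)"
  by (auto simp: tor_vertices_def fock_linear_Fhat_exponent)

text \<open>The order of the factors on the two sides is the same: \<open>F\<^sub>1\<close> corresponds
to the dressed current with label \<open>I0\<close>, \<open>F\<^sub>0\<close> to that with label
\<open>I1\<close>.\<close>

lemma oscillator_product_matching:
  "matching_map (oscillator_product (tor_vertices c0 c1 \<mu> N z w) ns f) =
     oscillator_product (ell_vertices N u v) ns (matching_map f)"
proof (rule oscillator_product_intertwine)
  show "list_all2 (\<lambda>V V'. \<forall>m f. m \<noteq> 0 \<longrightarrow>
      matching_map (oscillator_part V m f) = oscillator_part V' m (matching_map f))
     (tor_vertices c0 c1 \<mu> N z w) (ell_vertices N u v)"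
    unfolding tor_vertices_def ell_vertices_def F0_exponent_eq F1_exponent_eq
    by (intro list_all2_appendI)
      (simp_all add: list_all2_conv_all_nth matching_map_intertwines del: upt_Suc)
qed (simp_all add: fock_linear_matching_map bij_is_inj bij_matching_map)

lemma im_ratio_nonzero: "c \<noteq> 0 \<Longrightarrow> im_ratio x r s c \<mu> k l \<nu> N \<noteq> 0"
  using x p_less_1 qpoch_nonzero
  by (simp add: im_ratio_def Let_def powr_eq_xp flip: p)

abbreviation ell_currents :: "nat \<Rightarrow> (nat \<Rightarrow> real) \<times> (nat \<Rightarrow> real) \<Rightarrow> (int \<times> int, beta_index) current list" where
  "ell_currents N \<equiv> \<lambda>(a, b). map vertex_op (ell_vertices N (\<lambda>j. ucoord x (a j)) (\<lambda>j. ucoord x (b j)))"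

abbreviation tor_currents ::
    "complex \<Rightarrow> complex \<Rightarrow> int \<Rightarrow> nat \<Rightarrow> (nat \<Rightarrow> real) \<times> (nat \<Rightarrow> real) \<Rightarrow> (int, tor_index) current list" where
  "tor_currents c0 c1 \<mu> N \<equiv>
     \<lambda>(a, b). map vertex_op (tor_vertices c0 c1 \<mu> N (\<lambda>j. cis (2 * pi * a j)) (\<lambda>j. cis (2 * pi * b j)))"

lemma elliptic_IM_eq:
  "elliptic_IM x r s \<nu> N = current_integral N (ell_currents N)
     (\<lambda>(a, b) L. ell_kernel x r s \<nu> N (\<lambda>j. ucoord x (a j)) (\<lambda>j. ucoord x (b j)) (pihat r L))"
  by (simp only: elliptic_IM_def map_vertex_op_ell_vertices)

lemma toroidal_IM_eq:
  assumes "pbar * inverse q = p"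
  shows "toroidal_IM q d pbar pbar1 c0 c1 \<mu> \<nu> N = current_integral N (tor_currents c0 c1 \<mu> N)
     (\<lambda>(a, b) k. tor_kernel q d p pbar1 \<nu> N (\<lambda>j. cis (2 * pi * a j)) (\<lambda>j. cis (2 * pi * b j))
                   (Hzero \<mu> I1 k))"
  by (simp only: toroidal_IM_def assms Let_def map_vertex_op_tor_vertices)

lemma mode_product_ell_currents:
  assumes "length ns = length (ell_currents N \<theta>)"
  shows "mode_product (ell_currents N \<theta>) ns (zero_mode K (\<lambda>L. L) (Poly_Mapping.single (k, l) f)) =
    (case \<theta> of (a, b) \<Rightarrow> Poly_Mapping.single (k, l)
       (scal (K (k, l) * zero_mode_factor (ell_vertices N (\<lambda>j. ucoord x (a j)) (\<lambda>j. ucoord x (b j))) (k, l))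
         (oscillator_product (ell_vertices N (\<lambda>j. ucoord x (a j)) (\<lambda>j. ucoord x (b j))) ns f)))"
  using assms
  by (cases \<theta>) (simp add: mode_product_zero_mode_single fock_linear_ell_vertices total_shift_ell_vertices)

lemma mode_product_tor_currents:
  assumes "length ns = length (tor_currents c0 c1 \<mu> N \<theta>)"
  shows "mode_product (tor_currents c0 c1 \<mu> N \<theta>) ns (zero_mode K (\<lambda>L. L) (Poly_Mapping.single k f)) =
    (case \<theta> of (a, b) \<Rightarrow> Poly_Mapping.single k
       (scal (K k * zero_mode_factor (tor_vertices c0 c1 \<mu> N (\<lambda>j. cis (2 * pi * a j)) (\<lambda>j. cis (2 * pi * b j))) k)
         (oscillator_product (tor_vertices c0 c1 \<mu> N (\<lambda>j. cis (2 * pi * a j)) (\<lambda>j. cis (2 * pi * b j))) ns f)))"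
  using assms
  by (cases \<theta>) (simp add: mode_product_zero_mode_single fock_linear_tor_vertices total_shift_tor_vertices)

lemma elliptic_IM_in_sector:
  assumes "\<psi> \<in> sector (k, l)"
  shows "elliptic_IM x r s \<nu> N \<psi> \<in> sector (k, l)"
proof -
  obtain f where \<psi>: "\<psi> = Poly_Mapping.single (k, l) f" using assms by (auto simp: sector_def)
  show ?thesis
    unfolding elliptic_IM_eq \<psi>
    by (rule current_integral_in_sector)
      (simp only: mode_product_ell_currents single_in_sector split: prod.split, simp add: single_in_sector)
qed

lemma toroidal_IM_in_sector:
  assumes "pbar * inverse q = p" "\<psi> \<in> sector k"
  shows "toroidal_IM q d pbar pbar1 c0 c1 \<mu> \<nu> N \<psi> \<in> sector k"
proof -
  obtain f where \<psi>: "\<psi> = Poly_Mapping.single k f" using assms by (auto simp: sector_def)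
  show ?thesis
    unfolding toroidal_IM_eq [OF assms(1)] \<psi>
    by (rule current_integral_in_sector)
      (simp only: mode_product_tor_currents single_in_sector split: prod.split, simp add: single_in_sector)
qed

text \<open>The scalar ratio of the integrands does not depend on the point of the torus, so it can be
absorbed into the linear map along which the integral is transported.\<close>

lemma elliptic_IM_eq_toroidal_IM:
  assumes "r \<noteq> 1" "c0 * c1 \<noteq> 0" and pbar: "pbar * inverse q = p"
    and pbar1: "of_real pbar1 * of_real (p * inverse q) powr of_int (Hzero \<mu> I1 k)
           = of_real x powr (2 * pihat r (k, l))"
    and "\<psi> \<in> sector k"
  shows "elliptic_IM x r s ((\<nu> + \<mu>) mod 2) N (identify matching_map k l \<psi>) =
    states_scal (im_ratio x r s (c0 * c1) \<mu> k l \<nu> N)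
      (identify matching_map k l (toroidal_IM q d pbar pbar1 c0 c1 \<mu> \<nu> N \<psi>))"
proof -
  obtain f where \<psi>: "\<psi> = Poly_Mapping.single k f" using assms(5) by (auto simp: sector_def)
  define \<rho> where "\<rho> = im_ratio x r s (c0 * c1) \<mu> k l \<nu> N"
  have \<rho>: "\<rho> \<noteq> 0" unfolding \<rho>_def by (rule im_ratio_nonzero [OF assms(2)])
  define Ke where "Ke = (\<lambda>(a, b) L. ell_kernel x r s ((\<nu> + \<mu>) mod 2) N
      (\<lambda>j. ucoord x (a j)) (\<lambda>j. ucoord x (b j)) (pihat r L))"
  define Kt where "Kt = (\<lambda>(a, b) k. tor_kernel q d p pbar1 \<nu> N
      (\<lambda>j. cis (2 * pi * a j)) (\<lambda>j. cis (2 * pi * b j)) (Hzero \<mu> I1 k))"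
  define ze where "ze = (\<lambda>(a, b). zero_mode_factor
      (ell_vertices N (\<lambda>j. ucoord x (a j)) (\<lambda>j. ucoord x (b j))) (k, l))"
  define zt where "zt = (\<lambda>(a, b). zero_mode_factor
      (tor_vertices c0 c1 \<mu> N (\<lambda>j. cis (2 * pi * a j)) (\<lambda>j. cis (2 * pi * b j))) k)"
  define W where "W = (\<lambda>\<theta> ns. scal (Kt \<theta> k * zt \<theta>) (case \<theta> of (a, b) \<Rightarrow>
      oscillator_product (tor_vertices c0 c1 \<mu> N (\<lambda>j. cis (2 * pi * a j)) (\<lambda>j. cis (2 * pi * b j))) ns f))"
  define T where "T = (\<lambda>g. scal \<rho> (matching_map g))"
  define T' where "T' = (\<lambda>g. scal (1 / \<rho>) (unmatching_map g))"
  have kernels: "Ke \<theta> (k, l) * ze \<theta> = \<rho> * (Kt \<theta> k * zt \<theta>)" for \<theta>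
    using integrand_identity [OF assms(1,2) pbar1]
    by (cases \<theta>) (simp add: Ke_def Kt_def ze_def zt_def \<rho>_def cis_eq_xp del: Hzero.simps)
  have "current_integral N (ell_currents N) Ke (Poly_Mapping.single (k, l) (matching_map f)) =
      Poly_Mapping.single (k, l) (T (Poly_Mapping.lookup
        (current_integral N (tor_currents c0 c1 \<mu> N) Kt (Poly_Mapping.single k f)) k))"
  proof (rule current_integral_transport)
    show "fock_linear T" "row_finite T" "fock_linear T'" "row_finite T'"
      unfolding T_def T'_def matching_map_def unmatching_map_def
      by (intro fock_linear_scaled row_finite_scaled fock_linear_oscillator_subst
          row_finite_oscillator_subst)+
    show "T' (T g) = g" for g
      using \<rho> by (simp add: T_def T'_def unmatching_map_def scal_simps(7)
          fock_linear_scal [OF fock_linear_oscillator_subst] unmatching_matching [unfolded unmatching_map_def])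
    show "map fst (ell_currents N \<theta>) = map fst (tor_currents c0 c1 \<mu> N \<theta>)" for \<theta>
      by (cases \<theta>) (simp add: ell_vertices_def tor_vertices_def vertex_current_def
          powr_eq_xp cis_eq_xp del: upt_Suc)
    show "mode_product (tor_currents c0 c1 \<mu> N \<theta>) ns (zero_mode (Kt \<theta>) (\<lambda>L. L) (Poly_Mapping.single k f)) =
        Poly_Mapping.single k (W \<theta> ns)"
      if "length ns = length (tor_currents c0 c1 \<mu> N \<theta>)" for \<theta> ns
      unfolding mode_product_tor_currents [OF that] by (cases \<theta>) (simp add: W_def zt_def)
    show "mode_product (ell_currents N \<theta>) ns (zero_mode (Ke \<theta>) (\<lambda>L. L)
          (Poly_Mapping.single (k, l) (matching_map f))) = Poly_Mapping.single (k, l) (T (W \<theta> ns))"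
      if "length ns = length (tor_currents c0 c1 \<mu> N \<theta>)" for \<theta> ns
    proof -
      obtain a b where \<theta>: "\<theta> = (a, b)" by (cases \<theta>)
      have "length ns = length (ell_currents N \<theta>)"
        using that by (simp add: \<theta> ell_vertices_def tor_vertices_def)
      from mode_product_ell_currents [OF this] show ?thesis
        using kernels [of \<theta>] oscillator_product_matching [of c0 c1 \<mu> N
          "\<lambda>j. cis (2 * pi * a j)" "\<lambda>j. cis (2 * pi * b j)" ns f "\<lambda>j. ucoord x (a j)" "\<lambda>j. ucoord x (b j)"]
        by (simp add: \<theta> W_def T_def ze_def scal_simps(7) fock_linear_scal [OF fock_linear_matching_map])
    qed
  qed
  then show ?thesis
    unfolding elliptic_IM_eq toroidal_IM_eq [OF pbar] Ke_def [symmetric] Kt_def [symmetric]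
      \<rho>_def [symmetric] identify_def states_scal_def zero_mode_single \<psi> T_def
    by simp
qed

end

theorem corollary4p3:
  fixes x r s q d pbar pbar1 :: real and v c0 c1 :: complex and \<mu> k l :: int
  assumes "0 < x" "x < 1" "0 < r" "r < 1" "0 < s" "s < 2"
    and "\<mu> \<in> {0, 1}" and "v \<noteq> 0"
    and "q = inverse x"
    and "inverse q * d = x powr (2 - s)"
    and "q\<^sup>2 = x powr (- 2)"
    and "inverse q * inverse d = x powr s"
    and "pbar * inverse q = x powr (2 * r)"
    and "of_real pbar1 * of_real (pbar * inverse q * inverse q) powr of_int (Hzero \<mu> I1 k)
           = of_real x powr (2 * pihat r (k, l))"
    and "c0 * c1 = of_real (inverse q * d) * v"
  shows "(\<forall>\<nu>\<in>{0, 1}. \<forall>N. \<forall>\<psi>\<in>sector (k, l). elliptic_IM x r s \<nu> N \<psi> \<in> sector (k, l))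
    \<and> (\<forall>\<nu>\<in>{0, 1}. \<forall>N. \<forall>\<psi>\<in>sector k.
         toroidal_IM q d pbar pbar1 c0 c1 \<mu> \<nu> N \<psi> \<in> sector k)
    \<and> (\<exists>!\<Phi>. matches_oscillators x r s q d \<Phi>)
    \<and> (\<forall>\<Phi>. matches_oscillators x r s q d \<Phi> \<longrightarrow>
         (\<forall>\<nu>\<in>{0, 1}. \<forall>N. \<forall>\<psi>\<in>sector k.
            elliptic_IM x r s ((\<nu> + \<mu>) mod 2) N (identify \<Phi> k l \<psi>) =
            states_scal (im_ratio x r s (c0 * c1) \<mu> k l \<nu> N)
              (identify \<Phi> k l (toroidal_IM q d pbar pbar1 c0 c1 \<mu> \<nu> N \<psi>))))"
proof -
  have "x * d = x powr (2 - s)" using assms(9,10) by simp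
  moreover have "x * x powr (1 - s) = x powr (2 - s)"
    using assms(1) powr_mult_base [of x "1 - s"] by (simp add: algebra_simps)
  ultimately have d: "d = x powr (1 - s)"
    using assms(1) by (metis mult_cancel_left less_irrefl)
  interpret matched_parameters x r s q d "x powr (2 * r)"
    by unfold_locales (use assms d in auto)
  have c: "c0 * c1 \<noteq> 0"
    using assms(1,8,9,15) d by simp
  have pbar1: "of_real pbar1 * of_real (x powr (2 * r) * inverse q) powr of_int (Hzero \<mu> I1 k)
      = of_real x powr (2 * pihat r (k, l))"
    using assms(14) unfolding assms(13) .
  have r: "r \<noteq> 1" using assms(4) by simp
  show ?thesis
    unfolding matches_oscillators_iff_matching_map
    using elliptic_IM_in_sector toroidal_IM_in_sector [OF assms(13)]
      elliptic_IM_eq_toroidal_IM [OF r c assms(13) pbar1]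
    by blast
qed

end
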